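(* Let $(M,L)$ be a Finsler manifold with Finsler metric $g$, let $D^\diamond$ be its Chern (Rund) connection with hv-curvature $P^\diamond$, and let $T$ and $\widehat P$ be the (h)hv-torsion and (v)hv-torsion of the Cartan connection. Then for all $\pi$-vector fields $X,Y,Z,W$: (a) $P^\diamond(X,Y,Z,W)+P^\diamond(X,Y,W,Z)=2(D^\diamond_{\beta X}T)(Y,Z,W)-2T(\widehat{P^\diamond}(X,Y),Z,W)$; (b) $P^\diamond(X,Y)Z=P^\diamond(Z,Y)X$; (c) $P^\diamond(X,Y,Z,W)=(D^\diamond_{\beta X}T)(Y,Z,W)+(D^\diamond_{\beta Z}T)(Y,W,X)-(D^\diamond_{\beta W}T)(Y,X,Z)+T(\widehat{P^\diamond}(W,Y),X,Z)-T(\widehat{P^\diamond}(X,Y),Z,W)-T(\widehat{P^\diamond}(Z,Y),W,X)$; (d) $\widehat{P^\diamond}(\eta,X)=0$; (e) $\widehat{P^\diamond}(X,Y)=\widehat P(X,Y)=(D^\diamond_{\beta\eta}T)(X,Y)$; (f) $\widehat{P^\diamond}$ is symmetric: $\widehat{P^\diamond}(X,Y)=\widehat{P^\diamond}(Y,X)$; (g) $P^\diamond(X,\eta)Y=0$ and $P^\diamond(\eta,X)Y=(D^\diamond_{\beta\eta}T)(X,Y)$; (h) $(D^\diamond_{\gamma X}P^\diamond)(Z,Y,W)=(D^\diamond_{\gamma Y}P^\diamond)(Z,X,W)$; (i) $(D^\diamond_{\gamma\eta}P^\diamond)(X,Y,Z)=-P^\diamond(X,Y)Z$.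
   Context: $M$ is a real paracompact $C^\infty$ manifold of finite dimension, $\mathcal TM\subset TM$ is the set of nonzero tangent vectors, $\pi:\mathcal TM\to M$ the projection, $\pi^{-1}(TM)\to\mathcal TM$ the pullback of $TM$ by $\pi$; everything is $C^\infty$. Sections of $\pi^{-1}(TM)$ are called $\pi$-vector fields. $\eta$ is the $\pi$-vector field $\eta(u)=(u,u)$. $\rho:T(\mathcal TM)\to\pi^{-1}(TM)$ is $\rho(A)=(u,d\pi(A))$ for $A\in T_u(\mathcal TM)$, and $\gamma:\pi^{-1}(TM)\to T(\mathcal TM)$ is the vertical lift $\gamma(u,v)=\frac{d}{dt}|_{t=0}(u+tv)$; $V=\ker\rho=\operatorname{im}\gamma$. $(M,L)$ is a Finsler manifold: $L:TM\to[0,\infty)$ is smooth and positive on $\mathcal TM$, positively homogeneous of degree 1 on fibres, and the fibrewise Hessian of $E=\frac12L^2$ is positive definite on $\mathcal TM$; this Hessian (in coordinates $g_{ij}=\frac12\partial^2L^2/\partial y^i\partial y^j$) is the Finsler metric $g$ on $\pi^{-1}(TM)$. For a linear connection $D$ on $\pi^{-1}(TM)$, put $K(A)=D_A\eta$ and $H=\ker K$. $D$ is regular if $T(\mathcal TM)=V\oplus H$; then $\beta:=(\rho|_H)^{-1}:\pi^{-1}(TM)\to H$. Torsion: $\mathbf T(A,B)=D_A\rho B-D_B\rho A-\rho[A,B]$; curvature (note the sign): $\mathbf K(A,B)\rho C=-D_AD_B\rho C+D_BD_A\rho C+D_{[A,B]}\rho C$. $Q(X,Y)=\mathbf T(\beta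 X,\beta Y)$, $T(X,Y)=\mathbf T(\gamma X,\beta Y)$; h-, hv-, v-curvatures $R(X,Y)Z=\mathbf K(\beta X,\beta Y)Z$, $P(X,Y)Z=\mathbf K(\beta X,\gamma Y)Z$, $S(X,Y)Z=\mathbf K(\gamma X,\gamma Y)Z$; a hat denotes contraction with $\eta$: $\widehat P(X,Y)=P(X,Y)\eta$, etc. The Cartan connection $\nabla$ is the unique regular connection on $\pi^{-1}(TM)$ with $\nabla g=0$, $Q=0$, and $g(T(X,Y),Z)=g(T(X,Z),Y)$; unadorned $T,P,\widehat P,K,\beta$ refer to $\nabla$. The Chern connection $D^\diamond$ is the unique regular connection on $\pi^{-1}(TM)$ such that $(D^\diamond_Ag)(Y,Z)=2g(T(K^\diamond A,Y),Z)$ and $\mathbf T^\diamond=0$; objects with $^\diamond$ are those of $D^\diamond$. Known facts: $\beta^\diamond=\beta$, $K^\diamond=K$, and $D^\diamond_AY=\nabla_AY-T(KA,Y)$. Notation: $P^\diamond(X,Y,Z,W):=g(P^\diamond(X,Y)Z,W)$, $T(X,Y,Z):=g(T(X,Y),Z)$; $(D^\diamond_AT)(X,Y,Z)$ is the covariant derivative of this scalar-valued trilinear form, while $(D^\diamond_AT)(X,Y)=D^\diamond_A(T(X,Y))-T(D^\diamond_AX,Y)-T(X,D^\diamond_AY)$. $(D^\diamond_AP^\diamond)(X,Y,Z)$ is the vector-valued covariant derivative of $(X,Y,Z)\mapsto P^\diamond(X,Y)Z$. *)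

theory Defs
  imports "HOL-Analysis.Analysis" "HOL-Library.Function_Algebras"
begin

section \<open>Smooth maps between open subsets of Euclidean spaces\<close>

primrec Ck_on ::
  "nat \<Rightarrow> 'a::real_normed_vector set \<Rightarrow> ('a \<Rightarrow> 'b::real_normed_vector) \<Rightarrow> bool" where
  "Ck_on 0 S f \<longleftrightarrow> continuous_on S f"
| "Ck_on (Suc k) S f \<longleftrightarrow> (\<forall>x\<in>S. f differentiable (at x)) \<and>
     (\<forall>v. Ck_on k S (\<lambda>x. frechet_derivative f (at x) v))"

text \<open>Only used for open \<open>S\<close> in a Euclidean space.\<close>

definition smooth_on :: "'a::real_normed_vector set \<Rightarrow> ('a \<Rightarrow> 'b::real_normed_vector) \<Rightarrow> bool" where
  "smooth_on S f \<longleftrightarrow> (\<forall>k. Ck_on k S f)"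


section \<open>Smooth manifolds\<close>

text \<open>A chart is a pair of its domain and its coordinate map; the values of the coordinate map
  outside the domain are irrelevant.  The model space \<open>'e\<close> is an arbitrary Euclidean space, so the
  dimension is \<open>DIM('e)\<close>.\<close>

type_synonym ('p, 'e) chart = "'p set \<times> ('p \<Rightarrow> 'e)"
type_synonym ('p, 'e) atlas = "('p, 'e) chart set"

abbreviation cdom :: "('p, 'e) chart \<Rightarrow> 'p set" where "cdom c \<equiv> fst c"
abbreviation cmap :: "('p, 'e) chart \<Rightarrow> 'p \<Rightarrow> 'e" where "cmap c \<equiv> snd c"
abbreviation crange :: "('p, 'e) chart \<Rightarrow> 'e set" where "crange c \<equiv> cmap c ` cdom c"
abbreviation cinv :: "('p, 'e) chart \<Rightarrow> 'e \<Rightarrow> 'p" where "cinv c \<equiv> inv_into (cdom c) (cmap c)"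

definition points :: "('p, 'e) atlas \<Rightarrow> 'p set" where
  "points \<B> = (\<Union>c\<in>\<B>. cdom c)"

definition paracompact_space :: "'p topology \<Rightarrow> bool" where
  "paracompact_space M \<longleftrightarrow>
     (\<forall>\<U>. (\<forall>U\<in>\<U>. openin M U) \<and> \<Union>\<U> = topspace M \<longrightarrow>
       (\<exists>\<V>. (\<forall>V\<in>\<V>. openin M V \<and> (\<exists>U\<in>\<U>. V \<subseteq> U)) \<and> \<Union>\<V> = topspace M \<and>
            locally_finite_in M \<V>))"

definition smooth_atlas :: "'p topology \<Rightarrow> ('p, 'e::euclidean_space) atlas \<Rightarrow> bool" where
  "smooth_atlas M \<A> \<longleftrightarrow>
     points \<A> = topspace M \<and>
     (\<forall>c\<in>\<A>. openin M (cdom c) \<and> open (crange c) \<and>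
        homeomorphic_map (subtopology M (cdom c)) (top_of_set (crange c)) (cmap c)) \<and>
     (\<forall>c\<in>\<A>. \<forall>d\<in>\<A>. smooth_on (cmap c ` (cdom c \<inter> cdom d)) (cmap d \<circ> cinv c))"

definition smooth_manifold :: "'p topology \<Rightarrow> ('p, 'e::euclidean_space) atlas \<Rightarrow> bool" where
  "smooth_manifold M \<A> \<longleftrightarrow> Hausdorff_space M \<and> paracompact_space M \<and> smooth_atlas M \<A>"

definition smooth_fun :: "('p, 'e::euclidean_space) atlas \<Rightarrow> ('p \<Rightarrow> real) \<Rightarrow> bool" where
  "smooth_fun \<B> f \<longleftrightarrow> (\<forall>c\<in>\<B>. smooth_on (crange c) (f \<circ> cinv c))"

text \<open>A tangent vector at \<open>p\<close> is the family of its components in all charts of the atlas around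
  \<open>p\<close>, related by the Jacobians of the chart transitions.  The components for charts not containing
  \<open>p\<close> are set to \<open>0\<close>, so that equality and pointwise addition of families are equality and
  addition of tangent vectors.\<close>

type_synonym ('p, 'e) tvec = "('p, 'e) chart \<Rightarrow> 'e"

definition tscale :: "real \<Rightarrow> ('p, 'e::real_vector) tvec \<Rightarrow> ('p, 'e) tvec" (infixr "*\<^sub>t" 75) where
  "r *\<^sub>t v = (\<lambda>c. r *\<^sub>R v c)"

definition transition_deriv ::
  "('p, 'e::euclidean_space) chart \<Rightarrow> ('p, 'e) chart \<Rightarrow> 'p \<Rightarrow> 'e \<Rightarrow> 'e" where
  "transition_deriv c d p = frechet_derivative (cmap d \<circ> cinv c) (at (cmap c p))"

definition tangent_space :: "('p, 'e::euclidean_space) atlas \<Rightarrow> 'p \<Rightarrow> ('p, 'e) tvec set" where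
  "tangent_space \<B> p =
     {v. (\<forall>c\<in>\<B>. \<forall>d\<in>\<B>. p \<in> cdom c \<inter> cdom d \<longrightarrow> v d = transition_deriv c d p (v c)) \<and>
         (\<forall>c. \<not> (c \<in> \<B> \<and> p \<in> cdom c) \<longrightarrow> v c = 0)}"

text \<open>The tangent vector at \<open>p\<close> whose components in the chart \<open>c\<close> are \<open>w\<close>.\<close>

definition coord_vec ::
  "('p, 'e::euclidean_space) atlas \<Rightarrow> ('p, 'e) chart \<Rightarrow> 'e \<Rightarrow> 'p \<Rightarrow> ('p, 'e) tvec" where
  "coord_vec \<B> c w p = (\<lambda>d. if d \<in> \<B> \<and> p \<in> cdom d then transition_deriv c d p w else 0)"

text \<open>The velocity at time \<open>0\<close> of a curve.\<close>

definition velocity :: "('p, 'e::euclidean_space) atlas \<Rightarrow> (real \<Rightarrow> 'p) \<Rightarrow> ('p, 'e) tvec" where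
  "velocity \<B> \<kappa> =
     (\<lambda>c. if c \<in> \<B> \<and> \<kappa> 0 \<in> cdom c then vector_derivative (cmap c \<circ> \<kappa>) (at 0) else 0)"

definition chart_at :: "('p, 'e) atlas \<Rightarrow> 'p \<Rightarrow> ('p, 'e) chart" where
  "chart_at \<B> p = (SOME c. c \<in> \<B> \<and> p \<in> cdom c)"

text \<open>The differential at \<open>p\<close> of a smooth map between manifolds, and of a smooth function; by
  the chain rule the choice of the chart around \<open>p\<close> does not matter.\<close>

definition differential ::
  "('p, 'e::euclidean_space) atlas \<Rightarrow> ('q, 'f::euclidean_space) atlas \<Rightarrow> ('p \<Rightarrow> 'q) \<Rightarrow>
   'p \<Rightarrow> ('p, 'e) tvec \<Rightarrow> ('q, 'f) tvec" where
  "differential \<B> \<C> F p a = (let c = chart_at \<B> p in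
     (\<lambda>d. if d \<in> \<C> \<and> F p \<in> cdom d
          then frechet_derivative (cmap d \<circ> F \<circ> cinv c) (at (cmap c p)) (a c) else 0))"

definition fun_differential ::
  "('p, 'e::euclidean_space) atlas \<Rightarrow> ('p \<Rightarrow> real) \<Rightarrow> 'p \<Rightarrow> ('p, 'e) tvec \<Rightarrow> real" where
  "fun_differential \<B> f p a = (let c = chart_at \<B> p in
     frechet_derivative (f \<circ> cinv c) (at (cmap c p)) (a c))"

text \<open>Vector fields are extended by \<open>0\<close> outside the manifold, so that they are equal as soon as
  they agree on it.\<close>

definition vector_fields ::
  "('p, 'e::euclidean_space) atlas \<Rightarrow> ('p \<Rightarrow> ('p, 'e) tvec) set" where
  "vector_fields \<B> =
     {V. (\<forall>p\<in>points \<B>. V p \<in> tangent_space \<B> p) \<and> (\<forall>p. p \<notin> points \<B> \<longrightarrow> V p = 0) \<and>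
         (\<forall>c\<in>\<B>. smooth_on (crange c) (\<lambda>x. V (cinv c x) c))}"

definition field_act ::
  "('p, 'e::euclidean_space) atlas \<Rightarrow> ('p \<Rightarrow> ('p, 'e) tvec) \<Rightarrow> ('p \<Rightarrow> real) \<Rightarrow> 'p \<Rightarrow> real" where
  "field_act \<B> V f = (\<lambda>p. if p \<in> points \<B> then fun_differential \<B> f p (V p) else 0)"

text \<open>In coordinates, \<open>[V,W]\<^sup>i = V\<^sup>j \<partial>\<^sub>jW\<^sup>i - W\<^sup>j \<partial>\<^sub>jV\<^sup>i\<close>.\<close>

definition lie_bracket ::
  "('p, 'e::euclidean_space) atlas \<Rightarrow> ('p \<Rightarrow> ('p, 'e) tvec) \<Rightarrow> ('p \<Rightarrow> ('p, 'e) tvec) \<Rightarrow>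
   'p \<Rightarrow> ('p, 'e) tvec" where
  "lie_bracket \<B> V W p = (\<lambda>c. if c \<in> \<B> \<and> p \<in> cdom c
     then frechet_derivative (\<lambda>x. W (cinv c x) c) (at (cmap c p)) (V p c)
        - frechet_derivative (\<lambda>x. V (cinv c x) c) (at (cmap c p)) (W p c)
     else 0)"


section \<open>The slit tangent bundle and the pullback bundle\<close>

type_synonym ('m, 'e) tpoint = "'m \<times> ('m, 'e) tvec"
type_synonym ('m, 'e) ttvec = "(('m, 'e) tpoint, 'e \<times> 'e) tvec"

definition tangent_bundle :: "('m, 'e::euclidean_space) atlas \<Rightarrow> ('m, 'e) tpoint set" where
  "tangent_bundle \<A> = {(p, v). p \<in> points \<A> \<and> v \<in> tangent_space \<A> p}"

definition slit_bundle :: "('m, 'e::euclidean_space) atlas \<Rightarrow> ('m, 'e) tpoint set" where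
  "slit_bundle \<A> = {(p, v). p \<in> points \<A> \<and> v \<in> tangent_space \<A> p \<and> v \<noteq> 0}"

definition slit_chart ::
  "('m, 'e::euclidean_space) atlas \<Rightarrow> ('m, 'e) chart \<Rightarrow> (('m, 'e) tpoint, 'e \<times> 'e) chart" where
  "slit_chart \<A> c = ({(p, v). (p, v) \<in> slit_bundle \<A> \<and> p \<in> cdom c}, \<lambda>(p, v). (cmap c p, v c))"

definition slit_atlas ::
  "('m, 'e::euclidean_space) atlas \<Rightarrow> (('m, 'e) tpoint, 'e \<times> 'e) atlas" where
  "slit_atlas \<A> = slit_chart \<A> ` \<A>"

text \<open>An element \<open>(u, v)\<close> of the pullback of the tangent bundle consists of \<open>u\<close> in the slit
  bundle and a tangent vector \<open>v\<close> at the base point \<open>fst u\<close>.  A section is represented by its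
  second component \<open>u \<mapsto> v\<close>, extended by \<open>0\<close> outside the slit bundle; it is smooth iff its
  components in the induced bundle charts are.\<close>

type_synonym ('m, 'e) pi_field = "('m, 'e) tpoint \<Rightarrow> ('m, 'e) tvec"
type_synonym ('m, 'e) slit_field = "('m, 'e) tpoint \<Rightarrow> ('m, 'e) ttvec"

definition pi_fields :: "('m, 'e::euclidean_space) atlas \<Rightarrow> ('m, 'e) pi_field set" where
  "pi_fields \<A> =
     {X. (\<forall>u\<in>slit_bundle \<A>. X u \<in> tangent_space \<A> (fst u)) \<and>
         (\<forall>u. u \<notin> slit_bundle \<A> \<longrightarrow> X u = 0) \<and>
         (\<forall>c\<in>\<A>. smooth_on (crange (slit_chart \<A> c)) (\<lambda>x. X (cinv (slit_chart \<A> c) x) c))}"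

definition eta :: "('m, 'e::euclidean_space) atlas \<Rightarrow> ('m, 'e) pi_field" where
  "eta \<A> u = (if u \<in> slit_bundle \<A> then snd u else 0)"

definition rho_at ::
  "('m, 'e::euclidean_space) atlas \<Rightarrow> ('m, 'e) tpoint \<Rightarrow> ('m, 'e) ttvec \<Rightarrow> ('m, 'e) tvec" where
  "rho_at \<A> u a = differential (slit_atlas \<A>) \<A> fst u a"

definition rho :: "('m, 'e::euclidean_space) atlas \<Rightarrow> ('m, 'e) slit_field \<Rightarrow> ('m, 'e) pi_field" where
  "rho \<A> V = (\<lambda>u. if u \<in> slit_bundle \<A> then rho_at \<A> u (V u) else 0)"

definition gamma_at ::
  "('m, 'e::euclidean_space) atlas \<Rightarrow> ('m, 'e) tpoint \<Rightarrow> ('m, 'e) tvec \<Rightarrow> ('m, 'e) ttvec" where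
  "gamma_at \<A> u v = velocity (slit_atlas \<A>) (\<lambda>t. (fst u, snd u + t *\<^sub>t v))"

definition gamma :: "('m, 'e::euclidean_space) atlas \<Rightarrow> ('m, 'e) pi_field \<Rightarrow> ('m, 'e) slit_field" where
  "gamma \<A> X = (\<lambda>u. if u \<in> slit_bundle \<A> then gamma_at \<A> u (X u) else 0)"


section \<open>Linear connections on the pullback bundle\<close>

text \<open>\<open>D Y u a\<close> is the covariant derivative of the section \<open>Y\<close> at \<open>u\<close> in the direction of the
  tangent vector \<open>a\<close> of the slit bundle at \<open>u\<close>.  Thus \<open>D\<close> sends a section \<open>Y\<close> to a smooth 1-form
  with values in the pullback bundle; smoothness is that of its components in the coordinate
  frames.\<close>

type_synonym ('m, 'e) connection =
  "('m, 'e) pi_field \<Rightarrow> ('m, 'e) tpoint \<Rightarrow> ('m, 'e) ttvec \<Rightarrow> ('m, 'e) tvec"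

definition linear_connection ::
  "('m, 'e::euclidean_space) atlas \<Rightarrow> ('m, 'e) connection \<Rightarrow> bool" where
  "linear_connection \<A> D \<longleftrightarrow>
     (\<forall>Y\<in>pi_fields \<A>.
        (\<forall>u\<in>slit_bundle \<A>. \<forall>a\<in>tangent_space (slit_atlas \<A>) u.
           D Y u a \<in> tangent_space \<A> (fst u) \<and>
           (\<forall>b\<in>tangent_space (slit_atlas \<A>) u. D Y u (a + b) = D Y u a + D Y u b) \<and>
           (\<forall>r. D Y u (r *\<^sub>t a) = r *\<^sub>t D Y u a)) \<and>
        (\<forall>c\<in>\<A>. \<forall>w. smooth_on (crange (slit_chart \<A> c))
           (\<lambda>x. let u = cinv (slit_chart \<A> c) x
                in D Y u (coord_vec (slit_atlas \<A>) (slit_chart \<A> c) w u) c))) \<and>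
     (\<forall>Y\<in>pi_fields \<A>. \<forall>Z\<in>pi_fields \<A>. \<forall>u\<in>slit_bundle \<A>. \<forall>a\<in>tangent_space (slit_atlas \<A>) u.
        D (Y + Z) u a = D Y u a + D Z u a) \<and>
     (\<forall>Y\<in>pi_fields \<A>. \<forall>f. smooth_fun (slit_atlas \<A>) f \<longrightarrow>
        (\<forall>u\<in>slit_bundle \<A>. \<forall>a\<in>tangent_space (slit_atlas \<A>) u.
           D (\<lambda>u. f u *\<^sub>t Y u) u a =
             fun_differential (slit_atlas \<A>) f u a *\<^sub>t Y u + f u *\<^sub>t D Y u a))"

definition cov ::
  "('m, 'e::euclidean_space) atlas \<Rightarrow> ('m, 'e) connection \<Rightarrow>
   ('m, 'e) slit_field \<Rightarrow> ('m, 'e) pi_field \<Rightarrow> ('m, 'e) pi_field" where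
  "cov \<A> D V Y = (\<lambda>u. if u \<in> slit_bundle \<A> then D Y u (V u) else 0)"

definition vertical_space ::
  "('m, 'e::euclidean_space) atlas \<Rightarrow> ('m, 'e) tpoint \<Rightarrow> ('m, 'e) ttvec set" where
  "vertical_space \<A> u = {a \<in> tangent_space (slit_atlas \<A>) u. rho_at \<A> u a = 0}"

text \<open>The connection map \<open>K\<close>, on vectors and on vector fields.\<close>

definition conn_map_at ::
  "('m, 'e::euclidean_space) atlas \<Rightarrow> ('m, 'e) connection \<Rightarrow>
   ('m, 'e) tpoint \<Rightarrow> ('m, 'e) ttvec \<Rightarrow> ('m, 'e) tvec" where
  "conn_map_at \<A> D u a = D (eta \<A>) u a"

definition conn_map ::
  "('m, 'e::euclidean_space) atlas \<Rightarrow> ('m, 'e) connection \<Rightarrow> ('m, 'e) slit_field \<Rightarrow>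
   ('m, 'e) pi_field" where
  "conn_map \<A> D V = cov \<A> D V (eta \<A>)"

definition horizontal_space ::
  "('m, 'e::euclidean_space) atlas \<Rightarrow> ('m, 'e) connection \<Rightarrow> ('m, 'e) tpoint \<Rightarrow>
   ('m, 'e) ttvec set" where
  "horizontal_space \<A> D u = {a \<in> tangent_space (slit_atlas \<A>) u. conn_map_at \<A> D u a = 0}"

definition regular_connection ::
  "('m, 'e::euclidean_space) atlas \<Rightarrow> ('m, 'e) connection \<Rightarrow> bool" where
  "regular_connection \<A> D \<longleftrightarrow> linear_connection \<A> D \<and>
     (\<forall>u\<in>slit_bundle \<A>.
        vertical_space \<A> u \<inter> horizontal_space \<A> D u = {0} \<and>
        (\<forall>a\<in>tangent_space (slit_atlas \<A>) u.
           \<exists>v\<in>vertical_space \<A> u. \<exists>h\<in>horizontal_space \<A> D u. a = v + h))"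

definition beta ::
  "('m, 'e::euclidean_space) atlas \<Rightarrow> ('m, 'e) connection \<Rightarrow> ('m, 'e) pi_field \<Rightarrow>
   ('m, 'e) slit_field" where
  "beta \<A> D X = (\<lambda>u. if u \<in> slit_bundle \<A>
     then inv_into (horizontal_space \<A> D u) (rho_at \<A> u) (X u) else 0)"

definition torsion ::
  "('m, 'e::euclidean_space) atlas \<Rightarrow> ('m, 'e) connection \<Rightarrow>
   ('m, 'e) slit_field \<Rightarrow> ('m, 'e) slit_field \<Rightarrow> ('m, 'e) pi_field" where
  "torsion \<A> D V W =
     cov \<A> D V (rho \<A> W) - cov \<A> D W (rho \<A> V) - rho \<A> (lie_bracket (slit_atlas \<A>) V W)"

text \<open>Note the sign.\<close>

definition curvature ::
  "('m, 'e::euclidean_space) atlas \<Rightarrow> ('m, 'e) connection \<Rightarrow>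
   ('m, 'e) slit_field \<Rightarrow> ('m, 'e) slit_field \<Rightarrow> ('m, 'e) pi_field \<Rightarrow> ('m, 'e) pi_field" where
  "curvature \<A> D V W Z =
     - cov \<A> D V (cov \<A> D W Z) + cov \<A> D W (cov \<A> D V Z)
     + cov \<A> D (lie_bracket (slit_atlas \<A>) V W) Z"

definition h_torsion ::
  "('m, 'e::euclidean_space) atlas \<Rightarrow> ('m, 'e) connection \<Rightarrow>
   ('m, 'e) pi_field \<Rightarrow> ('m, 'e) pi_field \<Rightarrow> ('m, 'e) pi_field" where
  "h_torsion \<A> D X Y = torsion \<A> D (beta \<A> D X) (beta \<A> D Y)"

definition hv_torsion ::
  "('m, 'e::euclidean_space) atlas \<Rightarrow> ('m, 'e) connection \<Rightarrow>
   ('m, 'e) pi_field \<Rightarrow> ('m, 'e) pi_field \<Rightarrow> ('m, 'e) pi_field" where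
  "hv_torsion \<A> D X Y = torsion \<A> D (gamma \<A> X) (beta \<A> D Y)"

definition hv_curvature ::
  "('m, 'e::euclidean_space) atlas \<Rightarrow> ('m, 'e) connection \<Rightarrow>
   ('m, 'e) pi_field \<Rightarrow> ('m, 'e) pi_field \<Rightarrow> ('m, 'e) pi_field \<Rightarrow> ('m, 'e) pi_field" where
  "hv_curvature \<A> D X Y Z = curvature \<A> D (beta \<A> D X) (gamma \<A> Y) Z"

definition hv_curvature_hat ::
  "('m, 'e::euclidean_space) atlas \<Rightarrow> ('m, 'e) connection \<Rightarrow>
   ('m, 'e) pi_field \<Rightarrow> ('m, 'e) pi_field \<Rightarrow> ('m, 'e) pi_field" where
  "hv_curvature_hat \<A> D X Y = hv_curvature \<A> D X Y (eta \<A>)"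

text \<open>Covariant derivatives of scalar-valued bilinear and trilinear forms, and of vector-valued
  bilinear and trilinear maps, on sections.\<close>

definition cov_form2 ::
  "('m, 'e::euclidean_space) atlas \<Rightarrow> ('m, 'e) connection \<Rightarrow> ('m, 'e) slit_field \<Rightarrow>
   (('m, 'e) pi_field \<Rightarrow> ('m, 'e) pi_field \<Rightarrow> ('m, 'e) tpoint \<Rightarrow> real) \<Rightarrow>
   ('m, 'e) pi_field \<Rightarrow> ('m, 'e) pi_field \<Rightarrow> ('m, 'e) tpoint \<Rightarrow> real" where
  "cov_form2 \<A> D V F X Y =
     field_act (slit_atlas \<A>) V (F X Y) - F (cov \<A> D V X) Y - F X (cov \<A> D V Y)"

definition cov_form3 ::
  "('m, 'e::euclidean_space) atlas \<Rightarrow> ('m, 'e) connection \<Rightarrow> ('m, 'e) slit_field \<Rightarrow>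
   (('m, 'e) pi_field \<Rightarrow> ('m, 'e) pi_field \<Rightarrow> ('m, 'e) pi_field \<Rightarrow> ('m, 'e) tpoint \<Rightarrow> real) \<Rightarrow>
   ('m, 'e) pi_field \<Rightarrow> ('m, 'e) pi_field \<Rightarrow> ('m, 'e) pi_field \<Rightarrow> ('m, 'e) tpoint \<Rightarrow> real" where
  "cov_form3 \<A> D V F X Y Z =
     field_act (slit_atlas \<A>) V (F X Y Z)
     - F (cov \<A> D V X) Y Z - F X (cov \<A> D V Y) Z - F X Y (cov \<A> D V Z)"

definition cov_map2 ::
  "('m, 'e::euclidean_space) atlas \<Rightarrow> ('m, 'e) connection \<Rightarrow> ('m, 'e) slit_field \<Rightarrow>
   (('m, 'e) pi_field \<Rightarrow> ('m, 'e) pi_field \<Rightarrow> ('m, 'e) pi_field) \<Rightarrow>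
   ('m, 'e) pi_field \<Rightarrow> ('m, 'e) pi_field \<Rightarrow> ('m, 'e) pi_field" where
  "cov_map2 \<A> D V F X Y =
     cov \<A> D V (F X Y) - F (cov \<A> D V X) Y - F X (cov \<A> D V Y)"

definition cov_map3 ::
  "('m, 'e::euclidean_space) atlas \<Rightarrow> ('m, 'e) connection \<Rightarrow> ('m, 'e) slit_field \<Rightarrow>
   (('m, 'e) pi_field \<Rightarrow> ('m, 'e) pi_field \<Rightarrow> ('m, 'e) pi_field \<Rightarrow> ('m, 'e) pi_field) \<Rightarrow>
   ('m, 'e) pi_field \<Rightarrow> ('m, 'e) pi_field \<Rightarrow> ('m, 'e) pi_field \<Rightarrow> ('m, 'e) pi_field" where
  "cov_map3 \<A> D V F X Y Z =
     cov \<A> D V (F X Y Z)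
     - F (cov \<A> D V X) Y Z - F X (cov \<A> D V Y) Z - F X Y (cov \<A> D V Z)"


section \<open>Finsler manifolds\<close>

text \<open>The fibrewise Hessian of the energy \<open>L\<^sup>2/2\<close> at \<open>u\<close>.\<close>

definition finsler_metric_at ::
  "(('m, 'e::euclidean_space) tpoint \<Rightarrow> real) \<Rightarrow> ('m, 'e) tpoint \<Rightarrow>
   ('m, 'e) tvec \<Rightarrow> ('m, 'e) tvec \<Rightarrow> real" where
  "finsler_metric_at L u v w =
     deriv (\<lambda>s. deriv (\<lambda>t. (L (fst u, snd u + s *\<^sub>t v + t *\<^sub>t w))\<^sup>2 / 2) 0) 0"

definition finsler_metric ::
  "('m, 'e::euclidean_space) atlas \<Rightarrow> (('m, 'e) tpoint \<Rightarrow> real) \<Rightarrow>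
   ('m, 'e) pi_field \<Rightarrow> ('m, 'e) pi_field \<Rightarrow> ('m, 'e) tpoint \<Rightarrow> real" where
  "finsler_metric \<A> L X Y =
     (\<lambda>u. if u \<in> slit_bundle \<A> then finsler_metric_at L u (X u) (Y u) else 0)"

definition finsler_manifold ::
  "'m topology \<Rightarrow> ('m, 'e::euclidean_space) atlas \<Rightarrow> (('m, 'e) tpoint \<Rightarrow> real) \<Rightarrow> bool" where
  "finsler_manifold M \<A> L \<longleftrightarrow> smooth_manifold M \<A> \<and>
     (\<forall>u\<in>tangent_bundle \<A>. L u \<ge> 0) \<and>
     smooth_fun (slit_atlas \<A>) L \<and> (\<forall>u\<in>slit_bundle \<A>. L u > 0) \<and>
     (\<forall>(p, v)\<in>tangent_bundle \<A>. \<forall>r>0. L (p, r *\<^sub>t v) = r * L (p, v)) \<and>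
     (\<forall>u\<in>slit_bundle \<A>. \<forall>v\<in>tangent_space \<A> (fst u).
        v \<noteq> 0 \<longrightarrow> finsler_metric_at L u v v > 0)"

definition cartan_connection ::
  "('m, 'e::euclidean_space) atlas \<Rightarrow> (('m, 'e) tpoint \<Rightarrow> real) \<Rightarrow> ('m, 'e) connection \<Rightarrow> bool" where
  "cartan_connection \<A> L N \<longleftrightarrow> regular_connection \<A> N \<and>
     (\<forall>V\<in>vector_fields (slit_atlas \<A>). \<forall>Y\<in>pi_fields \<A>. \<forall>Z\<in>pi_fields \<A>.
        cov_form2 \<A> N V (finsler_metric \<A> L) Y Z = 0) \<and>
     (\<forall>X\<in>pi_fields \<A>. \<forall>Y\<in>pi_fields \<A>. h_torsion \<A> N X Y = 0) \<and>
     (\<forall>X\<in>pi_fields \<A>. \<forall>Y\<in>pi_fields \<A>. \<forall>Z\<in>pi_fields \<A>.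
        finsler_metric \<A> L (hv_torsion \<A> N X Y) Z = finsler_metric \<A> L (hv_torsion \<A> N X Z) Y)"

text \<open>\<open>(X, Y, Z) \<mapsto> g(T(X, Y), Z)\<close>\<close>

definition hv_torsion_form ::
  "('m, 'e::euclidean_space) atlas \<Rightarrow> (('m, 'e) tpoint \<Rightarrow> real) \<Rightarrow> ('m, 'e) connection \<Rightarrow>
   ('m, 'e) pi_field \<Rightarrow> ('m, 'e) pi_field \<Rightarrow> ('m, 'e) pi_field \<Rightarrow> ('m, 'e) tpoint \<Rightarrow> real" where
  "hv_torsion_form \<A> L N X Y Z = finsler_metric \<A> L (hv_torsion \<A> N X Y) Z"

text \<open>\<open>(X, Y, Z, W) \<mapsto> g(P(X, Y)Z, W)\<close>\<close>

definition hv_curvature_form ::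
  "('m, 'e::euclidean_space) atlas \<Rightarrow> (('m, 'e) tpoint \<Rightarrow> real) \<Rightarrow> ('m, 'e) connection \<Rightarrow>
   ('m, 'e) pi_field \<Rightarrow> ('m, 'e) pi_field \<Rightarrow> ('m, 'e) pi_field \<Rightarrow> ('m, 'e) pi_field \<Rightarrow>
   ('m, 'e) tpoint \<Rightarrow> real" where
  "hv_curvature_form \<A> L D X Y Z W = finsler_metric \<A> L (hv_curvature \<A> D X Y Z) W"

text \<open>The Chern connection \<open>D\<close>; its definition involves the (h)hv-torsion of the Cartan
  connection \<open>N\<close>.\<close>

definition chern_connection ::
  "('m, 'e::euclidean_space) atlas \<Rightarrow> (('m, 'e) tpoint \<Rightarrow> real) \<Rightarrow> ('m, 'e) connection \<Rightarrow>
   ('m, 'e) connection \<Rightarrow> bool" where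
  "chern_connection \<A> L N D \<longleftrightarrow> regular_connection \<A> D \<and>
     (\<forall>V\<in>vector_fields (slit_atlas \<A>). \<forall>Y\<in>pi_fields \<A>. \<forall>Z\<in>pi_fields \<A>. \<forall>u\<in>slit_bundle \<A>.
        cov_form2 \<A> D V (finsler_metric \<A> L) Y Z u
          = 2 * hv_torsion_form \<A> L N (conn_map \<A> D V) Y Z u) \<and>
     (\<forall>V\<in>vector_fields (slit_atlas \<A>). \<forall>W\<in>vector_fields (slit_atlas \<A>).
        torsion \<A> D V W = 0)"

end

theory Submission
  imports Defs
begin

text \<open>All identities are between global sections, so nothing has to be localised.  The vertical
  derivative of \<open>g\<close> is the third derivative of the energy; hence the torsion \<open>T\<close> of the Cartan connection
  \<open>\<nabla>\<close> is totally symmetric and, by homogeneity, vanishes on \<open>\<eta>\<close>.  Consequently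
  \<open>\<nabla>\<^sub>A Y - T(KA, Y)\<close> is torsion-free, and a Koszul argument identifies it with the Chern connection
  \<open>D\<close>, whose horizontal distribution is therefore that of \<open>\<nabla>\<close>.  For \<open>D\<close>, the first Bianchi identity
  for \<open>\<beta>X\<close>, \<open>\<gamma>Y\<close>, \<open>\<beta>Z\<close> is (b), commuting derivatives of \<open>g\<close> along \<open>\<beta>X\<close> and \<open>\<gamma>Y\<close> gives (a), and (a)
  and (b) together give (c) as for the Christoffel symbols.  Inserting \<open>\<eta>\<close> into (c) yields (d)--(g).
  The second Bianchi identity for \<open>\<gamma>X\<close>, \<open>\<gamma>Y\<close>, \<open>\<beta>Z\<close> is (h), which for \<open>X = \<eta>\<close> becomes (i) by (g).\<close>

section \<open>Calculus of smooth maps\<close>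

text \<open>Two obstacles shape the development. \<open>beta\<close> is a pointwise choice of
  preimages, so its smoothness is not built in: in a chart its vertical component solves a linear
  system whose coefficients are the components of the connection map, and smooth dependence of
  solutions has to be established for such systems. Moreover, the Chern condition refers to the
  connection map of \<open>D\<close> itself. In the Koszul comparison the discrepancy between the
  two connection maps is a second unknown; it enters only through \<open>T\<close>, so that
  inserting \<open>\<eta>\<close>, first in one slot and then in the other, removes it. Global
  sections suffice because equality is tested by the metric: the difference of two sections is
  paired with itself, and no single vector has to be extended to a section. Accordingly the
  algebraic part works over abelian groups with additive operations only, and coordinates are
  confined to the verification of its axioms.\<close>

lemma Ck_on_cong:
  assumes "open S" "\<And>x. x \<in> S \<Longrightarrow> f x = g x" "Ck_on k S f"
  shows "Ck_on k S g"
  using assms(2,3)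
proof (induction k arbitrary: f g)
  case 0
  then show ?case by (metis Ck_on.simps(1) continuous_on_cong)
next
  case (Suc k)
  have diff: "f differentiable (at x)" if "x \<in> S" for x
    using Suc.prems(2) that by auto
  have eq: "frechet_derivative f (at x) = frechet_derivative g (at x)" if "x \<in> S" for x
    using frechet_derivative_transform_within_open[OF diff[OF that] assms(1) that] Suc.prems(1) by blast
  have "g differentiable (at x)" if "x \<in> S" for x
    using diff[OF that] Suc.prems(1) assms(1) that
    by (meson differentiable_def has_derivative_transform_within_open)
  moreover have "Ck_on k S (\<lambda>x. frechet_derivative g (at x) v)" for v
  proof (rule Suc.IH)
    show "Ck_on k S (\<lambda>x. frechet_derivative f (at x) v)" using Suc.prems(2) by simp
  qed (simp only: eq)
  ultimately show ?case by simp
qed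

lemma Ck_on_subset:
  assumes "Ck_on k S f" "T \<subseteq> S"
  shows "Ck_on k T f"
  using assms(1)
proof (induction k arbitrary: f)
  case 0
  then show ?case using assms(2) continuous_on_subset by auto
next
  case (Suc k)
  then show ?case using assms(2) by auto
qed

text \<open>The recursion defining \<open>Ck_on\<close> does not list continuity at positive levels;
  differentiability supplies it at the bottom level, and the induction passes the claim on to the
  derivatives.\<close>

lemma Ck_on_Suc_lower:
  assumes "Ck_on (Suc k) S f"
  shows "Ck_on k S f"
  using assms
proof (induction k arbitrary: f)
  case 0
  then show ?case
    by (auto intro: continuous_at_imp_continuous_on differentiable_imp_continuous_within)
next
  case (Suc k)
  then show ?case by (metis Ck_on.simps(2))
qed

lemma Ck_on_const: "Ck_on k S (\<lambda>x. c)"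
  by (induction k arbitrary: c) simp_all

lemma Ck_on_linear:
  assumes "open S" "bounded_linear L" "Ck_on k S f"
  shows "Ck_on k S (\<lambda>x. L (f x))"
  using assms(3)
proof (induction k arbitrary: f)
  case 0
  then show ?case by (simp add: assms(2) bounded_linear.continuous_on)
next
  case (Suc k)
  have d: "((\<lambda>x. L (f x)) has_derivative (\<lambda>v. L (frechet_derivative f (at x) v))) (at x)"
    if "x \<in> S" for x
    using Suc.prems that bounded_linear.has_derivative[OF assms(2)]
    by (auto simp: frechet_derivative_works)
  have "Ck_on k S (\<lambda>x. frechet_derivative (\<lambda>x. L (f x)) (at x) v)" for v
  proof (rule Ck_on_cong[OF assms(1)])
    show "Ck_on k S (\<lambda>x. L (frechet_derivative f (at x) v))" using Suc by auto
  qed (simp add: frechet_derivative_at[OF d, symmetric])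
  then show ?case using d by (auto simp: differentiable_def)
qed

lemma Ck_on_add:
  assumes "open S" "Ck_on k S f" "Ck_on k S g"
  shows "Ck_on k S (\<lambda>x. f x + g x)"
  using assms(2,3)
proof (induction k arbitrary: f g)
  case 0
  then show ?case by (simp add: continuous_on_add)
next
  case (Suc k)
  have d: "((\<lambda>x. f x + g x) has_derivative
      (\<lambda>v. frechet_derivative f (at x) v + frechet_derivative g (at x) v)) (at x)"
    if "x \<in> S" for x
    using Suc.prems that has_derivative_add by (auto simp: frechet_derivative_works)
  have "Ck_on k S (\<lambda>x. frechet_derivative (\<lambda>x. f x + g x) (at x) v)" for v
  proof (rule Ck_on_cong[OF assms(1)])
    show "Ck_on k S (\<lambda>x. frechet_derivative f (at x) v + frechet_derivative g (at x) v)"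
      using Suc by auto
  qed (simp add: frechet_derivative_at[OF d, symmetric])
  then show ?case using d by (auto simp: differentiable_def)
qed

text \<open>The Leibniz rule pairs each derivative with an undifferentiated factor, which is why
  both factors are also lowered from level k + 1 to k.\<close>

lemma Ck_on_bilinear:
  assumes "open S" "bounded_bilinear B" "Ck_on k S f" "Ck_on k S g"
  shows "Ck_on k S (\<lambda>x. B (f x) (g x))"
  using assms(3,4)
proof (induction k arbitrary: f g)
  case 0
  then show ?case using bounded_bilinear.continuous_on[OF assms(2)] by auto
next
  case (Suc k)
  have low: "Ck_on k S f" "Ck_on k S g" using Suc.prems by (auto intro: Ck_on_Suc_lower)
  have d: "((\<lambda>x. B (f x) (g x)) has_derivative
      (\<lambda>v. B (f x) (frechet_derivative g (at x) v) + B (frechet_derivative f (at x) v) (g x))) (at x)"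
    if "x \<in> S" for x
    using Suc.prems that by (intro bounded_bilinear.FDERIV[OF assms(2)]) (auto simp: frechet_derivative_works)
  have "Ck_on k S (\<lambda>x. frechet_derivative (\<lambda>x. B (f x) (g x)) (at x) v)" for v
  proof (rule Ck_on_cong[OF assms(1)])
    show "Ck_on k S (\<lambda>x. B (f x) (frechet_derivative g (at x) v) + B (frechet_derivative f (at x) v) (g x))"
      using Suc low by (intro Ck_on_add assms(1)) auto
  qed (simp add: frechet_derivative_at[OF d, symmetric])
  then show ?case using d by (auto simp: differentiable_def)
qed

text \<open>Fields are required to be smooth in every chart separately, so general compositions do
  not arise; the slit charts only precompose with the linear projection \<open>fst\<close>.\<close>

lemma Ck_on_compose_linear:
  assumes "bounded_linear L" "open T" "L ` T \<subseteq> S" "Ck_on k S f"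
  shows "Ck_on k T (\<lambda>x. f (L x))"
  using assms(4)
proof (induction k arbitrary: f)
  case 0
  then show ?case
    using continuous_on_compose2[OF _ linear_continuous_on[OF assms(1)] assms(3)] by simp
next
  case (Suc k)
  have d: "((\<lambda>x. f (L x)) has_derivative (\<lambda>v. frechet_derivative f (at (L x)) (L v))) (at x)"
    if "x \<in> T" for x
  proof -
    have "(f has_derivative frechet_derivative f (at (L x))) (at (L x))"
      using Suc.prems that assms(3) by (auto simp: frechet_derivative_works)
    from has_derivative_compose[OF bounded_linear_imp_has_derivative[OF assms(1)] this]
    show ?thesis .
  qed
  have "Ck_on k T (\<lambda>x. frechet_derivative (\<lambda>x. f (L x)) (at x) v)" for v
  proof (rule Ck_on_cong[OF assms(2)])
    show "Ck_on k T (\<lambda>x. frechet_derivative f (at (L x)) (L v))" using Suc by auto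
  qed (simp add: frechet_derivative_at[OF d, symmetric])
  then show ?case using d by (auto simp: differentiable_def)
qed

lemma smooth_on_cong:
  "open S \<Longrightarrow> smooth_on S f \<Longrightarrow> (\<And>x. x \<in> S \<Longrightarrow> f x = g x) \<Longrightarrow> smooth_on S g"
  unfolding smooth_on_def using Ck_on_cong by blast

lemma smooth_on_subset: "smooth_on S f \<Longrightarrow> T \<subseteq> S \<Longrightarrow> smooth_on T f"
  unfolding smooth_on_def using Ck_on_subset by blast

lemma smooth_on_const: "smooth_on S (\<lambda>x. c)"
  unfolding smooth_on_def using Ck_on_const by blast

lemma smooth_on_linear: "open S \<Longrightarrow> bounded_linear L \<Longrightarrow> smooth_on S f \<Longrightarrow> smooth_on S (\<lambda>x. L (f x))"
  unfolding smooth_on_def using Ck_on_linear by blast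

lemma smooth_on_add: "open S \<Longrightarrow> smooth_on S f \<Longrightarrow> smooth_on S g \<Longrightarrow> smooth_on S (\<lambda>x. f x + g x)"
  unfolding smooth_on_def using Ck_on_add by blast

lemma smooth_on_bilinear:
  "open S \<Longrightarrow> bounded_bilinear B \<Longrightarrow> smooth_on S f \<Longrightarrow> smooth_on S g \<Longrightarrow> smooth_on S (\<lambda>x. B (f x) (g x))"
  unfolding smooth_on_def using Ck_on_bilinear by blast

lemma smooth_on_compose_linear:
  "bounded_linear L \<Longrightarrow> open T \<Longrightarrow> L ` T \<subseteq> S \<Longrightarrow> smooth_on S f \<Longrightarrow> smooth_on T (\<lambda>x. f (L x))"
  unfolding smooth_on_def using Ck_on_compose_linear by blast

lemma smooth_on_differentiable: "smooth_on S f \<Longrightarrow> x \<in> S \<Longrightarrow> f differentiable (at x)"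
  unfolding smooth_on_def using Ck_on.simps(2) by blast

lemma smooth_on_has_derivative:
  "smooth_on S f \<Longrightarrow> x \<in> S \<Longrightarrow> (f has_derivative frechet_derivative f (at x)) (at x)"
  using smooth_on_differentiable frechet_derivative_works by blast

lemma smooth_on_continuous: "smooth_on S f \<Longrightarrow> continuous_on S f"
  unfolding smooth_on_def using Ck_on.simps(1) by blast

lemma smooth_on_frechet: "smooth_on S f \<Longrightarrow> smooth_on S (\<lambda>x. frechet_derivative f (at x) v)"
  unfolding smooth_on_def using Ck_on.simps(2) by blast

lemma smooth_on_frechet_linear: "smooth_on S f \<Longrightarrow> x \<in> S \<Longrightarrow> linear (frechet_derivative f (at x))"
  using smooth_on_differentiable linear_frechet_derivative by blast

lemma smooth_on_uminus: "open S \<Longrightarrow> smooth_on S f \<Longrightarrow> smooth_on S (\<lambda>x. - f x)"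
  by (rule smooth_on_linear[where L = uminus]) (auto intro: bounded_linear_minus bounded_linear_ident)

lemma smooth_on_diff: "open S \<Longrightarrow> smooth_on S f \<Longrightarrow> smooth_on S g \<Longrightarrow> smooth_on S (\<lambda>x. f x - g x)"
  using smooth_on_add[OF _ _ smooth_on_uminus, of S f g] by simp

lemma smooth_on_Pair:
  assumes "open S" "smooth_on S f" "smooth_on S g"
  shows "smooth_on S (\<lambda>x. (f x, g x))"
proof -
  have "smooth_on S (\<lambda>x. (f x, 0) + (0, g x))"
    by (intro smooth_on_add assms smooth_on_linear[where L = "\<lambda>v. (v, 0)" and f = f]
        smooth_on_linear[where L = "\<lambda>v. (0, v)" and f = g]
        bounded_linear_Pair bounded_linear_ident bounded_linear_zero)
  then show ?thesis by simp
qed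

lemma smooth_on_ident: "smooth_on S (\<lambda>x. x)"
  unfolding smooth_on_def
proof
  fix k show "Ck_on k S (\<lambda>x. x)" by (cases k) (auto intro: Ck_on_const)
qed

subsection \<open>Families of linear maps\<close>

lemma linear_basis_expansion:
  fixes F :: "'e::euclidean_space \<Rightarrow> 'f::real_vector"
  assumes "linear F"
  shows "F w = (\<Sum>b\<in>Basis. (w \<bullet> b) *\<^sub>R F b)"
  by (subst euclidean_representation[of w, symmetric])
     (simp add: linear_sum[OF assms] linear_cmul[OF assms])

text \<open>Expanding the argument in \<open>Basis\<close> turns the evaluation into a finite sum of
  products, so parameter-dependent linear maps need not be treated as operator-valued
  functions.\<close>

lemma linear_family_Ck:
  fixes F :: "'a::real_normed_vector \<Rightarrow> 'e::euclidean_space \<Rightarrow> 'f::real_normed_vector"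
  assumes "open S" "\<And>x. x \<in> S \<Longrightarrow> linear (F x)" "\<And>w. Ck_on k S (\<lambda>x. F x w)" "Ck_on k S g"
  shows "Ck_on k S (\<lambda>x. F x (g x))"
proof (rule Ck_on_cong[OF assms(1)])
  have "Ck_on k S (\<lambda>x. \<Sum>b\<in>B. (g x \<bullet> b) *\<^sub>R F x b)" for B
    by (induction B rule: infinite_finite_induct)
       (auto intro!: Ck_on_const Ck_on_add assms Ck_on_bilinear[OF _ bounded_bilinear_scaleR]
          Ck_on_linear[OF _ bounded_linear_inner_left])
  then show "Ck_on k S (\<lambda>x. \<Sum>b\<in>Basis. (g x \<bullet> b) *\<^sub>R F x b)" .
qed (simp add: linear_basis_expansion[OF assms(2), symmetric])

lemma smooth_on_linear_family:
  fixes F :: "'a::real_normed_vector \<Rightarrow> 'e::euclidean_space \<Rightarrow> 'f::real_normed_vector"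
  assumes "open S" "\<And>x. x \<in> S \<Longrightarrow> linear (F x)" "\<And>w. smooth_on S (\<lambda>x. F x w)" "smooth_on S g"
  shows "smooth_on S (\<lambda>x. F x (g x))"
  using assms unfolding smooth_on_def by (auto intro: linear_family_Ck)

lemma smooth_on_frechet_field:
  fixes f :: "'a::euclidean_space \<Rightarrow> 'f::real_normed_vector"
  assumes "open S" "smooth_on S f" "smooth_on S g"
  shows "smooth_on S (\<lambda>x. frechet_derivative f (at x) (g x))"
  by (rule smooth_on_linear_family) (auto intro: assms smooth_on_frechet smooth_on_frechet_linear[OF assms(2)])

lemma frechet_derivative_linear_family_expansion:
  fixes F :: "'a::real_normed_vector \<Rightarrow> 'e::euclidean_space \<Rightarrow> 'f::real_normed_vector"
  assumes "open S" "x \<in> S" "\<And>x. x \<in> S \<Longrightarrow> linear (F x)"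
    and "\<And>w. (\<lambda>x. F x w) differentiable (at x)"
  shows "frechet_derivative (\<lambda>y. F y w) (at x) =
    (\<lambda>h. \<Sum>b\<in>Basis. (w \<bullet> b) *\<^sub>R frechet_derivative (\<lambda>y. F y b) (at x) h)"
proof -
  have F': "((\<lambda>y. F y b) has_derivative frechet_derivative (\<lambda>y. F y b) (at x)) (at x)" for b
    using assms(4) by (simp add: frechet_derivative_works[symmetric])
  have "((\<lambda>y. \<Sum>b\<in>Basis. (w \<bullet> b) *\<^sub>R F y b) has_derivative
      (\<lambda>h. \<Sum>b\<in>Basis. (w \<bullet> b) *\<^sub>R frechet_derivative (\<lambda>y. F y b) (at x) h)) (at x)"
    by (intro has_derivative_sum has_derivative_scaleR_right F')
  then have "((\<lambda>y. F y w) has_derivative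
      (\<lambda>h. \<Sum>b\<in>Basis. (w \<bullet> b) *\<^sub>R frechet_derivative (\<lambda>y. F y b) (at x) h)) (at x)"
    by (rule has_derivative_transform_within_open[OF _ assms(1,2)])
       (simp add: linear_basis_expansion[OF assms(3), symmetric])
  then show ?thesis by (rule frechet_derivative_at[symmetric])
qed

text \<open>Lets the differentiated family be evaluated on a moving argument in its turn, which the
  bootstrapping of smoothness below requires.\<close>

lemma linear_frechet_derivative_family:
  fixes F :: "'a::real_normed_vector \<Rightarrow> 'e::euclidean_space \<Rightarrow> 'f::real_normed_vector"
  assumes "open S" "x \<in> S" "\<And>x. x \<in> S \<Longrightarrow> linear (F x)"
    and "\<And>w. (\<lambda>x. F x w) differentiable (at x)"
  shows "linear (\<lambda>w. frechet_derivative (\<lambda>y. F y w) (at x) v)"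
proof -
  have "(\<lambda>w. frechet_derivative (\<lambda>y. F y w) (at x) v) =
      (\<lambda>w. \<Sum>b\<in>Basis. (w \<bullet> b) *\<^sub>R frechet_derivative (\<lambda>y. F y b) (at x) v)"
    by (rule ext) (rule fun_cong[OF frechet_derivative_linear_family_expansion[where F = F, OF assms]])
  moreover have "linear (\<lambda>w. \<Sum>b\<in>Basis. (w \<bullet> b) *\<^sub>R frechet_derivative (\<lambda>y. F y b) (at x) v)"
    by (rule linearI) (simp_all add: inner_add_left scaleR_add_left sum.distrib scaleR_sum_right)
  ultimately show ?thesis by simp
qed

text \<open>Product rule, with the argument frozen in one term and the map frozen in the other,
  obtained by differentiating the basis expansion.\<close>

lemma has_derivative_linear_family:
  fixes F :: "'a::real_normed_vector \<Rightarrow> 'e::euclidean_space \<Rightarrow> 'f::real_normed_vector"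
  assumes "open S" "x \<in> S" "\<And>x. x \<in> S \<Longrightarrow> linear (F x)"
    and "\<And>w. (\<lambda>x. F x w) differentiable (at x)" "(g has_derivative g') (at x)"
  shows "((\<lambda>y. F y (g y)) has_derivative
           (\<lambda>h. frechet_derivative (\<lambda>y. F y (g x)) (at x) h + F x (g' h))) (at x)"
proof -
  let ?F' = "\<lambda>w. frechet_derivative (\<lambda>y. F y w) (at x)"
  have F': "((\<lambda>y. F y w) has_derivative ?F' w) (at x)" for w
    using assms(4) by (simp add: frechet_derivative_works[symmetric])
  have "((\<lambda>y. \<Sum>b\<in>Basis. (g y \<bullet> b) *\<^sub>R F y b) has_derivative
     (\<lambda>h. \<Sum>b\<in>Basis. (g x \<bullet> b) *\<^sub>R ?F' b h + (g' h \<bullet> b) *\<^sub>R F x b)) (at x)"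
    by (intro has_derivative_sum has_derivative_scaleR F' has_derivative_inner_left assms(5))
  then have "((\<lambda>y. F y (g y)) has_derivative
      (\<lambda>h. \<Sum>b\<in>Basis. (g x \<bullet> b) *\<^sub>R ?F' b h + (g' h \<bullet> b) *\<^sub>R F x b)) (at x)"
    by (rule has_derivative_transform_within_open[OF _ assms(1,2)])
       (simp add: linear_basis_expansion[OF assms(3), symmetric])
  then show ?thesis
    by (simp add: frechet_derivative_linear_family_expansion[where F = F, OF assms(1-4), of "g x"] sum.distrib
        linear_basis_expansion[OF assms(3)[OF assms(2)], symmetric])
qed

lemma frechet_derivative_linear_family:
  fixes F :: "'a::real_normed_vector \<Rightarrow> 'e::euclidean_space \<Rightarrow> 'f::real_normed_vector"
  assumes "open S" "x \<in> S" "\<And>x. x \<in> S \<Longrightarrow> linear (F x)"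
    and "\<And>w. (\<lambda>x. F x w) differentiable (at x)" "g differentiable (at x)"
  shows "frechet_derivative (\<lambda>y. F y (g y)) (at x) h =
           frechet_derivative (\<lambda>y. F y (g x)) (at x) h + F x (frechet_derivative g (at x) h)"
  by (rule frechet_derivative_at[OF has_derivative_linear_family[where F = F, OF assms(1-4)
        assms(5)[unfolded frechet_derivative_works]], symmetric, THEN fun_cong])

text \<open>Near \<open>x\<close> the operators \<open>F y\<close> are bounded below uniformly, which makes solutions of
  \<open>F y (h y) = g y\<close> continuous; differentiating the equation then bootstraps smoothness.\<close>

lemma linear_family_solution_continuous:
  fixes F :: "'a::real_normed_vector \<Rightarrow> 'e::euclidean_space \<Rightarrow> 'e"
  assumes "open S" "x \<in> S" "\<And>x. x \<in> S \<Longrightarrow> linear (F x)" "inj (F x)"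
    and "\<And>w. continuous_on S (\<lambda>x. F x w)" "continuous_on S g"
    and "\<And>x. x \<in> S \<Longrightarrow> F x (h x) = g x"
  shows "isCont h x"
proof -
  obtain m where m: "m > 0" "\<And>v. m * norm v \<le> norm (F x v)"
    using linear_inj_bounded_below_pos[OF assms(3)[OF assms(2)] assms(4)] by (metis mult.commute)
  have cont: "isCont (\<lambda>x. F x w) x" "isCont g x" for w
    using assms(1,2,5,6) continuous_on_eq_continuous_at by blast+
  \<comment> \<open>\<open>s y\<close> bounds the operator norm of \<open>F y - F x\<close> through
    finitely many vectors, each of which is continuous in \<open>y\<close>.\<close>
  define s where "s y = (\<Sum>b\<in>Basis. norm (F y b - F x b))" for y
  have s0: "s \<midarrow>x\<rightarrow> 0"
  proof -
    have "(\<lambda>y. norm (F y b - F x b)) \<midarrow>x\<rightarrow> norm (F x b - F x b)" for b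
      by (intro tendsto_intros) (use cont in \<open>simp add: isCont_def\<close>)
    then have "(\<lambda>y. \<Sum>b\<in>Basis. norm (F y b - F x b)) \<midarrow>x\<rightarrow> (\<Sum>b\<in>(Basis::'e set). 0)"
      by (intro tendsto_sum) simp
    then show ?thesis by (simp add: s_def[abs_def])
  qed
  have op: "norm (F y v - F x v) \<le> s y * norm v" if "y \<in> S" for y v
  proof -
    have "F y v - F x v = (\<Sum>b\<in>Basis. (v \<bullet> b) *\<^sub>R (F y b - F x b))"
      using linear_basis_expansion[OF assms(3)[OF that], of v]
        linear_basis_expansion[OF assms(3)[OF assms(2)], of v]
      by (simp add: sum_subtractf scaleR_diff_right)
    also have "norm \<dots> \<le> (\<Sum>b\<in>Basis. norm (F y b - F x b) * norm v)"
      by (intro sum_norm_le)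
         (auto simp: mult.commute[of "norm (_ - _)"] intro!: mult_right_mono Basis_le_norm)
    finally show ?thesis by (simp add: s_def sum_distrib_right)
  qed
  have "\<forall>\<^sub>F y in at x. s y < m / 2" using order_tendstoD(2)[OF s0, of "m / 2"] m(1) by simp
  moreover have "\<forall>\<^sub>F y in at x. y \<in> S" using assms(1,2) eventually_at_in_open' by blast
  \<comment> \<open>Where \<open>s y < m / 2\<close>, the map \<open>F y\<close> keeps half of the
    lower bound \<open>m\<close> of \<open>F x\<close>; this is the origin of the factor
    \<open>2 / m\<close>.\<close>
  ultimately have ev: "\<forall>\<^sub>F y in at x. norm (h y - h x) \<le> norm (g y - F y (h x)) * (2 / m)"
  proof eventually_elim
    case (elim y)
    let ?v = "h y - h x"
    have "m * norm ?v \<le> norm (F y ?v) + s y * norm ?v"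
      using m(2)[of ?v] op[OF elim(2), of ?v] norm_triangle_ineq3[of "F x ?v" "F y ?v"]
      by (smt (verit) norm_minus_commute)
    moreover have "s y * norm ?v \<le> m / 2 * norm ?v" using elim by (intro mult_right_mono) auto
    moreover have "F y ?v = g y - F y (h x)"
      using linear_diff[OF assms(3)[OF elim(2)]] assms(7)[OF elim(2)] by simp
    ultimately show ?case using m(1) by (simp add: field_simps)
  qed
  have "(\<lambda>y. norm (g y - F y (h x)) * (2 / m)) \<midarrow>x\<rightarrow> norm (g x - F x (h x)) * (2 / m)"
    by (intro tendsto_intros) (use cont in \<open>auto simp: isCont_def\<close>)
  then have "(\<lambda>y. norm (g y - F y (h x)) * (2 / m)) \<midarrow>x\<rightarrow> 0"
    using assms(7)[OF assms(2)] by simp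
  then have "(\<lambda>y. h y - h x) \<midarrow>x\<rightarrow> 0"
    by (rule Lim_null_comparison[OF ev])
  then show ?thesis by (simp add: isCont_def LIM_zero_iff)
qed

text \<open>Solving for \<open>h y\<close> with the fixed inverse of \<open>F x\<close> leaves the
  error \<open>c y = (F y - F x) (h y - h x)\<close>. It is a product of two factors vanishing at
  \<open>x\<close>, so its derivative there is 0 although \<open>h\<close> is only known to be
  continuous.\<close>

lemma linear_family_solution_has_derivative:
  fixes F :: "'a::real_normed_vector \<Rightarrow> 'e::euclidean_space \<Rightarrow> 'e"
  assumes "open S" "x \<in> S" "\<And>x. x \<in> S \<Longrightarrow> linear (F x)" "inj (F x)"
    and "\<And>w. (\<lambda>x. F x w) differentiable (at x)" "g differentiable (at x)"
    and "\<And>x. x \<in> S \<Longrightarrow> F x (h x) = g x" "isCont h x"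
  shows "(h has_derivative (\<lambda>v. inv (F x) (frechet_derivative g (at x) v
           - frechet_derivative (\<lambda>y. F y (h x)) (at x) v))) (at x)"
proof -
  have lin: "linear (F x)" using assms(2,3) by blast
  have bl: "bounded_linear (inv (F x))"
    using inj_linear_imp_inv_bounded_linear[OF _ assms(4)] lin linear_conv_bounded_linear by blast
  have F': "((\<lambda>y. F y w) has_derivative frechet_derivative (\<lambda>y. F y w) (at x)) (at x)"
    and g': "(g has_derivative frechet_derivative g (at x)) (at x)" for w
    using assms(5,6) by (simp_all add: frechet_derivative_works[symmetric])
  define c where "c y = (\<Sum>b\<in>Basis. ((h y - h x) \<bullet> b) *\<^sub>R (F y b - F x b))" for y
  \<comment> \<open>The factor \<open>G\<close> grows at most linearly in the distance to
    \<open>x\<close> and \<open>q\<close> tends to 0, so the product is of smaller order than the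
    distance.\<close>
  have small: "((\<lambda>y. q y *\<^sub>R G y) has_derivative (\<lambda>v. 0)) (at x)"
    if q: "isCont q x" "q x = 0" and G: "(G has_derivative G') (at x)" "G x = 0"
    for q :: "'a \<Rightarrow> real" and G :: "'a \<Rightarrow> 'e" and G'
  proof -
    obtain K e where "e > 0" and K: "\<And>y. norm (y - x) < e \<Longrightarrow> norm (G y) \<le> K * norm (y - x)"
    proof -
      obtain B where B: "\<And>v. norm (G' v) \<le> norm v * B" 
        using bounded_linear.bounded[OF has_derivative_bounded_linear[OF G(1)]] by blast
      obtain e where e: "e > 0" "\<And>y. norm (y - x) < e \<Longrightarrow> norm (G y - G x - G' (y - x)) \<le> 1 * norm (y - x)"
        using G(1) unfolding has_derivative_at_alt by (metis zero_less_one)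
      have "norm (G y) \<le> (B + 1) * norm (y - x)" if "norm (y - x) < e" for y
        using e(2)[OF that] B[of "y - x"] norm_triangle_ineq2[of "G y" "G' (y - x)"] G(2)
        by (simp add: algebra_simps)
      with e(1) that show thesis by blast
    qed
    \<comment> \<open>The constant is enlarged to make it positive, so that one may divide by
      it.\<close>
    have Kge: "norm (G y) \<le> (\<bar>K\<bar> + 1) * norm (y - x)" if "norm (y - x) < e" for y
      using K[OF that] by (smt (verit) mult_right_mono norm_ge_zero)
    show ?thesis
      unfolding has_derivative_at_alt
    proof (intro conjI allI impI)
      fix r :: real assume "r > 0"
      then have "r / (\<bar>K\<bar> + 1) > 0" by simp
      with q(1) obtain d where d: "d > 0" "\<And>y. dist y x < d \<Longrightarrow> dist (q y) (q x) < r / (\<bar>K\<bar> + 1)"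
        unfolding continuous_at_eps_delta by blast
      show "\<exists>d>0. \<forall>y. norm (y - x) < d \<longrightarrow> norm (q y *\<^sub>R G y - q x *\<^sub>R G x - 0) \<le> r * norm (y - x)"
      proof (intro exI[of _ "min d e"] conjI allI impI)
        fix y assume y: "norm (y - x) < min d e"
        have "\<bar>q y\<bar> \<le> r / (\<bar>K\<bar> + 1)" using d(2)[of y] y q(2) by (auto simp: dist_norm)
        then have "\<bar>q y\<bar> * norm (G y) \<le> r / (\<bar>K\<bar> + 1) * ((\<bar>K\<bar> + 1) * norm (y - x))"
          using Kge[of y] y by (intro mult_mono) auto
        also have "\<dots> = r * norm (y - x)" by (simp add: add_pos_nonneg field_simps)
        finally show "norm (q y *\<^sub>R G y - q x *\<^sub>R G x - 0) \<le> r * norm (y - x)" using q(2) by simp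
      qed (use d \<open>e > 0\<close> in auto)
    qed (simp add: bounded_linear_zero)
  qed
  have "((\<lambda>y. \<Sum>b\<in>Basis. ((h y - h x) \<bullet> b) *\<^sub>R (F y b - F x b)) has_derivative (\<lambda>v. \<Sum>b\<in>(Basis::'e set). 0)) (at x)"
  proof (rule has_derivative_sum)
    fix b :: 'e assume "b \<in> Basis"
    show "((\<lambda>y. ((h y - h x) \<bullet> b) *\<^sub>R (F y b - F x b)) has_derivative (\<lambda>v. 0)) (at x)"
    proof (rule small)
      show "isCont (\<lambda>y. (h y - h x) \<bullet> b) x" using assms(8) by (intro continuous_intros)
      show "((\<lambda>y. F y b - F x b) has_derivative (\<lambda>v. frechet_derivative (\<lambda>y. F y b) (at x) v - 0)) (at x)"
        by (intro has_derivative_diff F' has_derivative_const)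
    qed auto
  qed
  then have c': "(c has_derivative (\<lambda>v. 0)) (at x)" by (simp add: c_def[abs_def])
  have "((\<lambda>y. h x + inv (F x) (g y - F y (h x) - c y)) has_derivative
      (\<lambda>v. 0 + inv (F x) (frechet_derivative g (at x) v
           - frechet_derivative (\<lambda>y. F y (h x)) (at x) v - 0))) (at x)"
    by (intro has_derivative_add has_derivative_const bounded_linear.has_derivative[OF bl]
        has_derivative_diff F' g' c')
  moreover have "h x + inv (F x) (g y - F y (h x) - c y) = h y" if "y \<in> S" for y
  proof -
    have "c y = F y (h y - h x) - F x (h y - h x)"
      using linear_basis_expansion[OF assms(3)[OF that], of "h y - h x"]
        linear_basis_expansion[OF lin, of "h y - h x"]
      by (simp add: c_def sum_subtractf scaleR_diff_right)
    then have "g y - F y (h x) - c y = F x (h y - h x)"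
      using linear_diff[OF assms(3)[OF that]] assms(7)[OF that] by simp
    then show ?thesis using assms(4) by (simp add: inv_f_f)
  qed
  ultimately show ?thesis
    using has_derivative_transform_within_open[OF _ assms(1,2)] by fastforce
qed

lemma smooth_on_linear_family_solution:
  fixes F :: "'a::real_normed_vector \<Rightarrow> 'e::euclidean_space \<Rightarrow> 'e"
  assumes "open S" "\<And>x. x \<in> S \<Longrightarrow> linear (F x)" "\<And>x. x \<in> S \<Longrightarrow> inj (F x)"
    and F: "\<And>w. smooth_on S (\<lambda>x. F x w)" and "smooth_on S g"
    and "\<And>x. x \<in> S \<Longrightarrow> F x (h x) = g x"
  shows "smooth_on S h"
  unfolding smooth_on_def
proof
  fix k
  have diff: "(\<lambda>x. F x w) differentiable (at x)" if "x \<in> S" for w x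
    using F smooth_on_differentiable that by blast
  have cont: "isCont h x" if "x \<in> S" "continuous_on S g" "\<And>x. x \<in> S \<Longrightarrow> F x (h x) = g x" for g h x
    using linear_family_solution_continuous[where F = F, OF assms(1) that(1) assms(2) assms(3)[OF that(1)]]
      that F smooth_on_continuous by blast
  have "Ck_on k S h" if "Ck_on k S g" "\<And>x. x \<in> S \<Longrightarrow> F x (h x) = g x" for h g
    using that
  proof (induction k arbitrary: h g)
    case 0
    then show ?case using cont by (simp add: continuous_at_imp_continuous_on)
  next
    case (Suc k)
    have g: "Ck_on k S g" by (rule Ck_on_Suc_lower[OF Suc.prems(1)])
    have "continuous_on S g"
      using Suc.prems(1) by (auto intro: continuous_at_imp_continuous_on differentiable_imp_continuous_within)
    then have cont_h: "isCont h x" if "x \<in> S" for x using cont that Suc.prems(2) by blast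
    \<comment> \<open>The derivative of \<open>h\<close> along \<open>v\<close> solves the system of
      the same family \<open>F\<close> with right-hand side \<open>r v\<close>, and
      \<open>r v\<close> is of class C^k as soon as \<open>h\<close> is. Hence the induction
      hypothesis is used twice, first for \<open>h\<close> and then for its derivatives, with
      varying right-hand sides.\<close>
    define r where "r v x = frechet_derivative g (at x) v - frechet_derivative (\<lambda>y. F y (h x)) (at x) v"
        for v x
    have d: "(h has_derivative (\<lambda>v. inv (F x) (r v x))) (at x)" if "x \<in> S" for x
      unfolding r_def
      by (rule linear_family_solution_has_derivative[where F = F, OF assms(1) that assms(2) assms(3)[OF that]])
         (use diff that Suc.prems cont_h in auto)
    have "Ck_on k S (\<lambda>x. frechet_derivative (\<lambda>y. F y (h x)) (at x) v)" for v
    proof (rule linear_family_Ck[where F = "\<lambda>x w. frechet_derivative (\<lambda>y. F y w) (at x) v" and g = h, OF assms(1)])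
      show "linear (\<lambda>w. frechet_derivative (\<lambda>y. F y w) (at x) v)" if "x \<in> S" for x
        by (rule linear_frechet_derivative_family[OF assms(1) that assms(2)]) (use diff that in auto)
      show "Ck_on k S (\<lambda>x. frechet_derivative (\<lambda>y. F y w) (at x) v)" for w
        using smooth_on_frechet[OF F] unfolding smooth_on_def by blast
      show "Ck_on k S h" by (rule Suc.IH[OF g Suc.prems(2)])
    qed
    then have "Ck_on k S (\<lambda>x. frechet_derivative g (at x) v + - frechet_derivative (\<lambda>y. F y (h x)) (at x) v)" for v
      using Suc.prems(1)
      by (intro Ck_on_add assms(1) Ck_on_linear[where L = uminus])
         (auto intro: bounded_linear_minus bounded_linear_ident)
    then have r: "Ck_on k S (r v)" for v by (simp add: r_def[abs_def])
    have "F x (inv (F x) w) = w" if "x \<in> S" for x w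
      using linear_injective_imp_surjective[OF assms(2,3)] that by (simp add: surj_f_inv_f)
    then have "Ck_on k S (\<lambda>x. frechet_derivative h (at x) v)" for v
      using d by (intro Suc.IH[OF r[of v]]) (simp add: frechet_derivative_at[OF d, symmetric])
    with d show ?case by (auto simp: differentiable_def)
  qed
  moreover have "Ck_on k S g" using assms(5) by (simp add: smooth_on_def)
  ultimately show "Ck_on k S h" using assms(6) by blast
qed

subsection \<open>Symmetry of second derivatives\<close>

text \<open>Two applications of the mean value theorem: to the increment over \<open>t k\<close> as
  a function of the step along \<open>h\<close>, then to the derivative along \<open>h\<close> as a
  function of the step along \<open>k\<close>.\<close>

lemma second_difference_mean_value:
  fixes f :: "'a::real_normed_vector \<Rightarrow> real"
  assumes "t > 0" "\<And>a b. a \<in> {0..t} \<Longrightarrow> b \<in> {0..t} \<Longrightarrow> x + a *\<^sub>R h + b *\<^sub>R k \<in> S"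
    and "\<And>x. x \<in> S \<Longrightarrow> f differentiable (at x)"
    and "\<And>x. x \<in> S \<Longrightarrow> (\<lambda>y. frechet_derivative f (at y) h) differentiable (at x)"
  shows "\<exists>a\<in>{0..t}. \<exists>b\<in>{0..t}.
    f (x + t *\<^sub>R h + t *\<^sub>R k) - f (x + t *\<^sub>R h) - f (x + t *\<^sub>R k) + f x
      = t * t * frechet_derivative (\<lambda>y. frechet_derivative f (at y) h) (at (x + a *\<^sub>R h + b *\<^sub>R k)) k"
proof -
  have line: "((\<lambda>s. F (p + s *\<^sub>R w)) has_real_derivative frechet_derivative F (at (p + s *\<^sub>R w)) w) (at s)"
    if "F differentiable (at (p + s *\<^sub>R w))" for F :: "'a \<Rightarrow> real" and p w s
  proof -
    have F: "(F has_derivative frechet_derivative F (at (p + s *\<^sub>R w))) (at (p + s *\<^sub>R w))"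
      using that frechet_derivative_works by blast
    have "((\<lambda>s. p + s *\<^sub>R w) has_derivative (\<lambda>r. r *\<^sub>R w)) (at s)"
      by (auto intro!: derivative_eq_intros)
    from has_derivative_compose[OF this F] show ?thesis
      unfolding has_field_derivative_def
      by (simp add: linear_cmul[OF linear_frechet_derivative[OF that]] mult_commute_abs)
  qed
  define G where "G a = f ((x + t *\<^sub>R k) + a *\<^sub>R h) - f (x + a *\<^sub>R h)" for a
  have G': "(G has_real_derivative (frechet_derivative f (at ((x + t *\<^sub>R k) + a *\<^sub>R h)) h
      - frechet_derivative f (at (x + a *\<^sub>R h)) h)) (at a)" if "0 \<le> a" "a \<le> t" for a
    unfolding G_def
    by (intro DERIV_diff line assms(3)) (use assms(1) assms(2)[of a t] assms(2)[of a 0] that in \<open>auto simp: algebra_simps\<close>)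
  obtain a where a: "0 < a" "a < t" and Ga: "G t - G 0 = (t - 0) *
      (frechet_derivative f (at ((x + t *\<^sub>R k) + a *\<^sub>R h)) h - frechet_derivative f (at (x + a *\<^sub>R h)) h)"
    using MVT2[OF assms(1) G'] by blast
  have H': "((\<lambda>b. frechet_derivative f (at ((x + a *\<^sub>R h) + b *\<^sub>R k)) h) has_real_derivative
      frechet_derivative (\<lambda>y. frechet_derivative f (at y) h) (at ((x + a *\<^sub>R h) + b *\<^sub>R k)) k) (at b)"
    if "0 \<le> b" "b \<le> t" for b
    by (intro line assms(4) assms(2)) (use a that in auto)
  obtain b where "0 < b" "b < t" "frechet_derivative f (at ((x + a *\<^sub>R h) + t *\<^sub>R k)) h
     - frechet_derivative f (at ((x + a *\<^sub>R h) + 0 *\<^sub>R k)) h =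
     (t - 0) * frechet_derivative (\<lambda>y. frechet_derivative f (at y) h) (at ((x + a *\<^sub>R h) + b *\<^sub>R k)) k"
    using MVT2[OF assms(1) H'] by blast
  with a Ga show ?thesis
    by (intro bexI[of _ a] bexI[of _ b]) (auto simp: G_def add_ac)
qed

text \<open>The second difference is symmetric in \<open>h\<close> and \<open>k\<close>, so the two
  mixed derivatives agree at suitable points arbitrarily close to \<open>x\<close>; continuity
  excludes a positive gap at \<open>x\<close>.\<close>

lemma frechet_derivative_commute_real:
  fixes f :: "'a::real_normed_vector \<Rightarrow> real"
  assumes "open S" "smooth_on S f" "x \<in> S"
  shows "frechet_derivative (\<lambda>y. frechet_derivative f (at y) h) (at x) k =
    frechet_derivative (\<lambda>y. frechet_derivative f (at y) k) (at x) h"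
proof (rule ccontr)
  define A where "A h k x = frechet_derivative (\<lambda>y. frechet_derivative f (at y) h) (at x) k" for h k x
  assume "\<not> ?thesis"
  then have e: "dist (A h k x) (A k h x) / 2 > 0" (is "?e > 0") by (simp add: A_def)
  have cont: "continuous (at x) (A h k)" for h k
  proof -
    have "continuous_on S (A h k)"
      unfolding A_def by (intro smooth_on_continuous smooth_on_frechet assms(2))
    then show ?thesis using assms(1,3) by (simp add: continuous_on_eq_continuous_at)
  qed
  obtain d1 where d1: "d1 > 0" "\<And>y. dist y x < d1 \<Longrightarrow> dist (A h k y) (A h k x) < ?e"
    using cont[of h k] e unfolding continuous_at_eps_delta by blast
  obtain d2 where d2: "d2 > 0" "\<And>y. dist y x < d2 \<Longrightarrow> dist (A k h y) (A k h x) < ?e"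
    using cont[of k h] e unfolding continuous_at_eps_delta by blast
  obtain d3 where d3: "d3 > 0" "ball x d3 \<subseteq> S" using assms(1,3) openE by blast
  define d where "d = min d1 (min d2 d3)"
  \<comment> \<open>Chosen so that the parallelogram with sides \<open>t h\<close> and
    \<open>t k\<close> stays within \<open>d / 2\<close> of \<open>x\<close>; the summand 1 keeps
    the denominator positive when both vectors are 0.\<close>
  define t where "t = d / (2 * (norm h + norm k + 1))"
  have d: "d > 0" using d1 d2 d3 by (simp add: d_def)
  then have t: "t > 0" by (simp add: t_def add_nonneg_pos)
  have near: "dist (x + a *\<^sub>R h + b *\<^sub>R k) x < d" if "a \<in> {0..t}" "b \<in> {0..t}" for a b
  proof -
    have "norm (a *\<^sub>R h + b *\<^sub>R k) \<le> t * norm h + t * norm k"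
      using that by (intro norm_triangle_le add_mono) (auto intro!: mult_right_mono)
    also have "\<dots> \<le> t * (norm h + norm k + 1)" using t by (simp add: algebra_simps)
    also have "\<dots> = d / 2"
    proof -
      have "norm h + norm k + 1 > 0" by (simp add: add_nonneg_pos)
      then show ?thesis by (simp add: t_def field_simps)
    qed
    finally show ?thesis using d by (simp add: dist_norm add.assoc)
  qed
  have inS: "x + a *\<^sub>R h + b *\<^sub>R k \<in> S" if "a \<in> {0..t}" "b \<in> {0..t}" for a b
    using near[OF that] d3(2) by (auto simp: d_def mem_ball dist_commute)
  have diffs: "f differentiable (at y)" "(\<lambda>y. frechet_derivative f (at y) w) differentiable (at y)"
    if "y \<in> S" for y w
    using that smooth_on_differentiable[OF assms(2)]
      smooth_on_differentiable[OF smooth_on_frechet[OF assms(2)]] by blast+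
  obtain a b where ab: "a \<in> {0..t}" "b \<in> {0..t}"
    "f (x + t *\<^sub>R h + t *\<^sub>R k) - f (x + t *\<^sub>R h) - f (x + t *\<^sub>R k) + f x = t * t * A h k (x + a *\<^sub>R h + b *\<^sub>R k)"
    unfolding A_def using second_difference_mean_value[where S=S and f=f and x=x, OF t inS diffs]
        by meson
  have inS': "x + a *\<^sub>R k + b *\<^sub>R h \<in> S" if "a \<in> {0..t}" "b \<in> {0..t}" for a b
    using inS[OF that(2,1)] by (simp add: add_ac)
  obtain a' b' where ab': "a' \<in> {0..t}" "b' \<in> {0..t}"
    "f (x + t *\<^sub>R k + t *\<^sub>R h) - f (x + t *\<^sub>R k) - f (x + t *\<^sub>R h) + f x = t * t * A k h (x + a' *\<^sub>R k + b' *\<^sub>R h)"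
    unfolding A_def using second_difference_mean_value[where S=S and f=f and x=x, OF t inS' diffs]
        by meson
  have "t * t * A h k (x + a *\<^sub>R h + b *\<^sub>R k) = t * t * A k h (x + b' *\<^sub>R h + a' *\<^sub>R k)"
  proof -
    have swap: "x + t *\<^sub>R k + t *\<^sub>R h = x + t *\<^sub>R h + t *\<^sub>R k"
      "x + a' *\<^sub>R k + b' *\<^sub>R h = x + b' *\<^sub>R h + a' *\<^sub>R k" by simp_all
    show ?thesis using ab(3) ab'(3) unfolding swap by linarith
  qed
  then have "A h k (x + a *\<^sub>R h + b *\<^sub>R k) = A k h (x + b' *\<^sub>R h + a' *\<^sub>R k)" using t by simp
  moreover have "dist (A h k (x + a *\<^sub>R h + b *\<^sub>R k)) (A h k x) < ?e"
    using near[OF ab(1,2)] by (intro d1) (simp add: d_def)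
  moreover have "dist (A k h (x + b' *\<^sub>R h + a' *\<^sub>R k)) (A k h x) < ?e"
    using near[OF ab'(2,1)] by (intro d2) (simp add: d_def)
  ultimately have "dist (A k h (x + b' *\<^sub>R h + a' *\<^sub>R k)) (A h k x)
      + dist (A k h (x + b' *\<^sub>R h + a' *\<^sub>R k)) (A k h x) < dist (A h k x) (A k h x)"
    by simp
  then show False
    using dist_triangle3[of "A h k x" "A k h x" "A k h (x + b' *\<^sub>R h + a' *\<^sub>R k)"] by linarith
qed

lemma frechet_derivative_commute:
  fixes f :: "'a::real_normed_vector \<Rightarrow> 'f::euclidean_space"
  assumes "open S" "smooth_on S f" "x \<in> S"
  shows "frechet_derivative (\<lambda>y. frechet_derivative f (at y) h) (at x) k =
    frechet_derivative (\<lambda>y. frechet_derivative f (at y) k) (at x) h"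
proof (rule euclidean_eqI)
  fix b :: 'f assume "b \<in> Basis"
  have inner: "frechet_derivative g (at y) v \<bullet> b = frechet_derivative (\<lambda>y. g y \<bullet> b) (at y) v"
    if "smooth_on S g" "y \<in> S" for g y v
    using frechet_derivative_at[OF has_derivative_inner_left[OF smooth_on_has_derivative[OF that]]]
    by metis
  have "frechet_derivative (\<lambda>y. frechet_derivative f (at y) h) (at x) k \<bullet> b =
      frechet_derivative (\<lambda>y. frechet_derivative (\<lambda>y. f y \<bullet> b) (at y) h) (at x) k" for h k
  proof -
    have "frechet_derivative (\<lambda>y. frechet_derivative f (at y) h \<bullet> b) (at x) =
        frechet_derivative (\<lambda>y. frechet_derivative (\<lambda>y. f y \<bullet> b) (at y) h) (at x)"
    proof (rule frechet_derivative_transform_within_open[OF _ assms(1,3)])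
      show "(\<lambda>y. frechet_derivative f (at y) h \<bullet> b) differentiable at x"
        using has_derivative_inner_left[OF smooth_on_has_derivative[OF smooth_on_frechet[OF assms(2)] assms(3)]]
        by (auto simp: differentiable_def)
    qed (simp add: inner[OF assms(2)])
    then show ?thesis by (simp add: inner[OF smooth_on_frechet[OF assms(2)] assms(3)])
  qed
  moreover have "smooth_on S (\<lambda>y. f y \<bullet> b)"
    by (rule smooth_on_linear[OF assms(1) bounded_linear_inner_left assms(2)])
  ultimately show "frechet_derivative (\<lambda>y. frechet_derivative f (at y) h) (at x) k \<bullet> b =
    frechet_derivative (\<lambda>y. frechet_derivative f (at y) k) (at x) h \<bullet> b"
    using frechet_derivative_commute_real[OF assms(1) _ assms(3)] by metis
qed

text \<open>Splits off the second derivative with frozen direction, the part that cancels in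
  brackets and commutators by symmetry.\<close>

lemma frechet_derivative_frechet_field:
  fixes f :: "'a::euclidean_space \<Rightarrow> 'f::real_normed_vector"
  assumes "open S" "smooth_on S f" "smooth_on S g" "x \<in> S"
  shows "frechet_derivative (\<lambda>y. frechet_derivative f (at y) (g y)) (at x) h =
    frechet_derivative (\<lambda>y. frechet_derivative f (at y) (g x)) (at x) h
    + frechet_derivative f (at x) (frechet_derivative g (at x) h)"
  by (rule frechet_derivative_linear_family[OF assms(1,4)])
     (auto intro: smooth_on_frechet_linear[OF assms(2)] assms(4)
       smooth_on_differentiable[OF assms(3)] smooth_on_differentiable[OF smooth_on_frechet[OF assms(2)]])

section \<open>Cartan and Chern connections, algebraically\<close>

text \<open>\<open>VF\<close>, \<open>PF\<close> and \<open>SF\<close> stand for vector fields on the slit bundle, \<open>\<pi>\<close>-vector fields and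
  smooth functions; \<open>vd X Y\<close> is the flat derivative of \<open>Y\<close> along the fibres in the direction \<open>X\<close>.
  The last two axioms say that the vertical derivative of \<open>g\<close>, being a third derivative of the
  energy, is symmetric, and that it vanishes on \<open>\<eta>\<close> by homogeneity.\<close>

locale pullback_calculus =
  fixes VF :: "'v::ab_group_add set" and PF :: "'p::ab_group_add set" and SF :: "('x \<Rightarrow> real) set"
    and br :: "'v \<Rightarrow> 'v \<Rightarrow> 'v" and rho :: "'v \<Rightarrow> 'p" and gam :: "'p \<Rightarrow> 'v"
    and act :: "'v \<Rightarrow> ('x \<Rightarrow> real) \<Rightarrow> 'x \<Rightarrow> real" and g :: "'p \<Rightarrow> 'p \<Rightarrow> 'x \<Rightarrow> real"
    and eta :: 'p and vd :: "'p \<Rightarrow> 'p \<Rightarrow> 'p"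
  assumes VF_zero [simp]: "0 \<in> VF"
    and VF_add [simp]: "A \<in> VF \<Longrightarrow> B \<in> VF \<Longrightarrow> A + B \<in> VF"
    and VF_minus [simp]: "A \<in> VF \<Longrightarrow> - A \<in> VF"
    and PF_zero [simp]: "0 \<in> PF"
    and PF_add [simp]: "X \<in> PF \<Longrightarrow> Y \<in> PF \<Longrightarrow> X + Y \<in> PF"
    and PF_minus [simp]: "X \<in> PF \<Longrightarrow> - X \<in> PF"
    and SF_add [simp]: "f \<in> SF \<Longrightarrow> h \<in> SF \<Longrightarrow> f + h \<in> SF"
    and eta_closed [simp]: "eta \<in> PF"
    and br_closed [simp]: "A \<in> VF \<Longrightarrow> B \<in> VF \<Longrightarrow> br A B \<in> VF"
    and br_add_left: "A \<in> VF \<Longrightarrow> B \<in> VF \<Longrightarrow> C \<in> VF \<Longrightarrow> br (A + B) C = br A C + br B C"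
    and br_antisym: "A \<in> VF \<Longrightarrow> B \<in> VF \<Longrightarrow> br B A = - br A B"
    and jacobi: "A \<in> VF \<Longrightarrow> B \<in> VF \<Longrightarrow> C \<in> VF \<Longrightarrow>
      br A (br B C) + br B (br C A) + br C (br A B) = 0"
    and rho_closed [simp]: "A \<in> VF \<Longrightarrow> rho A \<in> PF"
    and rho_add: "A \<in> VF \<Longrightarrow> B \<in> VF \<Longrightarrow> rho (A + B) = rho A + rho B"
    and gam_closed [simp]: "X \<in> PF \<Longrightarrow> gam X \<in> VF"
    and gam_add: "X \<in> PF \<Longrightarrow> Y \<in> PF \<Longrightarrow> gam (X + Y) = gam X + gam Y"
    and rho_gam [simp]: "X \<in> PF \<Longrightarrow> rho (gam X) = 0"
    and rho_eq_0: "A \<in> VF \<Longrightarrow> rho A = 0 \<Longrightarrow> \<exists>X\<in>PF. A = gam X"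
    and rho_br_gam: "X \<in> PF \<Longrightarrow> B \<in> VF \<Longrightarrow> rho (br (gam X) B) = vd X (rho B)"
    and vd_eta: "X \<in> PF \<Longrightarrow> vd X eta = X"
    and act_add: "A \<in> VF \<Longrightarrow> f \<in> SF \<Longrightarrow> h \<in> SF \<Longrightarrow> act A (f + h) = act A f + act A h"
    and act_br: "A \<in> VF \<Longrightarrow> B \<in> VF \<Longrightarrow> f \<in> SF \<Longrightarrow> act (br A B) f = act A (act B f) - act B (act A f)"
    and g_closed [simp]: "X \<in> PF \<Longrightarrow> Y \<in> PF \<Longrightarrow> g X Y \<in> SF"
    and g_add_left: "X \<in> PF \<Longrightarrow> Y \<in> PF \<Longrightarrow> Z \<in> PF \<Longrightarrow> g (X + Y) Z x = g X Z x + g Y Z x"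
    and g_sym: "X \<in> PF \<Longrightarrow> Y \<in> PF \<Longrightarrow> g X Y = g Y X"
    and g_definite: "X \<in> PF \<Longrightarrow> (\<And>x. g X X x = 0) \<Longrightarrow> X = 0"
    and vertical_g_sym: "X \<in> PF \<Longrightarrow> Y \<in> PF \<Longrightarrow> Z \<in> PF \<Longrightarrow>
      act (gam X) (g Y Z) x - g (vd X Y) Z x - g Y (vd X Z) x =
      act (gam Y) (g X Z) x - g (vd Y X) Z x - g X (vd Y Z) x"
    and vertical_g_eta: "Y \<in> PF \<Longrightarrow> Z \<in> PF \<Longrightarrow>
      act (gam eta) (g Y Z) x = g (vd eta Y) Z x + g Y (vd eta Z) x"
begin

lemma VF_diff [simp]: "A \<in> VF \<Longrightarrow> B \<in> VF \<Longrightarrow> A - B \<in> VF"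
  by (simp only: diff_conv_add_uminus VF_add VF_minus)

lemma PF_diff [simp]: "X \<in> PF \<Longrightarrow> Y \<in> PF \<Longrightarrow> X - Y \<in> PF"
  by (simp only: diff_conv_add_uminus PF_add PF_minus)

lemma br_add_right: "A \<in> VF \<Longrightarrow> B \<in> VF \<Longrightarrow> C \<in> VF \<Longrightarrow> br C (A + B) = br C A + br C B"
  using br_antisym[of "A + B" C] br_antisym[of A C] br_antisym[of B C] br_add_left[of A B C] by simp

lemma rho_diff: "A \<in> VF \<Longrightarrow> B \<in> VF \<Longrightarrow> rho (A - B) = rho A - rho B"
  using rho_add[of "A - B" B] by (simp add: algebra_simps)

lemma rho_zero [simp]: "rho 0 = 0"
  using rho_diff[of 0 0] by simp

lemma rho_minus: "A \<in> VF \<Longrightarrow> rho (- A) = - rho A"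
  using rho_diff[of 0 A] by simp

lemma gam_zero [simp]: "gam 0 = 0"
  using gam_add[of 0 0] by simp

lemma g_add_right: "X \<in> PF \<Longrightarrow> Y \<in> PF \<Longrightarrow> Z \<in> PF \<Longrightarrow> g Z (X + Y) x = g Z X x + g Z Y x"
  using g_add_left[of X Y Z x] g_sym by simp

lemma g_diff_left: "X \<in> PF \<Longrightarrow> Y \<in> PF \<Longrightarrow> Z \<in> PF \<Longrightarrow> g (X - Y) Z x = g X Z x - g Y Z x"
  using g_add_left[of "X - Y" Y Z x] by simp

lemma g_diff_right: "X \<in> PF \<Longrightarrow> Y \<in> PF \<Longrightarrow> Z \<in> PF \<Longrightarrow> g Z (X - Y) x = g Z X x - g Z Y x"
  using g_add_right[of "X - Y" Y Z x] by simp

lemma g_zero_left [simp]: "Z \<in> PF \<Longrightarrow> g 0 Z x = 0"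
  using g_diff_left[of 0 0 Z x] by simp

lemma g_zero_right [simp]: "Z \<in> PF \<Longrightarrow> g Z 0 x = 0"
  using g_diff_right[of 0 0 Z x] by simp

lemma g_minus_left: "X \<in> PF \<Longrightarrow> Z \<in> PF \<Longrightarrow> g (- X) Z x = - g X Z x"
  using g_diff_left[of 0 X Z x] by simp

text \<open>The test section is \<open>X - Y\<close> itself, so definiteness is enough and no
  nondegeneracy at single points has to be invoked.\<close>

lemma g_nondegenerate:
  assumes "X \<in> PF" "Y \<in> PF" "\<And>Z x. Z \<in> PF \<Longrightarrow> g X Z x = g Y Z x"
  shows "X = Y"
proof -
  have "X - Y = 0" by (rule g_definite) (use assms in \<open>simp_all add: g_diff_left\<close>)
  then show ?thesis by simp
qed

text \<open>Involutivity of the vertical distribution. Both brackets project to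
  \<open>vd X 0\<close>, which is found to be 0 by bracketing with the zero field.\<close>

lemma rho_br_gam_gam [simp]: "X \<in> PF \<Longrightarrow> Y \<in> PF \<Longrightarrow> rho (br (gam X) (gam Y)) = 0"
  using rho_br_gam[of X "gam Y"] rho_br_gam[of X 0] br_add_right[of 0 0 "gam X"] by simp

end

section \<open>Regular connections: torsion, curvature and the second Bianchi identity\<close>

locale regular_calculus = pullback_calculus VF PF SF br rho gam act g eta vd
  for VF :: "'v::ab_group_add set" and PF :: "'p::ab_group_add set" and SF :: "('x \<Rightarrow> real) set"
    and br rho gam act g eta vd +
  fixes cov :: "'v \<Rightarrow> 'p \<Rightarrow> 'p" and beta :: "'p \<Rightarrow> 'v"
  assumes cov_closed [simp]: "A \<in> VF \<Longrightarrow> Y \<in> PF \<Longrightarrow> cov A Y \<in> PF"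
    and cov_add: "A \<in> VF \<Longrightarrow> Y \<in> PF \<Longrightarrow> Z \<in> PF \<Longrightarrow> cov A (Y + Z) = cov A Y + cov A Z"
    and cov_add_vec: "A \<in> VF \<Longrightarrow> B \<in> VF \<Longrightarrow> Y \<in> PF \<Longrightarrow> cov (A + B) Y = cov A Y + cov B Y"
    and beta_closed [simp]: "X \<in> PF \<Longrightarrow> beta X \<in> VF"
    and rho_beta [simp]: "X \<in> PF \<Longrightarrow> rho (beta X) = X"
    and cov_beta_eta [simp]: "X \<in> PF \<Longrightarrow> cov (beta X) eta = 0"
    and cov_gam_eta_eq_0: "X \<in> PF \<Longrightarrow> cov (gam X) eta = 0 \<Longrightarrow> X = 0"
begin

definition tor :: "'v \<Rightarrow> 'v \<Rightarrow> 'p" where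
  "tor V W = cov V (rho W) - cov W (rho V) - rho (br V W)"

definition curv :: "'v \<Rightarrow> 'v \<Rightarrow> 'p \<Rightarrow> 'p" where
  "curv V W Z = - cov V (cov W Z) + cov W (cov V Z) + cov (br V W) Z"

definition T :: "'p \<Rightarrow> 'p \<Rightarrow> 'p" where
  "T X Y = tor (gam X) (beta Y)"

definition P :: "'p \<Rightarrow> 'p \<Rightarrow> 'p \<Rightarrow> 'p" where
  "P X Y Z = curv (beta X) (gam Y) Z"

lemma cov_diff: "A \<in> VF \<Longrightarrow> Y \<in> PF \<Longrightarrow> Z \<in> PF \<Longrightarrow> cov A (Y - Z) = cov A Y - cov A Z"
  using cov_add[of A "Y - Z" Z] by (simp add: algebra_simps)

lemma cov_zero [simp]: "A \<in> VF \<Longrightarrow> cov A 0 = 0"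
  using cov_diff[of A 0 0] by simp

lemma cov_minus: "A \<in> VF \<Longrightarrow> Y \<in> PF \<Longrightarrow> cov A (- Y) = - cov A Y"
  using cov_diff[of A 0 Y] by simp

lemma cov_diff_vec: "A \<in> VF \<Longrightarrow> B \<in> VF \<Longrightarrow> Y \<in> PF \<Longrightarrow> cov (A - B) Y = cov A Y - cov B Y"
  using cov_add_vec[of "A - B" B Y] by (simp add: algebra_simps)

lemma cov_zero_vec [simp]: "Y \<in> PF \<Longrightarrow> cov 0 Y = 0"
  using cov_diff_vec[of 0 0 Y] by simp

lemma cov_minus_vec: "A \<in> VF \<Longrightarrow> Y \<in> PF \<Longrightarrow> cov (- A) Y = - cov A Y"
  using cov_diff_vec[of 0 A Y] by simp

text \<open>\<open>A - beta (rho A)\<close> is vertical and killed by the connection map, hence zero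
  by regularity.\<close>

lemma horizontal_unique:
  assumes "A \<in> VF" "cov A eta = 0"
  shows "A = beta (rho A)"
proof -
  obtain Z where Z: "Z \<in> PF" "A - beta (rho A) = gam Z"
    using rho_eq_0[of "A - beta (rho A)"] assms by (auto simp: rho_diff)
  moreover have "cov (A - beta (rho A)) eta = 0" using assms by (simp add: cov_diff_vec)
  ultimately show ?thesis using cov_gam_eta_eq_0[of Z] by simp
qed

lemma tor_closed [simp]: "A \<in> VF \<Longrightarrow> B \<in> VF \<Longrightarrow> tor A B \<in> PF"
  by (simp add: tor_def)

lemma curv_closed [simp]: "A \<in> VF \<Longrightarrow> B \<in> VF \<Longrightarrow> Z \<in> PF \<Longrightarrow> curv A B Z \<in> PF"
  by (simp add: curv_def)

lemma T_closed [simp]: "X \<in> PF \<Longrightarrow> Y \<in> PF \<Longrightarrow> T X Y \<in> PF"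
  by (simp add: T_def)

lemma P_closed [simp]: "X \<in> PF \<Longrightarrow> Y \<in> PF \<Longrightarrow> Z \<in> PF \<Longrightarrow> P X Y Z \<in> PF"
  by (simp add: P_def)

text \<open>\<open>gam X\<close> is vertical, so the torsion sees \<open>beta Y\<close> only through
  its projection: \<open>T\<close> measures how the vertical covariant derivative deviates from the
  flat one along the fibres.\<close>

lemma T_eq: "X \<in> PF \<Longrightarrow> Y \<in> PF \<Longrightarrow> T X Y = cov (gam X) Y - vd X Y"
  by (simp add: T_def tor_def rho_br_gam)

lemma tor_antisym: "A \<in> VF \<Longrightarrow> B \<in> VF \<Longrightarrow> tor B A = - tor A B"
  using br_antisym[of A B] by (simp add: tor_def rho_minus)

lemma tor_add_left: "A \<in> VF \<Longrightarrow> B \<in> VF \<Longrightarrow> C \<in> VF \<Longrightarrow> tor (A + B) C = tor A C + tor B C"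
  by (simp add: tor_def cov_add cov_add_vec rho_add br_add_left algebra_simps)

lemma tor_add_right: "A \<in> VF \<Longrightarrow> B \<in> VF \<Longrightarrow> C \<in> VF \<Longrightarrow> tor C (A + B) = tor C A + tor C B"
  by (simp add: tor_def cov_add cov_add_vec rho_add br_add_right algebra_simps)

lemma T_add_left: "X \<in> PF \<Longrightarrow> Y \<in> PF \<Longrightarrow> Z \<in> PF \<Longrightarrow> T (X + Y) Z = T X Z + T Y Z"
  by (simp add: T_def gam_add tor_add_left)

lemma T_diff_left: "X \<in> PF \<Longrightarrow> Y \<in> PF \<Longrightarrow> Z \<in> PF \<Longrightarrow> T (X - Y) Z = T X Z - T Y Z"
  using T_add_left[of "X - Y" Y Z] by (simp add: algebra_simps)

lemma T_zero_left [simp]: "Z \<in> PF \<Longrightarrow> T 0 Z = 0"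
  using T_diff_left[of 0 0 Z] by simp

lemma tor_gam_gam [simp]: "X \<in> PF \<Longrightarrow> Y \<in> PF \<Longrightarrow> tor (gam X) (gam Y) = 0"
  by (simp add: tor_def)

lemma curv_antisym: "A \<in> VF \<Longrightarrow> B \<in> VF \<Longrightarrow> Z \<in> PF \<Longrightarrow> curv B A Z = - curv A B Z"
  using br_antisym[of A B] by (simp add: curv_def cov_minus_vec)

lemma curv_zero [simp]: "A \<in> VF \<Longrightarrow> B \<in> VF \<Longrightarrow> curv A B 0 = 0"
  by (simp add: curv_def)

lemma curv_add_left:
  "A \<in> VF \<Longrightarrow> B \<in> VF \<Longrightarrow> C \<in> VF \<Longrightarrow> Z \<in> PF \<Longrightarrow> curv (A + B) C Z = curv A C Z + curv B C Z"
  by (simp add: curv_def cov_add cov_add_vec br_add_left algebra_simps)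

lemma P_add_middle: "X \<in> PF \<Longrightarrow> Y \<in> PF \<Longrightarrow> Y' \<in> PF \<Longrightarrow> Z \<in> PF \<Longrightarrow> P X (Y + Y') Z = P X Y Z + P X Y' Z"
  using curv_antisym[of "beta X" "gam (Y + Y')" Z] curv_antisym[of "beta X" "gam Y" Z]
    curv_antisym[of "beta X" "gam Y'" Z] curv_add_left[of "gam Y" "gam Y'" "beta X" Z]
  by (simp add: P_def gam_add algebra_simps)

lemma P_diff_middle: "X \<in> PF \<Longrightarrow> Y \<in> PF \<Longrightarrow> Y' \<in> PF \<Longrightarrow> Z \<in> PF \<Longrightarrow> P X (Y - Y') Z = P X Y Z - P X Y' Z"
  using P_add_middle[of X "Y - Y'" Y' Z] by (simp add: algebra_simps)

text \<open>With brackets in place of torsion terms the identity holds for every connection of the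
  calculus: after expansion everything cancels except the covariant derivative along the Jacobi
  sum.\<close>

lemma second_Bianchi:
  assumes [simp]: "A \<in> VF" "B \<in> VF" "C \<in> VF" "W \<in> PF"
  shows "(cov A (curv B C W) - curv B C (cov A W) - curv (br A B) C W)
    + (cov B (curv C A W) - curv C A (cov B W) - curv (br B C) A W)
    + (cov C (curv A B W) - curv A B (cov C W) - curv (br C A) B W) = 0"
proof -
  have "br (br A B) C = - br C (br A B)" "br (br B C) A = - br A (br B C)" "br (br C A) B = - br B (br C A)"
    by (rule br_antisym; simp)+
  then have "br (br A B) C + br (br B C) A + br (br C A) B
      = - (br A (br B C) + br B (br C A) + br C (br A B))" by (simp only: minus_add_distrib ac_simps)
  then have "br (br A B) C + br (br B C) A + br (br C A) B = 0" by (simp add: jacobi)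
  then have "cov (br (br A B) C) W + cov (br (br B C) A) W + cov (br (br C A) B) W = 0"
    using cov_add_vec[of "br (br A B) C + br (br B C) A" "br (br C A) B" W]
      cov_add_vec[of "br (br A B) C" "br (br B C) A" W] by simp
  then show ?thesis
    by (simp add: curv_def cov_add cov_minus cov_diff algebra_simps)
qed

end

section \<open>Torsion-free connections: Bianchi identities and vertical curvature\<close>

locale torsion_free_calculus = regular_calculus +
  assumes tor_eq_0: "A \<in> VF \<Longrightarrow> B \<in> VF \<Longrightarrow> tor A B = 0"
begin

lemma cov_rho: "A \<in> VF \<Longrightarrow> B \<in> VF \<Longrightarrow> cov A (rho B) = cov B (rho A) + rho (br A B)"
  using tor_eq_0[of A B] by (simp add: tor_def algebra_simps)

text \<open>Zero torsion reduces the vertical derivative of \<open>eta\<close> to the flat one, and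
  the flat derivative of \<open>eta\<close> along \<open>X\<close> is \<open>X\<close>; thus the
  connection map inverts \<open>gam\<close>.\<close>

lemma cov_gam_eta: "X \<in> PF \<Longrightarrow> cov (gam X) eta = X"
  using cov_rho[of "gam X" "beta eta"] by (simp add: rho_br_gam vd_eta)

text \<open>\<open>cov_rho\<close> is applied at two levels, inside the second derivatives and again
  to the resulting brackets; what is left is \<open>rho\<close> of the Jacobi sum.\<close>

lemma first_Bianchi:
  assumes [simp]: "A \<in> VF" "B \<in> VF" "C \<in> VF"
  shows "curv A B (rho C) + curv B C (rho A) + curv C A (rho B) = 0"
proof -
  have "rho (br A (br B C)) + rho (br B (br C A)) + rho (br C (br A B)) = 0"
    using jacobi[of A B C] rho_add[of "br A (br B C) + br B (br C A)" "br C (br A B)"]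
      rho_add[of "br A (br B C)" "br B (br C A)"] by simp
  moreover have "cov A (cov B (rho C)) = cov A (cov C (rho B)) + cov A (rho (br B C))"
    "cov B (cov C (rho A)) = cov B (cov A (rho C)) + cov B (rho (br C A))"
    "cov C (cov A (rho B)) = cov C (cov B (rho A)) + cov C (rho (br A B))"
    using cov_rho[of B C] cov_rho[of C A] cov_rho[of A B] by (simp_all add: cov_add)
  moreover have "cov A (rho (br B C)) = cov (br B C) (rho A) + rho (br A (br B C))"
    "cov B (rho (br C A)) = cov (br C A) (rho B) + rho (br B (br C A))"
    "cov C (rho (br A B)) = cov (br A B) (rho C) + rho (br C (br A B))"
    by (rule cov_rho; simp)+
  ultimately show ?thesis by (simp add: curv_def algebra_simps)
qed

text \<open>The Bianchi term evaluated at \<open>rho (gam Y)\<close> is zero, and antisymmetry of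
  the curvature brings the other two to the form \<open>P\<close>.\<close>

lemma P_sym: 
  assumes [simp]: "X \<in> PF" "Y \<in> PF" "Z \<in> PF"
  shows "P X Y Z = P Z Y X"
  using first_Bianchi[of "beta X" "gam Y" "beta Z"] curv_antisym[of "beta Z" "gam Y" X]
  by (simp add: P_def)

text \<open>With two vertical arguments, two of the three terms of the first Bianchi identity are
  evaluated at 0. The v-curvature of the Chern connection vanishes for this reason.\<close>

lemma curv_gam_gam [simp]:
  assumes [simp]: "X \<in> PF" "Y \<in> PF" "Z \<in> PF"
  shows "curv (gam X) (gam Y) Z = 0"
  using first_Bianchi[of "gam X" "gam Y" "beta Z"] by simp

lemma decomposition: "A \<in> VF \<Longrightarrow> A = beta (rho A) + gam (cov A eta)"
  using horizontal_unique[of "A - gam (cov A eta)"]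
  by (simp add: cov_diff_vec cov_gam_eta rho_diff algebra_simps)

text \<open>The vanishing v-curvature, applied to \<open>eta\<close>, determines the connection map
  of the bracket; as the bracket is vertical, this determines the bracket.\<close>

lemma br_gam_gam: 
  assumes [simp]: "X \<in> PF" "Y \<in> PF"
  shows "br (gam X) (gam Y) = gam (cov (gam X) Y - cov (gam Y) X)"
proof -
  have "curv (gam X) (gam Y) eta = 0" by simp
  then have "cov (br (gam X) (gam Y)) eta = cov (gam X) Y - cov (gam Y) X"
    by (simp add: curv_def cov_gam_eta algebra_simps)
  moreover have "beta 0 = 0" using horizontal_unique[of 0] by simp
  ultimately show ?thesis using decomposition[of "br (gam X) (gam Y)"] by simp
qed

text \<open>The vertical part of \<open>A\<close> does not contribute, because the v-curvature
  vanishes; this makes brackets in curvature slots computable from their projections alone.\<close>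

lemma curv_gam_right: "A \<in> VF \<Longrightarrow> Y \<in> PF \<Longrightarrow> Z \<in> PF \<Longrightarrow> curv A (gam Y) Z = P (rho A) Y Z"
  by (subst decomposition) (simp_all add: curv_add_left P_def)

lemma curv_br_beta_gam:
  assumes [simp]: "X \<in> PF" "Y \<in> PF" "Z \<in> PF" "W \<in> PF"
  shows "curv (br (gam Y) (beta Z)) (gam X) W = P (cov (gam Y) Z) X W"
  using cov_rho[of "gam Y" "beta Z"] by (simp add: curv_gam_right)

text \<open>The vertical part of the second Bianchi identity for \<open>\<gamma>X\<close>, \<open>\<gamma>Y\<close>, \<open>\<beta>Z\<close>.\<close>

lemma cov_gam_P_sym:
  assumes [simp]: "X \<in> PF" "Y \<in> PF" "Z \<in> PF" "W \<in> PF"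
  shows "cov (gam X) (P Z Y W) - P (cov (gam X) Z) Y W - P Z (cov (gam X) Y) W - P Z Y (cov (gam X) W)
       = cov (gam Y) (P Z X W) - P (cov (gam Y) Z) X W - P Z (cov (gam Y) X) W - P Z X (cov (gam Y) W)"
proof -
  have swap: "curv (gam Y) (beta Z) V = - P Z Y V" if "V \<in> PF" "Y \<in> PF" for V Y
    using curv_antisym[of "beta Z" "gam Y" V] that by (simp add: P_def)
  have "curv (gam (cov (gam X) Y - cov (gam Y) X)) (beta Z) W = P Z (cov (gam Y) X) W - P Z (cov (gam X) Y) W"
    by (subst swap) (simp_all add: P_diff_middle)
  moreover have "br (beta Z) (gam X) = - br (gam X) (beta Z)" using br_antisym[of "gam X" "beta Z"]
      by simp
  \<comment> \<open>Additivity at \<open>0 + 0\<close> shows that the curvature vanishes on the zero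
    field, and so is odd in its first slot.\<close>
  moreover have "curv (- br (gam X) (beta Z)) (gam Y) W = - P (cov (gam X) Z) Y W"
    using curv_add_left[of "br (gam X) (beta Z)" "- br (gam X) (beta Z)" "gam Y" W]
      curv_br_beta_gam[of Y X Z W] curv_add_left[of 0 0 "gam Y" W]
    by (simp add: eq_neg_iff_add_eq_0 add.commute)
  ultimately show ?thesis
    using second_Bianchi[of "gam X" "gam Y" "beta Z" W] swap
    by (simp add: br_gam_gam curv_br_beta_gam cov_minus P_def[symmetric] algebra_simps)
qed

end

section \<open>The Cartan connection and the symmetries of its torsion\<close>

locale cartan_calculus = regular_calculus +
  assumes metric: "V \<in> VF \<Longrightarrow> Y \<in> PF \<Longrightarrow> Z \<in> PF \<Longrightarrow>
      act V (g Y Z) x = g (cov V Y) Z x + g Y (cov V Z) x"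
    and tor_beta_beta: "X \<in> PF \<Longrightarrow> Y \<in> PF \<Longrightarrow> tor (beta X) (beta Y) = 0"
    and g_T_sym: "X \<in> PF \<Longrightarrow> Y \<in> PF \<Longrightarrow> Z \<in> PF \<Longrightarrow> g (T X Y) Z x = g (T X Z) Y x"
begin

text \<open>Subtracting the flat derivatives from metric compatibility leaves \<open>T\<close> in
  both arguments of \<open>g\<close>, and these two terms are equal by hypothesis. So
  \<open>g (T X Y) Z\<close> is half the third fibre derivative of the energy, the Cartan
  tensor.\<close>

lemma g_T_eq:
  assumes [simp]: "X \<in> PF" "Y \<in> PF" "Z \<in> PF"
  shows "2 * g (T X Y) Z x = act (gam X) (g Y Z) x - g (vd X Y) Z x - g Y (vd X Z) x"
proof -
  \<comment> \<open>Closure of the sections under \<open>vd\<close> comes from realising it as the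
    projection of a bracket with a lift of \<open>Y\<close>.\<close>
  have [simp]: "vd X Y \<in> PF" if "Y \<in> PF" for Y
    using rho_br_gam[of X "beta Y"] that rho_closed[of "br (gam X) (beta Y)"] by simp
  have "g Y (T X Z) x = g Y (cov (gam X) Z) x - g Y (vd X Z) x"
    by (simp add: T_eq g_diff_right)
  moreover have "g (T X Y) Z x = g (cov (gam X) Y) Z x - g (vd X Y) Z x"
    by (simp add: T_eq g_diff_left)
  moreover have "g Y (T X Z) x = g (T X Y) Z x"
    using g_T_sym[of X Y Z x] g_sym[of Y "T X Z"] by simp
  ultimately show ?thesis using metric[of "gam X" Y Z x] by simp
qed

lemma T_sym: "X \<in> PF \<Longrightarrow> Y \<in> PF \<Longrightarrow> T X Y = T Y X"
proof (rule g_nondegenerate)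
  fix Z x assume [simp]: "X \<in> PF" "Y \<in> PF" "Z \<in> PF"
  show "g (T X Y) Z x = g (T Y X) Z x"
    using g_T_eq[of X Y Z x] g_T_eq[of Y X Z x] vertical_g_sym[of X Y Z x] by simp
qed simp_all

lemma T_eta_left [simp]: "Y \<in> PF \<Longrightarrow> T eta Y = 0"
proof (rule g_nondegenerate)
  fix Z x assume [simp]: "Y \<in> PF" "Z \<in> PF"
  show "g (T eta Y) Z x = g 0 Z x"
    using g_T_eq[of eta Y Z x] vertical_g_eta[of Y Z x] by simp
qed simp_all

lemma T_eta_right [simp]: "Y \<in> PF \<Longrightarrow> T Y eta = 0"
  using T_sym[of Y eta] by simp

text \<open>Here the torsion need not vanish, but its value \<open>T X eta\<close> does, and that is
  the only one that enters.\<close>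

lemma cov_gam_eta: "X \<in> PF \<Longrightarrow> cov (gam X) eta = X"
  using T_eq[of X eta] by (simp add: vd_eta)

lemma decomposition: "A \<in> VF \<Longrightarrow> A = beta (rho A) + gam (cov A eta)"
  using horizontal_unique[of "A - gam (cov A eta)"]
  by (simp add: cov_diff_vec cov_gam_eta rho_diff algebra_simps)

text \<open>Of the four pieces of the horizontal-vertical splitting, the purely horizontal one
  vanishes by assumption and the purely vertical one by involutivity.\<close>

lemma tor_eq:
  assumes [simp]: "A \<in> VF" "B \<in> VF"
  shows "tor A B = T (cov A eta) (rho B) - T (cov B eta) (rho A)"
proof -
  have "tor A B = tor (beta (rho A) + gam (cov A eta)) (beta (rho B) + gam (cov B eta))"
    using decomposition[of A] decomposition[of B] by simp
  also have "\<dots> = tor (gam (cov A eta)) (beta (rho B)) + tor (beta (rho A)) (gam (cov B eta))"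
    by (simp add: tor_add_left tor_add_right tor_beta_beta)
  also have "tor (beta (rho A)) (gam (cov B eta)) = - T (cov B eta) (rho A)"
    using tor_antisym[of "gam (cov B eta)" "beta (rho A)"] by (simp add: T_def)
  finally show ?thesis by (simp add: T_def)
qed

end

section \<open>Comparison of the Chern with the Cartan connection\<close>

locale chern_calculus =
  N: cartan_calculus VF PF SF br rho gam act g eta vd N betaN +
  D: torsion_free_calculus VF PF SF br rho gam act g eta vd D betaD
  for VF :: "'v::ab_group_add set" and PF :: "'p::ab_group_add set" and SF :: "('x \<Rightarrow> real) set"
    and br rho gam act g eta vd N betaN D betaD +
  assumes D_metric: "V \<in> VF \<Longrightarrow> Y \<in> PF \<Longrightarrow> Z \<in> PF \<Longrightarrow>
      act V (g Y Z) x = g (D V Y) Z x + g Y (D V Z) x + 2 * g (N.T (D V eta) Y) Z x"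
begin

lemma g_T_swap23: "X \<in> PF \<Longrightarrow> Y \<in> PF \<Longrightarrow> Z \<in> PF \<Longrightarrow> g (N.T X Y) Z x = g (N.T X Z) Y x"
  by (rule N.g_T_sym)

text \<open>By Koszul-type polarisation, a torsion-free connection is determined by the covariant
  derivative of \<open>g\<close>. Both \<open>D\<close> and \<open>\<nabla> - T(K, _)\<close> are torsion-free, and comparing them on \<open>\<eta>\<close> shows that their
  connection maps agree.\<close>

definition conn_diff where "conn_diff V Y = D V Y - N V Y + N.T (N V eta) Y"
definition conn_map_diff where "conn_map_diff V = D V eta - N V eta"

lemma conn_diff_closed [simp]: "V \<in> VF \<Longrightarrow> Y \<in> PF \<Longrightarrow> conn_diff V Y \<in> PF"
  by (simp add: conn_diff_def)

lemma conn_map_diff_closed [simp]: "V \<in> VF \<Longrightarrow> conn_map_diff V \<in> PF"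
  by (simp add: conn_map_diff_def)

text \<open>\<open>tor_eq\<close> says that subtracting \<open>T (N V eta) Y\<close> from the Cartan
  derivative makes it torsion-free; for two torsion-free derivatives the bracket terms cancel in the
  difference.\<close>

lemma conn_diff_sym: "A \<in> VF \<Longrightarrow> B \<in> VF \<Longrightarrow> conn_diff A (rho B) = conn_diff B (rho A)"
  using D.cov_rho[of A B] N.tor_eq[of A B] by (simp add: conn_diff_def N.tor_def algebra_simps)

text \<open>Difference of the two metric conditions. It would be zero if the connection maps were
  known to agree; the right-hand side records their discrepancy.\<close>

lemma conn_diff_skew:
  assumes [simp]: "A \<in> VF" "Y \<in> PF" "Z \<in> PF"
  shows "g (conn_diff A Y) Z x + g (conn_diff A Z) Y x = - 2 * g (N.T (conn_map_diff A) Y) Z x"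
proof -
  have "g (conn_diff A Y) Z x = g (D A Y) Z x - g (N A Y) Z x + g (N.T (N A eta) Y) Z x"
      if "Y \<in> PF" "Z \<in> PF" for Y Z
    using that by (simp add: conn_diff_def N.g_add_left N.g_diff_left)
  moreover have "g (N.T (conn_map_diff A) Y) Z x = g (N.T (D A eta) Y) Z x - g (N.T (N A eta) Y) Z x"
    by (simp add: conn_map_diff_def N.T_diff_left N.g_diff_left)
  ultimately show ?thesis
    using D_metric[of A Y Z x] N.metric[of A Y Z x] N.g_sym[of Y "D A Z"] N.g_sym[of Y "N A Z"]
      g_T_swap23[of "N A eta" Y Z x] by simp
qed

text \<open>Alternating sum of three instances of \<open>conn_diff_skew\<close>, as for Christoffel
  symbols. The arguments are written \<open>rho B\<close> because symmetry in the first two slots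
  makes sense only for vector fields on the slit bundle.\<close>

lemma g_conn_diff:
  assumes [simp]: "A \<in> VF" "B \<in> VF" "C \<in> VF"
  shows "g (conn_diff A (rho B)) (rho C) x = g (N.T (conn_map_diff C) (rho A)) (rho B) x
    - g (N.T (conn_map_diff A) (rho B)) (rho C) x - g (N.T (conn_map_diff B) (rho A)) (rho C) x"
  using conn_diff_skew[of A "rho B" "rho C" x] conn_diff_skew[of B "rho A" "rho C" x] conn_diff_skew[of C "rho A" "rho B" x]
    conn_diff_sym[of A B] conn_diff_sym[of A C] conn_diff_sym[of B C] by simp

text \<open>The second vector field is a lift of \<open>eta\<close>, so two of the three terms have
  \<open>eta\<close> as an argument of \<open>T\<close> and vanish.\<close>

lemma g_conn_map_diff:
  assumes [simp]: "A \<in> VF" "Z \<in> PF"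
  shows "g (conn_map_diff A) Z x = - g (N.T (conn_map_diff (betaN eta)) (rho A)) Z x"
proof -
  have "conn_diff A eta = conn_map_diff A" by (simp add: conn_diff_def conn_map_diff_def)
  then show ?thesis
    using g_conn_diff[of A "betaN eta" "betaN Z" x] g_T_swap23[of "conn_map_diff (betaN Z)" "rho A" eta x] by simp
qed

text \<open>For the lift of \<open>eta\<close> the remaining term again has \<open>eta\<close>
  inside \<open>T\<close>; once the discrepancy is zero there, the same formula gives zero for every
  vector field.\<close>

lemma conn_map_diff_eq_0: "A \<in> VF \<Longrightarrow> conn_map_diff A = 0"
proof -
  have "conn_map_diff (betaN eta) = 0"
    by (rule N.g_nondegenerate) (simp_all add: g_conn_map_diff)
  then show "conn_map_diff A = 0" if "A \<in> VF"
    using that by (intro N.g_nondegenerate) (simp_all add: g_conn_map_diff)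
qed

lemma conn_map_eq: "A \<in> VF \<Longrightarrow> D A eta = N A eta"
  using conn_map_diff_eq_0 by (simp add: conn_map_diff_def)

lemma D_eq: 
  assumes [simp]: "A \<in> VF" "Y \<in> PF"
  shows "D A Y = N A Y - N.T (N A eta) Y"
proof -
  have "conn_diff A Y = 0"
  proof (rule N.g_nondegenerate)
    fix Z x assume [simp]: "Z \<in> PF"
    show "g (conn_diff A Y) Z x = g 0 Z x"
      using g_conn_diff[of A "betaN Y" "betaN Z" x] by (simp add: conn_map_diff_eq_0)
  qed simp_all
  then show ?thesis by (simp add: conn_diff_def algebra_simps)
qed

text \<open>By \<open>conn_map_eq\<close> the Cartan lift is horizontal for \<open>D\<close> as
  well, and such a lift is unique.\<close>

lemma beta_eq: "X \<in> PF \<Longrightarrow> betaD X = betaN X"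
  using D.horizontal_unique[of "betaN X"] conn_map_eq by simp

lemma D_beta: "X \<in> PF \<Longrightarrow> Y \<in> PF \<Longrightarrow> D (betaN X) Y = N (betaN X) Y"
  by (simp add: D_eq)

lemma D_beta_eta [simp]: "X \<in> PF \<Longrightarrow> D (betaN X) eta = 0"
  by (simp add: D_beta)

section \<open>Identities for the hv-curvature of the Chern connection\<close>

definition DT where
  "DT V X Y Z x = act V (g (N.T X Y) Z) x
     - g (N.T (D V X) Y) Z x - g (N.T X (D V Y)) Z x - g (N.T X Y) (D V Z) x"

abbreviation Phat where "Phat X Y \<equiv> D.P X Y eta"

lemma Phat_eq: "X \<in> PF \<Longrightarrow> Y \<in> PF \<Longrightarrow> Phat X Y = D (br (betaN X) (gam Y)) eta - D (betaN X) Y"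
  by (simp add: D.P_def D.curv_def beta_eq D.cov_gam_eta)

text \<open>Contraction with \<open>eta\<close> leaves only the connection map and derivatives along
  horizontal lifts, and in both the two connections coincide.\<close>

lemma Phat_N: "X \<in> PF \<Longrightarrow> Y \<in> PF \<Longrightarrow> Phat X Y = N.P X Y eta"
  by (simp add: Phat_eq conn_map_eq N.P_def N.curv_def N.cov_gam_eta D_beta)

text \<open>The Ricci identity for \<open>g\<close>. The metric is parallel along \<open>A\<close>
  and has defect \<open>2 T\<close> along \<open>B\<close>; differentiating this defect along
  \<open>A\<close> gives the term \<open>DT\<close>, and the connection map of the bracket of
  \<open>A\<close> and \<open>B\<close> gives the term with \<open>Phat\<close>.\<close>

lemma P_metric:
  assumes [simp]: "X \<in> PF" "Y \<in> PF" "Z \<in> PF" "W \<in> PF"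
  shows "g (D.P X Y Z) W x + g (D.P X Y W) Z x =
    2 * DT (betaN X) Y Z W x - 2 * g (N.T (Phat X Y) Z) W x"
proof -
  define A where "A = betaN X"
  define B where "B = gam Y"
  have [simp]: "A \<in> VF" "B \<in> VF" by (simp_all add: A_def B_def)
  have actA: "act A (g U V) x = g (D A U) V x + g U (D A V) x" if "U \<in> PF" "V \<in> PF" for U V x
    using D_metric[of A U V x] that by (simp add: A_def)
  have actB: "act B (g U V) x = g (D B U) V x + g U (D B V) x + 2 * g (N.T Y U) V x" if "U \<in> PF" "V \<in> PF"
      for U V x
    using D_metric[of B U V x] that by (simp add: B_def D.cov_gam_eta)
  have "act A (g Z W) = g (D A Z) W + g Z (D A W)"
    by (rule ext) (simp add: actA)
  then have BA: "act B (act A (g Z W)) = act B (g (D A Z) W) + act B (g Z (D A W))"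
    by (simp add: N.act_add)
  \<comment> \<open>The factor 2 is written as a repeated summand, because \<open>act\<close> is
    only known to be additive.\<close>
  have "act B (g Z W) = g (D B Z) W + g Z (D B W) + (g (N.T Y Z) W + g (N.T Y Z) W)"
    by (rule ext) (simp add: actB)
  then have AB: "act A (act B (g Z W)) = act A (g (D B Z) W) + act A (g Z (D B W))
      + (act A (g (N.T Y Z) W) + act A (g (N.T Y Z) W))"
    by (simp only: N.act_add N.SF_add N.g_closed D.cov_closed N.T_closed assms \<open>A \<in> VF\<close> \<open>B \<in> VF\<close>)
  have "act (br A B) (g Z W) x = act A (act B (g Z W)) x - act B (act A (g Z W)) x"
    by (simp add: N.act_br)
  moreover have "g (D.P X Y Z) W x = - g (D A (D B Z)) W x + g (D B (D A Z)) W x + g (D (br A B) Z) W x"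
    if "Z \<in> PF" "W \<in> PF" for Z W
    using that by (simp add: D.P_def D.curv_def beta_eq N.g_add_left N.g_diff_left N.g_minus_left flip: A_def B_def)
  moreover have "g (N.T (Phat X Y) Z) W x = g (N.T (D (br A B) eta) Z) W x - g (N.T (D A Y) Z) W x"
    by (simp add: Phat_eq N.T_diff_left N.g_diff_left flip: A_def B_def)
  ultimately show ?thesis
    using D_metric[of "br A B" Z W x] N.g_sym[of Z "D A (D B W)"]
      N.g_sym[of Z "D B (D A W)"] N.g_sym[of Z "D (br A B) W"]
    by (simp add: AB BA actA actB DT_def flip: A_def)
qed

lemma P_formula:
  assumes [simp]: "X \<in> PF" "Y \<in> PF" "Z \<in> PF" "W \<in> PF"
  shows "g (D.P X Y Z) W x = DT (betaN X) Y Z W x + DT (betaN Z) Y W X x - DT (betaN W) Y X Z x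
    + g (N.T (Phat W Y) X) Z x - g (N.T (Phat X Y) Z) W x - g (N.T (Phat Z Y) W) X x"
  using P_metric[of X Y Z W x] P_metric[of Z Y W X x] P_metric[of W Y X Z x]
    D.P_sym[of X Y Z] D.P_sym[of X Y W] D.P_sym[of Z Y W] by simp

text \<open>With \<open>DT_swap12\<close> this makes \<open>DT\<close> totally symmetric, from which
  the symmetry in (f) is derived.\<close>

lemma DT_swap23: 
  assumes [simp]: "V \<in> VF" "X \<in> PF" "Y \<in> PF" "Z \<in> PF"
  shows "DT V X Y Z x = DT V X Z Y x"
proof -
  have "g (N.T X Y) Z = g (N.T X Z) Y" using g_T_swap23[of X Y Z] by (intro ext) simp
  then show ?thesis
    using g_T_swap23[of "D V X" Y Z x] g_T_swap23[of X "D V Y" Z x] g_T_swap23[of X Y "D V Z" x]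
    by (simp add: DT_def)
qed

lemma DT_swap12: 
  assumes [simp]: "V \<in> VF" "X \<in> PF" "Y \<in> PF" "Z \<in> PF"
  shows "DT V X Y Z x = DT V Y X Z x"
  using N.T_sym[of X Y] N.T_sym[of "D V X" Y] N.T_sym[of X "D V Y"] by (simp add: DT_def)

lemma DT_eta_left [simp]: 
  assumes [simp]: "U \<in> PF" "Y \<in> PF" "Z \<in> PF"
  shows "DT (betaN U) eta Y Z x = 0"
proof -
  \<comment> \<open>The derivative of the zero function \<open>g 0 Z\<close> is read off from the
    Chern metric condition.\<close>
  have "act (betaN U) (g 0 Z) x = 0" using D_metric[of "betaN U" 0 Z x] by simp
  then show ?thesis by (simp add: DT_def)
qed

lemma DT_eta_middle [simp]: "U \<in> PF \<Longrightarrow> Y \<in> PF \<Longrightarrow> Z \<in> PF \<Longrightarrow> DT (betaN U) Y eta Z x = 0"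
  using DT_swap12[of "betaN U" Y eta Z x] by simp

lemma DT_eta_right [simp]: "U \<in> PF \<Longrightarrow> Y \<in> PF \<Longrightarrow> Z \<in> PF \<Longrightarrow> DT (betaN U) Y Z eta x = 0"
  using DT_swap23[of "betaN U" Y Z eta x] by simp

lemma g_T_eta [simp]: "X \<in> PF \<Longrightarrow> Y \<in> PF \<Longrightarrow> g (N.T X Y) eta x = 0"
  using g_T_swap23[of X Y eta x] by simp

text \<open>With \<open>eta\<close> in the first and the third slot, every term of (c) has
  \<open>eta\<close> as an argument of \<open>T\<close> or of its horizontal derivative.\<close>

lemma Phat_eta_left [simp]: "X \<in> PF \<Longrightarrow> Phat eta X = 0"
  by (rule N.g_nondegenerate) (simp_all add: P_formula)

text \<open>Only the derivative along \<open>betaN eta\<close> survives in (c). The torsion term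
  containing \<open>Phat eta Y\<close> vanishes by (d), which therefore has to come first.\<close>

lemma g_Phat: "X \<in> PF \<Longrightarrow> Y \<in> PF \<Longrightarrow> W \<in> PF \<Longrightarrow> g (Phat X Y) W x = DT (betaN eta) Y W X x"
  by (simp add: P_formula[of X Y eta W])

definition DTv where
  "DTv V X Y = D V (N.T X Y) - N.T (D V X) Y - N.T X (D V Y)"

text \<open>The metric is parallel along horizontal lifts, so deriving the trilinear form and
  deriving the vector-valued map amount to the same there.\<close>

lemma g_DTv: 
  assumes [simp]: "U \<in> PF" "X \<in> PF" "Y \<in> PF" "Z \<in> PF"
  shows "g (DTv (betaN U) X Y) Z x = DT (betaN U) X Y Z x"
  using D_metric[of "betaN U" "N.T X Y" Z x] by (simp add: DTv_def DT_def N.g_diff_left)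

lemma Phat_eq_DTv: 
  assumes [simp]: "X \<in> PF" "Y \<in> PF"
  shows "Phat X Y = DTv (betaN eta) X Y"
proof (rule N.g_nondegenerate)
  show "DTv (betaN eta) X Y \<in> PF" by (simp add: DTv_def)
  fix Z x assume [simp]: "Z \<in> PF"
  show "g (Phat X Y) Z x = g (DTv (betaN eta) X Y) Z x"
    using DT_swap23[of "betaN eta" Y Z X x] DT_swap12[of "betaN eta" Y X Z x] by (simp add: g_Phat g_DTv)
qed simp

lemma Phat_sym: 
  assumes [simp]: "X \<in> PF" "Y \<in> PF"
  shows "Phat X Y = Phat Y X"
proof (rule N.g_nondegenerate)
  fix Z x assume [simp]: "Z \<in> PF"
  show "g (Phat X Y) Z x = g (Phat Y X) Z x"
    using DT_swap23[of "betaN eta" Y Z X x] DT_swap12[of "betaN eta" Y X Z x]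
     DT_swap23[of "betaN eta" X Y Z x] by (simp add: g_Phat)
qed simp_all

text \<open>Symmetry of \<open>Phat\<close> turns (d) into the vanishing of
  \<open>Phat V eta\<close>; the \<open>DT\<close> terms of (c) vanish because each has
  \<open>eta\<close> as an argument.\<close>

lemma P_eta_middle [simp]: 
  assumes [simp]: "X \<in> PF" "Y \<in> PF"
  shows "D.P X eta Y = 0"
proof (rule N.g_nondegenerate)
  fix Z x assume [simp]: "Z \<in> PF"
  have "Phat V eta = 0" if "V \<in> PF" for V using Phat_sym[of V eta] that by simp
  then show "g (D.P X eta Y) Z x = g 0 Z x" by (simp add: P_formula)
qed simp_all

lemma P_eta_left: "X \<in> PF \<Longrightarrow> Y \<in> PF \<Longrightarrow> D.P eta X Y = DTv (betaN eta) X Y"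
  using D.P_sym[of eta X Y] Phat_sym[of Y X] Phat_eq_DTv[of X Y] by simp

text \<open>After exchanging the two vertical directions, every term with \<open>eta\<close> in the
  middle slot is zero. The sole survivor comes from differentiating \<open>eta\<close> itself, as
  \<open>D (gam Y) eta = Y\<close>.\<close>

lemma cov_gam_eta_P: 
  assumes [simp]: "X \<in> PF" "Y \<in> PF" "Z \<in> PF"
  shows "D (gam eta) (D.P X Y Z) - D.P (D (gam eta) X) Y Z - D.P X (D (gam eta) Y) Z
    - D.P X Y (D (gam eta) Z) = - D.P X Y Z"
  using D.cov_gam_P_sym[of eta Y X Z] by (simp add: D.cov_gam_eta)

end

section \<open>Vector fields in charts\<close>

lemma cinv_in_cdom: "x \<in> crange c \<Longrightarrow> cinv c x \<in> cdom c"
  by (rule inv_into_into)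

lemma cmap_cinv: "x \<in> crange c \<Longrightarrow> cmap c (cinv c x) = x"
  by (rule f_inv_into_f)

abbreviation component ::
  "('p \<Rightarrow> ('p, 'e) tvec) \<Rightarrow> ('p, 'e) chart \<Rightarrow> 'e \<Rightarrow> 'e" where
  "component V c \<equiv> \<lambda>x. V (cinv c x) c"

text \<open>Three consequences of having an atlas, without any topology on the set of points. The
  same lemmas therefore apply to \<open>slit_atlas\<close>, for which no topology is
  defined.\<close>

locale smooth_charts =
  fixes \<B> :: "('p, 'e::euclidean_space) atlas"
  assumes inj_chart: "c \<in> \<B> \<Longrightarrow> inj_on (cmap c) (cdom c)"
    and open_overlap: "c \<in> \<B> \<Longrightarrow> d \<in> \<B> \<Longrightarrow> open (cmap c ` (cdom c \<inter> cdom d))"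
    and smooth_transition:
      "c \<in> \<B> \<Longrightarrow> d \<in> \<B> \<Longrightarrow> smooth_on (cmap c ` (cdom c \<inter> cdom d)) (cmap d \<circ> cinv c)"
begin

lemma open_crange: "c \<in> \<B> \<Longrightarrow> open (crange c)"
  using open_overlap[of c c] by simp

lemma cinv_cmap: "c \<in> \<B> \<Longrightarrow> p \<in> cdom c \<Longrightarrow> cinv c (cmap c p) = p"
  using inj_chart by simp

lemma has_derivative_transition:
  assumes "c \<in> \<B>" "d \<in> \<B>" "p \<in> cdom c" "p \<in> cdom d"
  shows "((cmap d \<circ> cinv c) has_derivative transition_deriv c d p) (at (cmap c p))"
  unfolding transition_deriv_def
  by (rule smooth_on_has_derivative[OF smooth_transition[OF assms(1,2)]]) (use assms(3,4) in auto)

lemma linear_transition_deriv: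
  assumes "c \<in> \<B>" "d \<in> \<B>" "p \<in> cdom c" "p \<in> cdom d"
  shows "linear (transition_deriv c d p)"
  using has_derivative_transition[OF assms] has_derivative_linear by blast

lemma transition_deriv_self:
  assumes "c \<in> \<B>" "p \<in> cdom c"
  shows "transition_deriv c c p w = w"
proof -
  have "((cmap c \<circ> cinv c) has_derivative (\<lambda>w. w)) (at (cmap c p))"
    by (rule has_derivative_transform_within_open[OF has_derivative_ident open_crange[OF assms(1)]])
       (use assms in \<open>auto simp: cmap_cinv\<close>)
  then show ?thesis by (simp add: transition_deriv_def frechet_derivative_at[symmetric])
qed

text \<open>Chain rule. This cocycle identity makes the family built from one component by
  \<open>coord_vec\<close> a tangent vector.\<close>

lemma transition_deriv_compose:
  assumes "c \<in> \<B>" "d \<in> \<B>" "e \<in> \<B>" "p \<in> cdom c" "p \<in> cdom d" "p \<in> cdom e"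
  shows "transition_deriv d e p (transition_deriv c d p w) = transition_deriv c e p w"
proof -
  let ?S = "cmap c ` (cdom c \<inter> cdom d) \<inter> cmap c ` (cdom c \<inter> cdom e)"
  have "((cmap e \<circ> cinv d) has_derivative transition_deriv d e p) (at ((cmap d \<circ> cinv c) (cmap c p)))"
    using has_derivative_transition[of d e p] assms by (simp add: cinv_cmap)
  from has_derivative_compose[OF has_derivative_transition[of c d p] this] assms
  have "((\<lambda>x. (cmap e \<circ> cinv d) ((cmap d \<circ> cinv c) x)) has_derivative
      (\<lambda>w. transition_deriv d e p (transition_deriv c d p w))) (at (cmap c p))" by simp
  then have "((cmap e \<circ> cinv c) has_derivative
      (\<lambda>w. transition_deriv d e p (transition_deriv c d p w))) (at (cmap c p))"
  proof (rule has_derivative_transform_within_open)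
    show "open ?S" using assms open_overlap by blast
    show "cmap c p \<in> ?S" using assms by blast
    show "(cmap e \<circ> cinv d) ((cmap d \<circ> cinv c) x) = (cmap e \<circ> cinv c) x" if "x \<in> ?S" for x
    proof -
      from that obtain q where "q \<in> cdom c" "q \<in> cdom d" "x = cmap c q" by blast
      then show ?thesis using assms by (simp add: cinv_cmap)
    qed
  qed
  then show ?thesis by (simp add: transition_deriv_def[of c e] frechet_derivative_at[symmetric])
qed

lemma tangent_space_transition:
  "v \<in> tangent_space \<B> p \<Longrightarrow> c \<in> \<B> \<Longrightarrow> d \<in> \<B> \<Longrightarrow> p \<in> cdom c \<Longrightarrow> p \<in> cdom d \<Longrightarrow>
    v d = transition_deriv c d p (v c)"
  unfolding tangent_space_def by blast

lemma tangent_space_outside: "v \<in> tangent_space \<B> p \<Longrightarrow> \<not> (c \<in> \<B> \<and> p \<in> cdom c) \<Longrightarrow> v c = 0"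
  unfolding tangent_space_def by blast

lemma coord_vec_tangent:
  assumes "c \<in> \<B>" "p \<in> cdom c"
  shows "coord_vec \<B> c w p \<in> tangent_space \<B> p"
  using assms by (auto simp: tangent_space_def coord_vec_def transition_deriv_compose)

lemma coord_vec_component: "c \<in> \<B> \<Longrightarrow> p \<in> cdom c \<Longrightarrow> coord_vec \<B> c w p c = w"
  by (simp add: coord_vec_def transition_deriv_self)

lemma tangent_space_eq_coord_vec:
  assumes "v \<in> tangent_space \<B> p" "c \<in> \<B>" "p \<in> cdom c"
  shows "v = coord_vec \<B> c (v c) p"
  by (rule ext)
     (use assms tangent_space_transition tangent_space_outside in \<open>auto simp: coord_vec_def\<close>)

lemma tangent_space_eqI:
  assumes "v \<in> tangent_space \<B> p" "w \<in> tangent_space \<B> p" "c \<in> \<B>" "p \<in> cdom c" "v c = w c"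
  shows "v = w"
  using tangent_space_eq_coord_vec[OF assms(1,3,4)] tangent_space_eq_coord_vec[OF assms(2-4)] assms(5)
  by simp

lemma tangent_spaceI:
  assumes "\<And>c d. c \<in> \<B> \<Longrightarrow> d \<in> \<B> \<Longrightarrow> p \<in> cdom c \<Longrightarrow> p \<in> cdom d \<Longrightarrow>
      v d = transition_deriv c d p (v c)"
    and "\<And>c. \<not> (c \<in> \<B> \<and> p \<in> cdom c) \<Longrightarrow> v c = 0"
  shows "v \<in> tangent_space \<B> p"
  unfolding tangent_space_def using assms by blast

lemma tangent_space_zero: "0 \<in> tangent_space \<B> p"
  by (rule tangent_spaceI) (simp_all add: linear_0[OF linear_transition_deriv])

lemma tangent_space_add:
  assumes "v \<in> tangent_space \<B> p" "w \<in> tangent_space \<B> p"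
  shows "v + w \<in> tangent_space \<B> p"
proof (rule tangent_spaceI)
  fix c d assume cd: "c \<in> \<B>" "d \<in> \<B>" "p \<in> cdom c" "p \<in> cdom d"
  show "(v + w) d = transition_deriv c d p ((v + w) c)"
    using tangent_space_transition[OF assms(1) cd] tangent_space_transition[OF assms(2) cd]
    by (simp add: linear_add[OF linear_transition_deriv[OF cd]])
qed (simp add: tangent_space_outside[OF assms(1)] tangent_space_outside[OF assms(2)])

lemma tangent_space_scale:
  assumes "v \<in> tangent_space \<B> p"
  shows "r *\<^sub>t v \<in> tangent_space \<B> p"
proof (rule tangent_spaceI)
  fix c d assume cd: "c \<in> \<B>" "d \<in> \<B>" "p \<in> cdom c" "p \<in> cdom d"
  show "(r *\<^sub>t v) d = transition_deriv c d p ((r *\<^sub>t v) c)"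
    using tangent_space_transition[OF assms cd]
    by (simp add: linear_cmul[OF linear_transition_deriv[OF cd]] tscale_def)
qed (simp add: tangent_space_outside[OF assms] tscale_def)

lemma tangent_space_minus: "v \<in> tangent_space \<B> p \<Longrightarrow> - v \<in> tangent_space \<B> p"
  using tangent_space_scale[of v p "-1"] by (simp add: tscale_def fun_Compl_def)

lemma linear_coord_vec:
  assumes "c \<in> \<B>" "p \<in> cdom c"
  shows "coord_vec \<B> c (v + w) p = coord_vec \<B> c v p + coord_vec \<B> c w p"
    and "coord_vec \<B> c (r *\<^sub>R w) p = r *\<^sub>t coord_vec \<B> c w p"
  using linear_add[OF linear_transition_deriv] linear_cmul[OF linear_transition_deriv] assms
  by (auto simp: coord_vec_def tscale_def fun_eq_iff)

lemma chart_at: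
  assumes "p \<in> points \<B>"
  shows "chart_at \<B> p \<in> \<B>" "p \<in> cdom (chart_at \<B> p)"
proof -
  have "\<exists>c. c \<in> \<B> \<and> p \<in> cdom c" using assms by (auto simp: points_def)
  from someI_ex[OF this] show "chart_at \<B> p \<in> \<B>" "p \<in> cdom (chart_at \<B> p)"
    by (auto simp: chart_at_def)
qed

lemma pointsI: "c \<in> \<B> \<Longrightarrow> p \<in> cdom c \<Longrightarrow> p \<in> points \<B>"
  by (auto simp: points_def)

text \<open>The definition picks a chart by choice; the chain rule carries the value to an arbitrary
  chart around \<open>p\<close>.\<close>

lemma fun_differential_chart:
  assumes "smooth_fun \<B> f" "c \<in> \<B>" "p \<in> cdom c" "a \<in> tangent_space \<B> p"
  shows "fun_differential \<B> f p a = frechet_derivative (f \<circ> cinv c) (at (cmap c p)) (a c)"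
proof -
  define d where "d = chart_at \<B> p"
  have d: "d \<in> \<B>" "p \<in> cdom d" using chart_at pointsI assms by (auto simp: d_def)
  have "((f \<circ> cinv d) has_derivative frechet_derivative (f \<circ> cinv d) (at (cmap d p)))
      (at ((cmap d \<circ> cinv c) (cmap c p)))"
    using assms d smooth_on_has_derivative[of "crange d" "f \<circ> cinv d" "cmap d p"]
    by (simp add: smooth_fun_def cinv_cmap)
  from has_derivative_compose[OF has_derivative_transition[OF assms(2) d(1) assms(3) d(2)] this]
  have "((f \<circ> cinv c) has_derivative
      (\<lambda>w. frechet_derivative (f \<circ> cinv d) (at (cmap d p)) (transition_deriv c d p w))) (at (cmap c p))"
    by (rule has_derivative_transform_within_open[OF _ open_overlap[OF assms(2) d(1)]])
       (use assms d in \<open>auto simp: cinv_cmap\<close>)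
  then have "frechet_derivative (f \<circ> cinv c) (at (cmap c p)) (a c) =
      frechet_derivative (f \<circ> cinv d) (at (cmap d p)) (a d)"
    using tangent_space_transition[OF assms(4,2) d(1) assms(3) d(2)]
    by (simp add: frechet_derivative_at[symmetric])
  then show ?thesis by (simp add: fun_differential_def Let_def flip: d_def)
qed

lemma smooth_fun_add: "smooth_fun \<B> f \<Longrightarrow> smooth_fun \<B> h \<Longrightarrow> smooth_fun \<B> (f + h)"
  using smooth_on_add[OF open_crange, of _ "f \<circ> cinv _" "h \<circ> cinv _"]
  by (simp add: smooth_fun_def o_def)

lemma vector_field_tangent: "V \<in> vector_fields \<B> \<Longrightarrow> p \<in> points \<B> \<Longrightarrow> V p \<in> tangent_space \<B> p"
  by (simp add: vector_fields_def)

lemma vector_field_outside: "V \<in> vector_fields \<B> \<Longrightarrow> p \<notin> points \<B> \<Longrightarrow> V p = 0"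
  by (simp add: vector_fields_def)

lemma vector_field_smooth: "V \<in> vector_fields \<B> \<Longrightarrow> c \<in> \<B> \<Longrightarrow> smooth_on (crange c) (component V c)"
  by (simp add: vector_fields_def)

lemma vector_field_differentiable:
  "V \<in> vector_fields \<B> \<Longrightarrow> c \<in> \<B> \<Longrightarrow> p \<in> cdom c \<Longrightarrow> component V c differentiable (at (cmap c p))"
  using smooth_on_differentiable[OF vector_field_smooth] by blast

lemma vector_fields_zero: "0 \<in> vector_fields \<B>"
  by (auto simp: vector_fields_def tangent_space_zero smooth_on_const)

lemma vector_fields_add:
  "V \<in> vector_fields \<B> \<Longrightarrow> W \<in> vector_fields \<B> \<Longrightarrow> V + W \<in> vector_fields \<B>"
  by (auto simp: vector_fields_def tangent_space_add smooth_on_add open_crange)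

lemma vector_fields_minus: "V \<in> vector_fields \<B> \<Longrightarrow> - V \<in> vector_fields \<B>"
  by (auto simp: vector_fields_def tangent_space_minus smooth_on_uminus open_crange)

lemma vector_field_transition:
  assumes "V \<in> vector_fields \<B>" "c \<in> \<B>" "d \<in> \<B>" "y \<in> cmap c ` (cdom c \<inter> cdom d)"
  shows "component V d ((cmap d \<circ> cinv c) y) =
    frechet_derivative (cmap d \<circ> cinv c) (at y) (component V c y)"
proof -
  obtain p where p: "p \<in> cdom c" "p \<in> cdom d" "y = cmap c p" using assms(4) by blast
  then show ?thesis
    using tangent_space_transition[OF vector_field_tangent[OF assms(1)] assms(2,3)] pointsI assms
    by (simp add: cinv_cmap transition_deriv_def)
qed

lemma field_act_chart:
  assumes "V \<in> vector_fields \<B>" "smooth_fun \<B> f" "c \<in> \<B>" "p \<in> cdom c"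
  shows "field_act \<B> V f p = frechet_derivative (f \<circ> cinv c) (at (cmap c p)) (V p c)"
  using fun_differential_chart[OF assms(2-4)] vector_field_tangent[OF assms(1)] pointsI[OF assms(3,4)]
  by (simp add: field_act_def)

lemma field_act_add:
  assumes "V \<in> vector_fields \<B>" "smooth_fun \<B> f" "smooth_fun \<B> h"
  shows "field_act \<B> V (f + h) = field_act \<B> V f + field_act \<B> V h"
proof
  fix p
  show "field_act \<B> V (f + h) p = (field_act \<B> V f + field_act \<B> V h) p"
  proof (cases "p \<in> points \<B>")
    case True
    then obtain c where c: "c \<in> \<B>" "p \<in> cdom c" by (auto simp: points_def)
    have s: "smooth_on (crange c) (f \<circ> cinv c)" "smooth_on (crange c) (h \<circ> cinv c)"
      using assms c by (auto simp: smooth_fun_def)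
    have "((\<lambda>x. (f \<circ> cinv c) x + (h \<circ> cinv c) x) has_derivative
      (\<lambda>w. frechet_derivative (f \<circ> cinv c) (at (cmap c p)) w
         + frechet_derivative (h \<circ> cinv c) (at (cmap c p)) w)) (at (cmap c p))"
      by (intro has_derivative_add smooth_on_has_derivative[OF s(1)] smooth_on_has_derivative[OF s(2)])
         (use c in auto)
    from frechet_derivative_at[OF this]
    have "frechet_derivative ((f + h) \<circ> cinv c) (at (cmap c p)) w =
      frechet_derivative (f \<circ> cinv c) (at (cmap c p)) w
         + frechet_derivative (h \<circ> cinv c) (at (cmap c p)) w" for w
      by (simp add: o_def fun_eq_iff)
    then show ?thesis
      using assms c smooth_fun_add by (simp add: field_act_chart)
  qed (simp add: field_act_def)
qed

section \<open>The Lie bracket: invariance, Jacobi identity and commutators of derivations\<close>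

lemma lie_bracket_chart:
  assumes "c \<in> \<B>" "p \<in> cdom c"
  shows "lie_bracket \<B> V W p c = frechet_derivative (component W c) (at (cmap c p)) (V p c)
        - frechet_derivative (component V c) (at (cmap c p)) (W p c)"
  using assms by (simp add: lie_bracket_def)

lemma component_lie_bracket:
  assumes "c \<in> \<B>" "x \<in> crange c"
  shows "component (lie_bracket \<B> V W) c x = frechet_derivative (component W c) (at x) (component V c x)
        - frechet_derivative (component V c) (at x) (component W c x)"
  using assms by (simp add: lie_bracket_chart cinv_in_cdom cmap_cinv)

lemma lie_bracket_outside: "p \<notin> points \<B> \<Longrightarrow> lie_bracket \<B> V W p = 0"
  by (auto simp: lie_bracket_def points_def fun_eq_iff)

text \<open>Each half of the bracket transforms with an extra term, a second derivative of the
  transition map; the two extra terms agree by symmetry of second derivatives and cancel.\<close>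

lemma lie_bracket_transition:
  assumes "V \<in> vector_fields \<B>" "W \<in> vector_fields \<B>" "c \<in> \<B>" "d \<in> \<B>" "p \<in> cdom c" "p \<in> cdom d"
  shows "lie_bracket \<B> V W p d = transition_deriv c d p (lie_bracket \<B> V W p c)"
proof -
  let ?S = "cmap c ` (cdom c \<inter> cdom d)" and ?\<tau> = "cmap d \<circ> cinv c" and ?z = "cmap c p"
  have S: "open ?S" "?z \<in> ?S" "smooth_on ?S ?\<tau>" "?\<tau> ?z = cmap d p"
    using assms open_overlap smooth_transition by (auto simp: cinv_cmap)
  have key: "frechet_derivative (component W d) (at (cmap d p)) (V p d) =
      frechet_derivative (\<lambda>y. frechet_derivative ?\<tau> (at y) (W p c)) (at ?z) (V p c)
      + transition_deriv c d p (frechet_derivative (component W c) (at ?z) (V p c))"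
    if V: "V \<in> vector_fields \<B>" and W: "W \<in> vector_fields \<B>" for V W
  proof -
    have sW: "smooth_on ?S (component W c)"
      by (rule smooth_on_subset[OF vector_field_smooth[OF W assms(3)]]) auto
    have "(component W d has_derivative frechet_derivative (component W d) (at (cmap d p))) (at (?\<tau> ?z))"
      unfolding S(4)
      by (rule smooth_on_has_derivative[OF vector_field_smooth[OF W assms(4)] imageI[OF assms(6)]])
    from has_derivative_compose[OF has_derivative_transition[OF assms(3-6)] this]
    have 1: "((\<lambda>y. frechet_derivative ?\<tau> (at y) (component W c y)) has_derivative
        (\<lambda>h. frechet_derivative (component W d) (at (cmap d p)) (transition_deriv c d p h))) (at ?z)"
      by (rule has_derivative_transform_within_open[OF _ S(1,2)])
         (rule vector_field_transition[OF W assms(3,4)])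
    have "frechet_derivative (component W d) (at (cmap d p)) (transition_deriv c d p (V p c)) =
        frechet_derivative (\<lambda>y. frechet_derivative ?\<tau> (at y) (component W c y)) (at ?z) (V p c)"
      using frechet_derivative_at[OF 1] by (rule fun_cong)
    also have "\<dots> = frechet_derivative (\<lambda>y. frechet_derivative ?\<tau> (at y) (component W c ?z)) (at ?z) (V p c)
        + frechet_derivative ?\<tau> (at ?z) (frechet_derivative (component W c) (at ?z) (V p c))"
      by (rule frechet_derivative_frechet_field[OF S(1,3) sW S(2)])
    also have "transition_deriv c d p (V p c) = V p d"
      by (rule tangent_space_transition[OF vector_field_tangent[OF V pointsI[OF assms(3,5)]] assms(3-6), symmetric])
    finally show ?thesis
      unfolding transition_deriv_def cinv_cmap[OF assms(3,5)] .
  qed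
  show ?thesis
    using key[OF assms(1,2)] key[OF assms(2,1)] assms
      frechet_derivative_commute[OF S(1,3,2), of "W p c" "V p c"]
    by (simp add: lie_bracket_chart linear_diff[OF linear_transition_deriv])
qed

lemma lie_bracket_closed:
  assumes "V \<in> vector_fields \<B>" "W \<in> vector_fields \<B>"
  shows "lie_bracket \<B> V W \<in> vector_fields \<B>"
  unfolding vector_fields_def
proof (intro CollectI conjI ballI allI impI)
  fix p assume "p \<in> points \<B>"
  then show "lie_bracket \<B> V W p \<in> tangent_space \<B> p"
    by (intro tangent_spaceI lie_bracket_transition[OF assms]) (assumption+, auto simp: lie_bracket_def)
next
  fix c assume c: "c \<in> \<B>"
  show "smooth_on (crange c) (component (lie_bracket \<B> V W) c)"
    by (rule smooth_on_cong[OF open_crange[OF c], where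
        f = "\<lambda>x. frechet_derivative (component W c) (at x) (component V c x)
        - frechet_derivative (component V c) (at x) (component W c x)"])
       (intro smooth_on_diff smooth_on_frechet_field open_crange c vector_field_smooth assms,
         simp add: component_lie_bracket c)
qed (simp add: lie_bracket_outside)

lemma lie_bracket_antisym: "lie_bracket \<B> W V = - lie_bracket \<B> V W"
  by (auto simp: lie_bracket_def fun_eq_iff)

lemma field_eqI:
  assumes "\<And>p c. \<not> (c \<in> \<B> \<and> p \<in> cdom c) \<Longrightarrow> V p c = W p c"
    and "\<And>p c. c \<in> \<B> \<Longrightarrow> p \<in> cdom c \<Longrightarrow> V p c = W p c"
  shows "V = W"
  using assms by (metis ext)

lemma frechet_component_add:
  assumes "V \<in> vector_fields \<B>" "W \<in> vector_fields \<B>" "c \<in> \<B>" "p \<in> cdom c"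
  shows "frechet_derivative (component (V + W) c) (at (cmap c p)) h =
    frechet_derivative (component V c) (at (cmap c p)) h
    + frechet_derivative (component W c) (at (cmap c p)) h"
proof -
  have "((\<lambda>x. component V c x + component W c x) has_derivative
      (\<lambda>h. frechet_derivative (component V c) (at (cmap c p)) h
        + frechet_derivative (component W c) (at (cmap c p)) h)) (at (cmap c p))"
    using assms by (intro has_derivative_add smooth_on_has_derivative[OF vector_field_smooth]) auto
  from fun_cong[OF frechet_derivative_at[OF this]] show ?thesis by simp
qed

lemma lie_bracket_add_left:
  assumes "U \<in> vector_fields \<B>" "V \<in> vector_fields \<B>" "W \<in> vector_fields \<B>"
  shows "lie_bracket \<B> (U + V) W = lie_bracket \<B> U W + lie_bracket \<B> V W"
proof (rule field_eqI)
  fix p c assume c: "c \<in> \<B>" "p \<in> cdom c"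
  have "linear (frechet_derivative (component W c) (at (cmap c p)))"
    using linear_frechet_derivative[OF vector_field_differentiable[OF assms(3) c]] .
  then show "lie_bracket \<B> (U + V) W p c = (lie_bracket \<B> U W + lie_bracket \<B> V W) p c"
    using frechet_component_add[OF assms(1,2) c, of "W p c"]
    by (simp add: lie_bracket_chart c linear_add)
qed (auto simp: lie_bracket_def)

text \<open>In one chart a nested bracket consists of second derivatives and of compositions of
  first derivatives. In the cyclic sum the former cancel by symmetry, the latter because each
  composition occurs with both signs.\<close>

lemma lie_bracket_jacobi:
  assumes "U \<in> vector_fields \<B>" "V \<in> vector_fields \<B>" "W \<in> vector_fields \<B>"
  shows "lie_bracket \<B> U (lie_bracket \<B> V W) + lie_bracket \<B> V (lie_bracket \<B> W U)
    + lie_bracket \<B> W (lie_bracket \<B> U V) = 0"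
proof (rule field_eqI)
  fix p c assume c: "c \<in> \<B>" "p \<in> cdom c"
  let ?z = "cmap c p"
  let ?D = "\<lambda>V. frechet_derivative (component V c) (at ?z)"
  let ?DD = "\<lambda>V h k. frechet_derivative (\<lambda>y. frechet_derivative (component V c) (at y) k) (at ?z) h"
  have z: "?z \<in> crange c" using c by blast
  note o = open_crange[OF c(1)]
  have lin: "linear (?D V)" if "V \<in> vector_fields \<B>" for V
    using linear_frechet_derivative[OF vector_field_differentiable[OF that c]] .
  have DD: "?DD V h k = ?DD V k h" if "V \<in> vector_fields \<B>" for V h k
    by (rule frechet_derivative_commute[OF o vector_field_smooth[OF that c(1)] z])
  have bracket: "lie_bracket \<B> U (lie_bracket \<B> V W) p c =
      ?DD W (U p c) (V p c) + ?D W (?D V (U p c)) - ?DD V (U p c) (W p c) - ?D V (?D W (U p c))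
      - ?D U (?D W (V p c)) + ?D U (?D V (W p c))"
    if V: "V \<in> vector_fields \<B>" and W: "W \<in> vector_fields \<B>" and U: "U \<in> vector_fields \<B>" for U V W
  proof -
    have s: "smooth_on (crange c) (\<lambda>x. frechet_derivative (component W c) (at x) (component V c x))"
      if "V \<in> vector_fields \<B>" "W \<in> vector_fields \<B>" for V W
      using that by (intro smooth_on_frechet_field o vector_field_smooth c)
    have d: "frechet_derivative (\<lambda>x. frechet_derivative (component W c) (at x) (component V c x)) (at ?z) h
        = ?DD W h (V p c) + ?D W (?D V h)" if "V \<in> vector_fields \<B>" "W \<in> vector_fields \<B>" for V W h
      using frechet_derivative_frechet_field[OF o vector_field_smooth[OF that(2) c(1)]
          vector_field_smooth[OF that(1) c(1)] z] c by (simp add: cinv_cmap)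
    have "((\<lambda>x. frechet_derivative (component W c) (at x) (component V c x)
        - frechet_derivative (component V c) (at x) (component W c x)) has_derivative
        (\<lambda>h. (?DD W h (V p c) + ?D W (?D V h)) - (?DD V h (W p c) + ?D V (?D W h)))) (at ?z)"
      using has_derivative_diff[OF smooth_on_has_derivative[OF s[OF V W] z] smooth_on_has_derivative[OF s[OF W V] z]]
      by (simp add: d[OF V W] d[OF W V])
    then have "(component (lie_bracket \<B> V W) c has_derivative
        (\<lambda>h. (?DD W h (V p c) + ?D W (?D V h)) - (?DD V h (W p c) + ?D V (?D W h)))) (at ?z)"
      by (rule has_derivative_transform_within_open[OF _ o z]) (simp add: component_lie_bracket c)
    note fun_cong[OF frechet_derivative_at[OF this], symmetric, of "U p c"]
    then show ?thesis
      by (simp add: lie_bracket_chart[OF c] linear_diff[OF lin[OF U]])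
  qed
  show "(lie_bracket \<B> U (lie_bracket \<B> V W) + lie_bracket \<B> V (lie_bracket \<B> W U)
    + lie_bracket \<B> W (lie_bracket \<B> U V)) p c = 0 p c"
    unfolding plus_fun_apply zero_fun_apply bracket[OF assms(2,3,1)] bracket[OF assms(3,1,2)]
      bracket[OF assms(1,2,3)] DD[OF assms(3), of "U p c" "V p c"] DD[OF assms(2), of "U p c" "W p c"]
      DD[OF assms(1), of "V p c" "W p c"]
    by (simp add: algebra_simps)
qed (auto simp: lie_bracket_def)

lemma field_act_lie_bracket:
  assumes "V \<in> vector_fields \<B>" "W \<in> vector_fields \<B>" "smooth_fun \<B> f"
  shows "field_act \<B> (lie_bracket \<B> V W) f = field_act \<B> V (field_act \<B> W f) - field_act \<B> W (field_act \<B> V f)"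
proof
  fix p
  show "field_act \<B> (lie_bracket \<B> V W) f p =
    (field_act \<B> V (field_act \<B> W f) - field_act \<B> W (field_act \<B> V f)) p"
  proof (cases "p \<in> points \<B>")
    case True
    \<comment> \<open>This is the chart that \<open>field_act\<close> itself picks at
      \<open>p\<close>, so the outer derivative can be unfolded without knowing that the inner one
      is a smooth function.\<close>
    define c where "c = chart_at \<B> p"
    let ?z = "cmap c p" and ?f = "f \<circ> cinv c"
    let ?D = "\<lambda>V. frechet_derivative (component V c) (at ?z)"
    have c: "c \<in> \<B>" "p \<in> cdom c" using chart_at True by (auto simp: c_def)
    have z: "?z \<in> crange c" using c by blast
    note o = open_crange[OF c(1)]
    have f: "smooth_on (crange c) ?f" using assms(3) c by (simp add: smooth_fun_def)
    have second: "field_act \<B> V (field_act \<B> W f) p =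
      frechet_derivative (\<lambda>y. frechet_derivative ?f (at y) (W p c)) (at ?z) (V p c)
      + frechet_derivative ?f (at ?z) (?D W (V p c))"
      if V: "V \<in> vector_fields \<B>" and W: "W \<in> vector_fields \<B>" for V W
    proof -
      have s: "smooth_on (crange c) (\<lambda>x. frechet_derivative ?f (at x) (component W c x))"
        by (intro smooth_on_frechet_field o f vector_field_smooth W c)
      have "frechet_derivative (\<lambda>x. frechet_derivative ?f (at x) (component W c x)) (at ?z)
          = frechet_derivative (field_act \<B> W f \<circ> cinv c) (at ?z)"
        by (rule frechet_derivative_transform_within_open[OF smooth_on_differentiable[OF s z] o z])
           (use assms W c in \<open>simp add: field_act_chart cinv_in_cdom cmap_cinv\<close>)
      then have "field_act \<B> V (field_act \<B> W f) p =
          frechet_derivative (\<lambda>x. frechet_derivative ?f (at x) (component W c x)) (at ?z) (V p c)"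
        using True by (simp add: field_act_def[of _ V] fun_differential_def Let_def flip: c_def)
      then show ?thesis
        using frechet_derivative_frechet_field[OF o f vector_field_smooth[OF W c(1)] z] c
        by (simp add: cinv_cmap)
    qed
    have "linear (frechet_derivative ?f (at ?z))"
      using smooth_on_frechet_linear[OF f z] .
    then show ?thesis
      using second[OF assms(1,2)] second[OF assms(2,1)] c assms
        frechet_derivative_commute_real[OF o f z, of "W p c" "V p c"]
      by (simp add: field_act_chart lie_bracket_closed lie_bracket_chart linear_diff)
  qed (simp add: field_act_def)
qed

end

section \<open>The slit tangent bundle\<close>

lemma points_slit_atlas: "points (slit_atlas \<A>) = slit_bundle \<A>"
  by (auto simp: points_def slit_atlas_def slit_chart_def slit_bundle_def)

lemma slit_chart_in [simp, intro]: "c \<in> \<A> \<Longrightarrow> slit_chart \<A> c \<in> slit_atlas \<A>"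
  by (simp add: slit_atlas_def)

lemma cdom_slit_chart: "u \<in> cdom (slit_chart \<A> c) \<longleftrightarrow> u \<in> slit_bundle \<A> \<and> fst u \<in> cdom c"
  by (auto simp: slit_chart_def)

lemma cmap_slit_chart: "cmap (slit_chart \<A> c) u = (cmap c (fst u), snd u c)"
  by (simp add: slit_chart_def case_prod_unfold)

lemma slit_bundleD:
  assumes "u \<in> slit_bundle \<A>"
  shows "fst u \<in> points \<A>" "snd u \<in> tangent_space \<A> (fst u)" "snd u \<noteq> 0"
  using assms by (auto simp: slit_bundle_def)

text \<open>The second component evaluates a family of derivatives on the moving fibre coordinate,
  whence the term with the second derivative of \<open>f\<close>.\<close>

lemma has_derivative_tangent_map:
  fixes f :: "'e::euclidean_space \<Rightarrow> 'e"
  assumes "open S" "smooth_on S f" "fst z \<in> S"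
  shows "((\<lambda>z. (f (fst z), frechet_derivative f (at (fst z)) (snd z))) has_derivative
    (\<lambda>h. (frechet_derivative f (at (fst z)) (fst h),
       frechet_derivative (\<lambda>x. frechet_derivative f (at x) (snd z)) (at (fst z)) (fst h)
       + frechet_derivative f (at (fst z)) (snd h)))) (at z)"
proof (rule has_derivative_Pair)
  have fst: "(fst has_derivative fst) (at z)" by (rule has_derivative_fst[OF has_derivative_ident])
  show "((\<lambda>z. f (fst z)) has_derivative (\<lambda>h. frechet_derivative f (at (fst z)) (fst h))) (at z)"
    by (rule has_derivative_compose[OF fst smooth_on_has_derivative[OF assms(2,3)]])
  have d: "((\<lambda>z. frechet_derivative f (at (fst z)) w) has_derivative
      (\<lambda>h. frechet_derivative (\<lambda>x. frechet_derivative f (at x) w) (at (fst z)) (fst h))) (at z)" for w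
    by (rule has_derivative_compose[OF fst smooth_on_has_derivative[OF smooth_on_frechet[OF assms(2)] assms(3)]])
  have "((\<lambda>y. frechet_derivative f (at (fst y)) (snd y)) has_derivative
      (\<lambda>h. frechet_derivative (\<lambda>y. frechet_derivative f (at (fst y)) (snd z)) (at z) h
         + frechet_derivative f (at (fst z)) (snd h))) (at z)"
  proof (rule has_derivative_linear_family[where F = "\<lambda>y. frechet_derivative f (at (fst y))" and S = "S \<times> UNIV"])
    show "linear (frechet_derivative f (at (fst y)))" if "y \<in> S \<times> UNIV" for y :: "'e \<times> 'e"
      using smooth_on_frechet_linear[OF assms(2)] that by auto
    show "(\<lambda>y. frechet_derivative f (at (fst y)) w) differentiable (at z)" for w
      using d differentiable_def by blast
    show "(snd has_derivative snd) (at z)" by (rule has_derivative_snd[OF has_derivative_ident])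
  qed (use assms in \<open>auto simp: open_Times mem_Times_iff\<close>)
  then show "((\<lambda>y. frechet_derivative f (at (fst y)) (snd y)) has_derivative
      (\<lambda>h. frechet_derivative (\<lambda>x. frechet_derivative f (at x) (snd z)) (at (fst z)) (fst h)
         + frechet_derivative f (at (fst z)) (snd h))) (at z)"
    by (simp add: frechet_derivative_at[OF d, symmetric])
qed

lemma smooth_on_tangent_map:
  fixes f :: "'e::euclidean_space \<Rightarrow> 'e"
  assumes "open S" "smooth_on S f" "open T" "T \<subseteq> S \<times> UNIV"
  shows "smooth_on T (\<lambda>z. (f (fst z), frechet_derivative f (at (fst z)) (snd z)))"
proof (rule smooth_on_Pair[OF assms(3)])
  have fst: "bounded_linear fst" "fst ` T \<subseteq> S" using assms(4) by (auto simp: bounded_linear_fst)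
  show "smooth_on T (\<lambda>z. f (fst z))"
    by (rule smooth_on_compose_linear[OF fst(1) assms(3) fst(2) assms(2)])
  show "smooth_on T (\<lambda>z. frechet_derivative f (at (fst z)) (snd z))"
  proof (rule smooth_on_linear_family[where F = "\<lambda>z. frechet_derivative f (at (fst z))" and g = snd, OF assms(3)])
    show "linear (frechet_derivative f (at (fst z)))" if "z \<in> T" for z
      using smooth_on_frechet_linear[OF assms(2)] fst(2) that by blast
    show "smooth_on T (\<lambda>z. frechet_derivative f (at (fst z)) w)" for w
      by (rule smooth_on_compose_linear[OF fst(1) assms(3) fst(2) smooth_on_frechet[OF assms(2)]])
    show "smooth_on T snd"
      by (rule smooth_on_linear[OF assms(3) bounded_linear_snd smooth_on_ident])
  qed
qed

section \<open>The slit bundle as a manifold\<close>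

locale slit_charts = base: smooth_charts \<A>
  for \<A> :: "('m, 'e::euclidean_space) atlas"
begin

abbreviation "SA \<equiv> slit_atlas \<A>"
abbreviation "sc \<equiv> slit_chart \<A>"

lemma slit_component_nonzero:
  assumes "u \<in> slit_bundle \<A>" "c \<in> \<A>" "fst u \<in> cdom c"
  shows "snd u c \<noteq> 0"
proof
  assume "snd u c = 0"
  then have "snd u = 0"
    using base.tangent_space_eqI[OF slit_bundleD(2)[OF assms(1)] base.tangent_space_zero assms(2,3)]
        by simp
  then show False using slit_bundleD(3)[OF assms(1)] by simp
qed

lemma slit_bundleI:
  assumes "c \<in> \<A>" "p \<in> cdom c" "v \<in> tangent_space \<A> p" "v c \<noteq> 0"
  shows "(p, v) \<in> slit_bundle \<A>"
  using assms base.pointsI by (auto simp: slit_bundle_def)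

text \<open>A nonzero tangent vector has nonzero components in every chart, so removing the zero
  section just removes 0 from the fibre coordinates. This exhibits overlaps as products of open
  sets.\<close>

lemma slit_chart_image:
  assumes "c \<in> \<A>" "d \<in> \<A>"
  shows "cmap (sc c) ` (cdom (sc c) \<inter> cdom (sc d)) = cmap c ` (cdom c \<inter> cdom d) \<times> (- {0 :: 'e})"
proof (intro equalityI subsetI)
  fix z assume "z \<in> cmap (sc c) ` (cdom (sc c) \<inter> cdom (sc d))"
  then show "z \<in> cmap c ` (cdom c \<inter> cdom d) \<times> (- {0 :: 'e})"
    using slit_component_nonzero[OF _ assms(1)] by (auto simp: cdom_slit_chart cmap_slit_chart)
next
  fix z assume "z \<in> cmap c ` (cdom c \<inter> cdom d) \<times> (- {0 :: 'e})"
  then obtain p w where p: "p \<in> cdom c" "p \<in> cdom d" "w \<noteq> 0" "z = (cmap c p, w)" by auto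
  let ?u = "(p, coord_vec \<A> c w p)"
  have "?u \<in> slit_bundle \<A>"
    using p assms by (intro slit_bundleI[of c]) (simp_all add: base.coord_vec_tangent base.coord_vec_component)
  then have "?u \<in> cdom (sc c) \<inter> cdom (sc d)" "z = cmap (sc c) ?u"
    using p assms by (simp_all add: cdom_slit_chart cmap_slit_chart base.coord_vec_component)
  then show "z \<in> cmap (sc c) ` (cdom (sc c) \<inter> cdom (sc d))" by blast
qed

lemma crange_slit_chart: "c \<in> \<A> \<Longrightarrow> crange (sc c) = crange c \<times> (- {0 :: 'e})"
  using slit_chart_image[of c c] by simp

lemma inj_slit_chart:
  assumes "c \<in> \<A>"
  shows "inj_on (cmap (sc c)) (cdom (sc c))"
proof (rule inj_onI)
  fix u w assume u: "u \<in> cdom (sc c)" and w: "w \<in> cdom (sc c)" and eq: "cmap (sc c) u = cmap (sc c) w"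
  then have "fst u = fst w" using base.inj_chart[OF assms]
    by (auto simp: cdom_slit_chart cmap_slit_chart inj_on_def)
  moreover from this have "snd u = snd w"
    using u w eq assms base.tangent_space_eqI[of "snd u" "fst u" "snd w" c] slit_bundleD(2)[of u] slit_bundleD(2)[of w]
    by (simp add: cdom_slit_chart cmap_slit_chart)
  ultimately show "u = w" by (simp add: prod_eq_iff)
qed

lemma cinv_slit_in:
  assumes "c \<in> \<A>" "z \<in> crange (sc c)"
  shows "cinv (sc c) z \<in> slit_bundle \<A>" "fst (cinv (sc c) z) \<in> cdom c"
  using cinv_in_cdom[OF assms(2)] by (simp_all add: cdom_slit_chart)

lemma cinv_slit:
  assumes "c \<in> \<A>" "z \<in> crange (sc c)"
  shows "fst (cinv (sc c) z) = cinv c (fst z)" "snd (cinv (sc c) z) c = snd z"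
proof -
  have "cmap c (fst (cinv (sc c) z)) = fst z" and snd: "snd (cinv (sc c) z) c = snd z"
    using cmap_cinv[OF assms(2)] by (simp_all add: cmap_slit_chart prod_eq_iff)
  then show "fst (cinv (sc c) z) = cinv c (fst z)" "snd (cinv (sc c) z) c = snd z"
    using base.cinv_cmap[OF assms(1) cinv_slit_in(2)[OF assms]] by simp_all
qed

text \<open>Transitions of slit charts are the tangent maps of the base transitions, so their
  smoothness reduces to \<open>smooth_on_tangent_map\<close>.\<close>

lemma slit_transition:
  assumes "c \<in> \<A>" "d \<in> \<A>" "z \<in> cmap c ` (cdom c \<inter> cdom d) \<times> (- {0 :: 'e})"
  shows "(cmap (sc d) \<circ> cinv (sc c)) z =
    ((cmap d \<circ> cinv c) (fst z), frechet_derivative (cmap d \<circ> cinv c) (at (fst z)) (snd z))"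
proof -
  have z: "z \<in> crange (sc c)" using assms crange_slit_chart[OF assms(1)] by auto
  have "fst z \<in> cmap c ` (cdom c \<inter> cdom d)" using assms(3) by (simp add: mem_Times_iff)
  then obtain p where p: "p \<in> cdom c" "p \<in> cdom d" "fst z = cmap c p" by blast
  let ?u = "cinv (sc c) z"
  have u: "fst ?u = p" "snd ?u c = snd z" "?u \<in> slit_bundle \<A>"
    using cinv_slit[OF assms(1) z] cinv_slit_in[OF assms(1) z] p base.cinv_cmap[OF assms(1)] by auto
  have "snd ?u d = transition_deriv c d p (snd ?u c)"
    using base.tangent_space_transition[OF slit_bundleD(2)[OF u(3)] assms(1,2)] p u(1) by simp
  then show ?thesis
    using u p base.cinv_cmap[OF assms(1)] by (simp add: cmap_slit_chart transition_deriv_def)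
qed

end

sublocale slit_charts \<subseteq> slit: smooth_charts "slit_atlas \<A>"
proof
  fix c' d' assume c': "c' \<in> slit_atlas \<A>" and d': "d' \<in> slit_atlas \<A>"
  then obtain c d where c: "c \<in> \<A>" "c' = sc c" and d: "d \<in> \<A>" "d' = sc d" by (auto simp: slit_atlas_def)
  note o = base.open_overlap[OF c(1) d(1)]
  have o': "open (cmap c ` (cdom c \<inter> cdom d) \<times> (- {0 :: 'e}))"
    by (intro open_Times o open_Compl closed_singleton)
  show "open (cmap c' ` (cdom c' \<inter> cdom d'))"
    using o' slit_chart_image[OF c(1) d(1)] c d by simp
  show "smooth_on (cmap c' ` (cdom c' \<inter> cdom d')) (cmap d' \<circ> cinv c')"
    unfolding c(2) d(2) slit_chart_image[OF c(1) d(1)]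
  proof (rule smooth_on_cong[OF o'])
    show "smooth_on (cmap c ` (cdom c \<inter> cdom d) \<times> (- {0 :: 'e})) (\<lambda>z. ((cmap d \<circ> cinv c) (fst z),
        frechet_derivative (cmap d \<circ> cinv c) (at (fst z)) (snd z)))"
      by (rule smooth_on_tangent_map[OF o base.smooth_transition[OF c(1) d(1)] o']) auto
  qed (rule slit_transition[OF c(1) d(1), symmetric])
next
  fix c' assume "c' \<in> slit_atlas \<A>"
  then show "inj_on (cmap c') (cdom c')" using inj_slit_chart by (auto simp: slit_atlas_def)
qed

context slit_charts
begin

section \<open>Projection and vertical lift in coordinates\<close>

lemma slit_chart_exists:
  assumes "u \<in> slit_bundle \<A>"
  obtains c where "c \<in> \<A>" "fst u \<in> cdom c"
  using slit_bundleD(1)[OF assms] by (auto simp: points_def)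

text \<open>The block-triangular form explains both bundle maps: base components transform among
  themselves, which gives \<open>rho\<close>, and vectors with base component 0 transform like
  vectors of the base, which gives \<open>gamma\<close>.\<close>

lemma transition_deriv_slit:
  assumes "u \<in> slit_bundle \<A>" "c \<in> \<A>" "d \<in> \<A>" "fst u \<in> cdom c" "fst u \<in> cdom d"
  shows "transition_deriv (sc c) (sc d) u h = (transition_deriv c d (fst u) (fst h),
     frechet_derivative (\<lambda>x. frechet_derivative (cmap d \<circ> cinv c) (at x) (snd u c)) (at (cmap c (fst u))) (fst h)
     + transition_deriv c d (fst u) (snd h))"
proof -
  let ?O = "cmap c ` (cdom c \<inter> cdom d) \<times> (- {0 :: 'e})" and ?z = "cmap (sc c) u"
  note o = base.open_overlap[OF assms(2,3)]
  have z: "fst ?z = cmap c (fst u)" "snd ?z = snd u c" by (simp_all add: cmap_slit_chart)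
  have in_o: "fst ?z \<in> cmap c ` (cdom c \<inter> cdom d)" using assms by (simp add: z)
  have o': "open ?O" by (intro open_Times o open_Compl closed_singleton)
  have zO: "?z \<in> ?O"
    using in_o slit_component_nonzero[OF assms(1,2,4)] by (simp add: mem_Times_iff z)
  have "(cmap (sc d) \<circ> cinv (sc c) has_derivative
     (\<lambda>h. (transition_deriv c d (fst u) (fst h),
     frechet_derivative (\<lambda>x. frechet_derivative (cmap d \<circ> cinv c) (at x) (snd u c)) (at (cmap c (fst u))) (fst h)
     + transition_deriv c d (fst u) (snd h)))) (at ?z)"
    using has_derivative_transform_within_open[OF has_derivative_tangent_map[OF o base.smooth_transition[OF assms(2,3)] in_o]
        o' zO slit_transition[OF assms(2,3), symmetric]]
    unfolding z transition_deriv_def .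
  from fun_cong[OF frechet_derivative_at[OF this]] show ?thesis
    unfolding transition_deriv_def[of "sc c"] by simp
qed

lemma slit_cinv_cmap: "u \<in> slit_bundle \<A> \<Longrightarrow> c \<in> \<A> \<Longrightarrow> fst u \<in> cdom c \<Longrightarrow> cinv (sc c) (cmap (sc c) u) = u"
  by (rule slit.cinv_cmap) (simp_all add: cdom_slit_chart)

lemma slit_cmap_in: "u \<in> slit_bundle \<A> \<Longrightarrow> fst u \<in> cdom c \<Longrightarrow> cmap (sc c) u \<in> crange (sc c)"
  by (rule imageI) (simp add: cdom_slit_chart)

text \<open>\<open>differential\<close> works in a chosen chart; block-triangularity of the
  transition derivative moves the result to any chart \<open>d\<close>.\<close>

lemma rho_at_component:
  assumes "u \<in> slit_bundle \<A>" "a \<in> tangent_space SA u" "d \<in> \<A>" "fst u \<in> cdom d"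
  shows "rho_at \<A> u a d = fst (a (sc d))"
proof -
  have "chart_at SA u \<in> SA" "u \<in> cdom (chart_at SA u)"
    using slit.chart_at[of u] assms(1) by (simp_all add: points_slit_atlas)
  then obtain c where c: "c \<in> \<A>" "chart_at SA u = sc c" "fst u \<in> cdom c"
    by (auto simp: slit_atlas_def cdom_slit_chart)
  let ?O = "cmap c ` (cdom c \<inter> cdom d) \<times> (- {0 :: 'e})" and ?z = "cmap (sc c) u"
  note o = base.open_overlap[OF c(1) assms(3)]
  have o': "open ?O" by (intro open_Times o open_Compl closed_singleton)
  have z: "fst ?z = cmap c (fst u)" "snd ?z = snd u c" by (simp_all add: cmap_slit_chart)
  have zO: "?z \<in> ?O"
    using slit_component_nonzero[OF assms(1) c(1,3)] c(3) assms(4) by (simp add: mem_Times_iff z)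
  have t: "(cmap d \<circ> cinv c has_derivative transition_deriv c d (fst u)) (at (fst ?z))"
    unfolding z by (rule base.has_derivative_transition[OF c(1) assms(3) c(3) assms(4)])
  have "((\<lambda>z. (cmap d \<circ> cinv c) (fst z)) has_derivative (\<lambda>h. transition_deriv c d (fst u) (fst h))) (at ?z)"
    by (rule has_derivative_compose[OF has_derivative_fst[OF has_derivative_ident] t])
  then have "(cmap d \<circ> fst \<circ> cinv (sc c) has_derivative (\<lambda>h. transition_deriv c d (fst u) (fst h))) (at ?z)"
  proof (rule has_derivative_transform_within_open[OF _ o' zO])
    fix y assume "y \<in> ?O"
    then have "y \<in> crange (sc c)" using crange_slit_chart[OF c(1)] by auto
    then show "(cmap d \<circ> cinv c) (fst y) = (cmap d \<circ> fst \<circ> cinv (sc c)) y"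
      using cinv_slit(1)[OF c(1)] by simp
  qed
  from fun_cong[OF frechet_derivative_at[OF this], of "a (sc c)", symmetric]
  have "rho_at \<A> u a d = transition_deriv c d (fst u) (fst (a (sc c)))"
    using assms by (simp add: rho_at_def differential_def c(2) Let_def flip: o_assoc)
  also have "\<dots> = fst (transition_deriv (sc c) (sc d) u (a (sc c)))"
    by (simp add: transition_deriv_slit[OF assms(1) c(1) assms(3) c(3) assms(4)])
  also have "transition_deriv (sc c) (sc d) u (a (sc c)) = a (sc d)"
    by (rule slit.tangent_space_transition[OF assms(2), symmetric])
       (use assms c in \<open>simp_all add: cdom_slit_chart\<close>)
  finally show ?thesis .
qed

lemma rho_at_tangent:
  assumes "u \<in> slit_bundle \<A>" "a \<in> tangent_space SA u"
  shows "rho_at \<A> u a \<in> tangent_space \<A> (fst u)"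
proof (rule base.tangent_spaceI)
  fix c d assume c: "c \<in> \<A>" "d \<in> \<A>" "fst u \<in> cdom c" "fst u \<in> cdom d"
  have "a (sc d) = transition_deriv (sc c) (sc d) u (a (sc c))"
    by (rule slit.tangent_space_transition[OF assms(2)])
       (use assms c in \<open>simp_all add: cdom_slit_chart\<close>)
  then show "rho_at \<A> u a d = transition_deriv c d (fst u) (rho_at \<A> u a c)"
    using transition_deriv_slit[OF assms(1) c] c assms by (simp add: rho_at_component)
qed (auto simp: rho_at_def differential_def Let_def)

lemma gamma_at_component:
  assumes "u \<in> slit_bundle \<A>" "c \<in> \<A>" "fst u \<in> cdom c"
  shows "gamma_at \<A> u v (sc c) = (0, v c)"
proof -
  have "((\<lambda>t. (cmap c (fst u), snd u c + t *\<^sub>R v c)) has_vector_derivative (0, v c)) (at 0)"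
    unfolding has_vector_derivative_def by (auto intro!: derivative_eq_intros)
  moreover have "cmap (sc c) \<circ> (\<lambda>t. (fst u, snd u + t *\<^sub>t v)) = (\<lambda>t. (cmap c (fst u), snd u c + t *\<^sub>R v c))"
    by (simp add: fun_eq_iff cmap_slit_chart tscale_def)
  moreover have "snd u + 0 *\<^sub>t v = snd u" by (simp add: tscale_def fun_eq_iff)
  ultimately show ?thesis
    using assms by (simp add: gamma_at_def velocity_def cdom_slit_chart vector_derivative_at)
qed

lemma gamma_at_tangent:
  assumes "u \<in> slit_bundle \<A>" "v \<in> tangent_space \<A> (fst u)"
  shows "gamma_at \<A> u v \<in> tangent_space SA u"
proof (rule slit.tangent_spaceI)
  fix c' d' assume "c' \<in> SA" "d' \<in> SA" "u \<in> cdom c'" "u \<in> cdom d'"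
  then obtain c d where c: "c' = sc c" "c \<in> \<A>" "fst u \<in> cdom c" and d: "d' = sc d" "d \<in> \<A>" "fst u \<in> cdom d"
    by (auto simp: slit_atlas_def cdom_slit_chart)
  \<comment> \<open>Linearity disposes of the second-derivative term of the transition, since the
    base component of a vertical lift is 0.\<close>
  have "linear (frechet_derivative (\<lambda>x. frechet_derivative (cmap d \<circ> cinv c) (at x) (snd u c)) (at (cmap c (fst u))))"
    by (rule smooth_on_frechet_linear[OF smooth_on_frechet[OF base.smooth_transition[OF c(2) d(2)]]])
       (use c d in auto)
  then show "gamma_at \<A> u v d' = transition_deriv c' d' u (gamma_at \<A> u v c')"
    using transition_deriv_slit[OF assms(1) c(2) d(2) c(3) d(3)] 
      base.tangent_space_transition[OF assms(2) c(2) d(2) c(3) d(3)]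
      linear_0[OF base.linear_transition_deriv[OF c(2) d(2) c(3) d(3)]]
      gamma_at_component[OF assms(1) c(2,3)] gamma_at_component[OF assms(1) d(2,3)]
    by (simp add: c(1) d(1) linear_0)
next
  fix c' assume "\<not> (c' \<in> SA \<and> u \<in> cdom c')"
  moreover have "snd u + 0 *\<^sub>t v = snd u" by (simp add: tscale_def fun_eq_iff)
  ultimately show "gamma_at \<A> u v c' = 0"
    by (auto simp: gamma_at_def velocity_def)
qed

subsection \<open>Sections\<close>

abbreviation "pcomp X c \<equiv> \<lambda>z. X (cinv (slit_chart \<A> c) z) c"

lemma pi_field_tangent: "X \<in> pi_fields \<A> \<Longrightarrow> u \<in> slit_bundle \<A> \<Longrightarrow> X u \<in> tangent_space \<A> (fst u)"
  by (simp add: pi_fields_def)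

lemma pi_field_outside: "X \<in> pi_fields \<A> \<Longrightarrow> u \<notin> slit_bundle \<A> \<Longrightarrow> X u = 0"
  unfolding pi_fields_def by blast

lemma pi_field_component_outside:
  assumes "X \<in> pi_fields \<A>" "\<not> (u \<in> slit_bundle \<A> \<and> c \<in> \<A> \<and> fst u \<in> cdom c)"
  shows "X u c = 0"
proof (cases "u \<in> slit_bundle \<A>")
  case True
  then show ?thesis
    using base.tangent_space_outside[OF pi_field_tangent[OF assms(1) True]] assms(2) by blast
qed (simp add: pi_field_outside[OF assms(1)])

lemma pi_field_smooth: "X \<in> pi_fields \<A> \<Longrightarrow> c \<in> \<A> \<Longrightarrow> smooth_on (crange (sc c)) (pcomp X c)"
  by (simp add: pi_fields_def)

lemma open_slit: "c \<in> \<A> \<Longrightarrow> open (crange (sc c))"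
  by (rule slit.open_crange) simp

lemma pi_field_eqI:
  assumes "X \<in> pi_fields \<A>" "Y \<in> pi_fields \<A>"
    and "\<And>u c. u \<in> slit_bundle \<A> \<Longrightarrow> c \<in> \<A> \<Longrightarrow> fst u \<in> cdom c \<Longrightarrow> X u c = Y u c"
  shows "X = Y"
proof
  fix u
  show "X u = Y u"
  proof (cases "u \<in> slit_bundle \<A>")
    case True
    then obtain c where "c \<in> \<A>" "fst u \<in> cdom c" by (rule slit_chart_exists)
    then show ?thesis
      using base.tangent_space_eqI[OF pi_field_tangent[OF assms(1) True] pi_field_tangent[OF assms(2) True]]
        assms(3)[OF True] by blast
  qed (simp add: pi_field_outside assms)
qed

lemma pi_fields_zero: "0 \<in> pi_fields \<A>"
  by (auto simp: pi_fields_def base.tangent_space_zero smooth_on_const)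

lemma pi_fields_add: "X \<in> pi_fields \<A> \<Longrightarrow> Y \<in> pi_fields \<A> \<Longrightarrow> X + Y \<in> pi_fields \<A>"
  by (auto simp: pi_fields_def base.tangent_space_add smooth_on_add open_slit)

lemma pi_fields_minus: "X \<in> pi_fields \<A> \<Longrightarrow> - X \<in> pi_fields \<A>"
  by (auto simp: pi_fields_def base.tangent_space_minus smooth_on_uminus open_slit)

lemma pcomp_eta: "c \<in> \<A> \<Longrightarrow> z \<in> crange (sc c) \<Longrightarrow> pcomp (eta \<A>) c z = snd z"
  using cinv_slit[of c z] cinv_slit_in[of c z] by (simp add: eta_def)

lemma eta_closed: "eta \<A> \<in> pi_fields \<A>"
  unfolding pi_fields_def
proof (intro CollectI conjI ballI allI impI)
  fix c assume c: "c \<in> \<A>"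
  show "smooth_on (crange (sc c)) (pcomp (eta \<A>) c)"
    by (rule smooth_on_cong[OF open_slit[OF c] smooth_on_linear[OF open_slit[OF c] bounded_linear_snd smooth_on_ident]])
       (simp add: pcomp_eta c)
qed (auto simp: eta_def slit_bundleD)

lemma slit_field_tangent: "V \<in> vector_fields SA \<Longrightarrow> u \<in> slit_bundle \<A> \<Longrightarrow> V u \<in> tangent_space SA u"
  using slit.vector_field_tangent by (simp add: points_slit_atlas)

lemma slit_field_outside: "V \<in> vector_fields SA \<Longrightarrow> u \<notin> slit_bundle \<A> \<Longrightarrow> V u = 0"
  by (metis points_slit_atlas slit.vector_field_outside)

lemma slit_field_smooth: "V \<in> vector_fields SA \<Longrightarrow> c \<in> \<A> \<Longrightarrow> smooth_on (crange (sc c)) (component V (sc c))"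
  by (rule slit.vector_field_smooth) simp_all

lemma slit_fieldsI:
  assumes "\<And>u. u \<in> slit_bundle \<A> \<Longrightarrow> V u \<in> tangent_space SA u"
    and "\<And>u. u \<notin> slit_bundle \<A> \<Longrightarrow> V u = 0"
    and "\<And>c. c \<in> \<A> \<Longrightarrow> smooth_on (crange (sc c)) (component V (sc c))"
  shows "V \<in> vector_fields SA"
  unfolding vector_fields_def points_slit_atlas
proof (intro CollectI conjI ballI allI impI)
  fix c' assume "c' \<in> SA"
  then show "smooth_on (crange c') (component V c')" using assms(3) by (auto simp only: slit_atlas_def)
qed (use assms in blast)+

lemma slit_field_eqI:
  assumes "V \<in> vector_fields SA" "W \<in> vector_fields SA"
    and "\<And>u c. u \<in> slit_bundle \<A> \<Longrightarrow> c \<in> \<A> \<Longrightarrow> fst u \<in> cdom c \<Longrightarrow> V u (sc c) = W u (sc c)"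
  shows "V = W"
proof
  fix u
  show "V u = W u"
  proof (cases "u \<in> slit_bundle \<A>")
    case True
    then obtain c where "c \<in> \<A>" "fst u \<in> cdom c" by (rule slit_chart_exists)
    then show ?thesis
      using slit.tangent_space_eqI[OF slit_field_tangent[OF assms(1) True] slit_field_tangent[OF assms(2) True],
          of "sc c"] assms(3)[OF True] True by (simp add: cdom_slit_chart)
  qed (simp add: slit_field_outside assms)
qed

lemma rho_component:
  "V \<in> vector_fields SA \<Longrightarrow> u \<in> slit_bundle \<A> \<Longrightarrow> c \<in> \<A> \<Longrightarrow> fst u \<in> cdom c \<Longrightarrow> rho \<A> V u c = fst (V u (sc c))"
  using rho_at_component[OF _ slit_field_tangent] by (simp add: rho_def)

lemma rho_closed:
  assumes "V \<in> vector_fields SA"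
  shows "rho \<A> V \<in> pi_fields \<A>"
  unfolding pi_fields_def
proof (intro CollectI conjI ballI allI impI)
  fix c assume c: "c \<in> \<A>"
  show "smooth_on (crange (sc c)) (pcomp (rho \<A> V) c)"
    by (rule smooth_on_cong[OF open_slit[OF c] smooth_on_linear[OF open_slit[OF c] bounded_linear_fst slit_field_smooth[OF assms c]]])
       (simp add: rho_component assms c cinv_slit_in)
qed (auto simp: rho_def rho_at_tangent slit_field_tangent assms)

lemma rho_add:
  assumes "V \<in> vector_fields SA" "W \<in> vector_fields SA"
  shows "rho \<A> (V + W) = rho \<A> V + rho \<A> W"
  by (rule pi_field_eqI)
     (simp_all add: rho_closed pi_fields_add slit.vector_fields_add assms rho_component)

lemma gamma_component:
  "u \<in> slit_bundle \<A> \<Longrightarrow> c \<in> \<A> \<Longrightarrow> fst u \<in> cdom c \<Longrightarrow> gamma \<A> X u (sc c) = (0, X u c)"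
  by (simp add: gamma_def gamma_at_component)

lemma gamma_closed:
  assumes "X \<in> pi_fields \<A>"
  shows "gamma \<A> X \<in> vector_fields SA"
proof (rule slit_fieldsI)
  fix c assume c: "c \<in> \<A>"
  show "smooth_on (crange (sc c)) (component (gamma \<A> X) (sc c))"
    by (rule smooth_on_cong[OF open_slit[OF c] smooth_on_Pair[OF open_slit[OF c] smooth_on_const pi_field_smooth[OF assms c]]])
       (simp add: gamma_component c cinv_slit_in)
qed (simp_all add: gamma_def gamma_at_tangent pi_field_tangent assms)

lemma gamma_add:
  assumes "X \<in> pi_fields \<A>" "Y \<in> pi_fields \<A>"
  shows "gamma \<A> (X + Y) = gamma \<A> X + gamma \<A> Y"
  by (rule slit_field_eqI)
     (simp_all add: gamma_closed pi_fields_add slit.vector_fields_add assms gamma_component)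

lemma rho_gamma: "X \<in> pi_fields \<A> \<Longrightarrow> rho \<A> (gamma \<A> X) = 0"
  by (rule pi_field_eqI)
     (simp_all add: rho_closed gamma_closed pi_fields_zero rho_component gamma_component)

text \<open>For a vertical field the inhomogeneous term in the transition rule drops out, so its
  fibre components form a tangent vector of the base.\<close>

lemma vertical_eq_gamma:
  assumes V: "V \<in> vector_fields SA" and "rho \<A> V = 0"
  shows "\<exists>X\<in>pi_fields \<A>. V = gamma \<A> X"
proof -
  define X where "X u = (\<lambda>c. if u \<in> slit_bundle \<A> \<and> c \<in> \<A> \<and> fst u \<in> cdom c then snd (V u (sc c)) else 0)"
      for u
  have fst0: "fst (V u (sc c)) = 0" if "u \<in> slit_bundle \<A>" "c \<in> \<A>" "fst u \<in> cdom c" for u c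
    using rho_component[OF V that] assms(2) by simp
  have X: "X \<in> pi_fields \<A>"
    unfolding pi_fields_def
  proof (intro CollectI conjI ballI allI impI)
    fix u assume u: "u \<in> slit_bundle \<A>"
    show "X u \<in> tangent_space \<A> (fst u)"
    proof (rule base.tangent_spaceI)
      fix c d assume c: "c \<in> \<A>" "d \<in> \<A>" "fst u \<in> cdom c" "fst u \<in> cdom d"
      have "V u (sc d) = transition_deriv (sc c) (sc d) u (V u (sc c))"
        by (rule slit.tangent_space_transition[OF slit_field_tangent[OF V u]])
           (use u c in \<open>simp_all add: cdom_slit_chart\<close>)
      moreover have "linear (frechet_derivative (\<lambda>x. frechet_derivative (cmap d \<circ> cinv c) (at x) (snd u c)) (at (cmap c (fst u))))"
        by (rule smooth_on_frechet_linear[OF smooth_on_frechet[OF base.smooth_transition[OF c(1,2)]]])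
           (use c in auto)
      ultimately show "X u d = transition_deriv c d (fst u) (X u c)"
        using u c transition_deriv_slit[OF u c] fst0[OF u c(1,3)] by (simp add: X_def linear_0)
    qed (auto simp: X_def)
  next
    fix c assume c: "c \<in> \<A>"
    show "smooth_on (crange (sc c)) (pcomp X c)"
      by (rule smooth_on_cong[OF open_slit[OF c] smooth_on_linear[OF open_slit[OF c] bounded_linear_snd slit_field_smooth[OF V c]]])
         (simp add: X_def c cinv_slit_in)
  qed (auto simp: X_def)
  moreover have "V = gamma \<A> X"
    by (rule slit_field_eqI[OF V gamma_closed[OF X]])
       (use fst0 in \<open>simp add: gamma_component X_def prod_eq_iff\<close>)
  ultimately show ?thesis by blast
qed

text \<open>The flat derivative along the fibres, taken chart by chart. That the result is a section
  is inferred later from its being the projection of a bracket.\<close>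

definition vderiv :: "('m, 'e) pi_field \<Rightarrow> ('m, 'e) pi_field \<Rightarrow> ('m, 'e) pi_field" where
  "vderiv X Y u = (\<lambda>c. if u \<in> slit_bundle \<A> \<and> c \<in> \<A> \<and> fst u \<in> cdom c
     then frechet_derivative (pcomp Y c) (at (cmap (sc c) u)) (0, X u c) else 0)"

lemma vderiv_component: "u \<in> slit_bundle \<A> \<Longrightarrow> c \<in> \<A> \<Longrightarrow> fst u \<in> cdom c \<Longrightarrow>
    vderiv X Y u c = frechet_derivative (pcomp Y c) (at (cmap (sc c) u)) (0, X u c)"
  by (simp add: vderiv_def)

text \<open>The base components of \<open>gamma \<A> X\<close> vanish identically, so only one half
  of the bracket reaches the base.\<close>

lemma rho_lie_bracket_gamma:
  assumes "X \<in> pi_fields \<A>" "V \<in> vector_fields SA"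
  shows "rho \<A> (lie_bracket SA (gamma \<A> X) V) = vderiv X (rho \<A> V)"
proof (rule ext, rule ext)
  fix u c
  have br: "lie_bracket SA (gamma \<A> X) V \<in> vector_fields SA"
    by (intro slit.lie_bracket_closed gamma_closed assms)
  show "rho \<A> (lie_bracket SA (gamma \<A> X) V) u c = vderiv X (rho \<A> V) u c"
  proof (cases "u \<in> slit_bundle \<A> \<and> c \<in> \<A> \<and> fst u \<in> cdom c")
    case True
    then have u: "u \<in> slit_bundle \<A>" and c: "c \<in> \<A>" "fst u \<in> cdom c" by auto
    let ?z = "cmap (sc c) u"
    note z = slit_cmap_in[OF u c(2)]
    have d: "frechet_derivative (\<lambda>z. fst (component W (sc c) z)) (at ?z) = (\<lambda>h. fst (frechet_derivative (component W (sc c)) (at ?z) h))"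
      if "W \<in> vector_fields SA" for W
      by (rule frechet_derivative_at[OF has_derivative_fst[OF smooth_on_has_derivative[OF slit_field_smooth[OF that c(1)] z]], symmetric])
    have fstW: "frechet_derivative (pcomp (rho \<A> W) c) (at ?z) = (\<lambda>h. fst (frechet_derivative (component W (sc c)) (at ?z) h))"
      if W: "W \<in> vector_fields SA" for W
      unfolding d[OF W, symmetric]
      by (rule frechet_derivative_transform_within_open[OF smooth_on_differentiable[OF pi_field_smooth[OF rho_closed[OF W] c(1)] z] open_slit[OF c(1)] z])
         (simp add: rho_component[OF W] cinv_slit_in c)
    have "fst (frechet_derivative (component (gamma \<A> X) (sc c)) (at ?z) h) = 0" for h
      using fun_cong[OF fstW[OF gamma_closed[OF assms(1)]], of h] by (simp add: rho_gamma assms)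
    then show ?thesis
      using True assms u c
      by (simp add: rho_component[OF br] vderiv_component slit.lie_bracket_chart cdom_slit_chart fstW gamma_component)
  next
    case False
    then show ?thesis
      using pi_field_component_outside[OF rho_closed[OF br] False] by (auto simp: vderiv_def)
  qed
qed

text \<open>In coordinates \<open>eta\<close> is the projection to the fibre coordinate.\<close>

lemma vderiv_eta: 
  assumes "X \<in> pi_fields \<A>"
  shows "vderiv X (eta \<A>) = X"
proof (rule ext, rule ext)
  fix u c
  show "vderiv X (eta \<A>) u c = X u c"
  proof (cases "u \<in> slit_bundle \<A> \<and> c \<in> \<A> \<and> fst u \<in> cdom c")
    case True
    then have u: "u \<in> slit_bundle \<A>" and c: "c \<in> \<A>" "fst u \<in> cdom c" by auto
    have "(snd has_derivative snd) (at (cmap (sc c) u))"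
        by (rule has_derivative_snd[OF has_derivative_ident])
    then have "(pcomp (eta \<A>) c has_derivative snd) (at (cmap (sc c) u))"
      by (rule has_derivative_transform_within_open[OF _ open_slit[OF c(1)] slit_cmap_in[OF u c(2)]])
         (simp add: pcomp_eta c)
    from frechet_derivative_at[OF this] show ?thesis using True by (simp add: vderiv_component)
  next
    case False
    then show ?thesis
      using pi_field_component_outside[OF assms False] by (auto simp: vderiv_def)
  qed
qed

end

subsection \<open>Regular connections\<close>

context slit_charts
begin

lemma tscale_apply: "(r *\<^sub>t v) c = r *\<^sub>R v c"
  by (simp add: tscale_def)

lemma connection_tangent:
  assumes "linear_connection \<A> D" "Y \<in> pi_fields \<A>" "u \<in> slit_bundle \<A>" "a \<in> tangent_space SA u"
  shows "D Y u a \<in> tangent_space \<A> (fst u)"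
  using assms unfolding linear_connection_def by blast

lemma connection_add_vec:
  assumes "linear_connection \<A> D" "Y \<in> pi_fields \<A>" "u \<in> slit_bundle \<A>"
    and "a \<in> tangent_space SA u" "b \<in> tangent_space SA u"
  shows "D Y u (a + b) = D Y u a + D Y u b"
  using assms unfolding linear_connection_def by blast

lemma connection_scale_vec:
  assumes "linear_connection \<A> D" "Y \<in> pi_fields \<A>" "u \<in> slit_bundle \<A>" "a \<in> tangent_space SA u"
  shows "D Y u (r *\<^sub>t a) = r *\<^sub>t D Y u a"
  using assms unfolding linear_connection_def by blast

lemma connection_add:
  assumes "linear_connection \<A> D" "Y \<in> pi_fields \<A>" "Z \<in> pi_fields \<A>" "u \<in> slit_bundle \<A>"
    and "a \<in> tangent_space SA u"
  shows "D (Y + Z) u a = D Y u a + D Z u a"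
  using assms unfolding linear_connection_def by blast

text \<open>The connection in the coordinate frame of one chart, with the direction as a coordinate
  vector: a smooth family of linear maps, to which the lemmas on such families apply.\<close>

definition frame_cov ::
  "('m, 'e) connection \<Rightarrow> ('m, 'e) pi_field \<Rightarrow> ('m, 'e) chart \<Rightarrow> 'e \<times> 'e \<Rightarrow> 'e \<times> 'e \<Rightarrow> 'e" where
  "frame_cov D Y c z w = D Y (cinv (sc c) z) (coord_vec SA (sc c) w (cinv (sc c) z)) c"

lemma slit_coord_vec_tangent:
  "c \<in> \<A> \<Longrightarrow> u \<in> slit_bundle \<A> \<Longrightarrow> fst u \<in> cdom c \<Longrightarrow> coord_vec SA (sc c) w u \<in> tangent_space SA u"
  by (rule slit.coord_vec_tangent) (simp_all add: cdom_slit_chart)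

lemma slit_coord_vec_component:
  "c \<in> \<A> \<Longrightarrow> u \<in> slit_bundle \<A> \<Longrightarrow> fst u \<in> cdom c \<Longrightarrow> coord_vec SA (sc c) w u (sc c) = w"
  by (rule slit.coord_vec_component) (simp_all add: cdom_slit_chart)

lemma smooth_frame_cov:
  "linear_connection \<A> D \<Longrightarrow> Y \<in> pi_fields \<A> \<Longrightarrow> c \<in> \<A> \<Longrightarrow>
    smooth_on (crange (sc c)) (\<lambda>z. frame_cov D Y c z w)"
  unfolding linear_connection_def Let_def frame_cov_def by blast

lemma linear_frame_cov:
  assumes "linear_connection \<A> D" "Y \<in> pi_fields \<A>" "c \<in> \<A>" "z \<in> crange (sc c)"
  shows "linear (frame_cov D Y c z)"
proof -
  note u = cinv_slit_in[OF assms(3,4)]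
  have "cinv (sc c) z \<in> cdom (sc c)" by (rule cinv_in_cdom[OF assms(4)])
  note cv = slit.linear_coord_vec[OF slit_chart_in[OF assms(3)] this]
  show ?thesis
    by (rule linearI)
       (simp_all add: frame_cov_def cv connection_add_vec[OF assms(1,2) u(1)]
         connection_scale_vec[OF assms(1,2) u(1)] slit_coord_vec_tangent u assms(3) tscale_apply)
qed

lemma frame_cov_component:
  assumes "u \<in> slit_bundle \<A>" "c \<in> \<A>" "fst u \<in> cdom c" "a \<in> tangent_space SA u"
  shows "frame_cov D Y c (cmap (sc c) u) (a (sc c)) = D Y u a c"
proof -
  have "coord_vec SA (sc c) (a (sc c)) u = a"
    by (rule slit.tangent_space_eq_coord_vec[OF assms(4) slit_chart_in[OF assms(2)], symmetric])
       (simp add: cdom_slit_chart assms)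
  then show ?thesis by (simp add: frame_cov_def slit_cinv_cmap assms(1-3))
qed

lemma cov_closed:
  assumes "linear_connection \<A> D" "V \<in> vector_fields SA" "Y \<in> pi_fields \<A>"
  shows "cov \<A> D V Y \<in> pi_fields \<A>"
  unfolding pi_fields_def
proof (intro CollectI conjI ballI allI impI)
  fix c assume c: "c \<in> \<A>"
  show "smooth_on (crange (sc c)) (pcomp (cov \<A> D V Y) c)"
  proof (rule smooth_on_cong[OF open_slit[OF c]])
    show "smooth_on (crange (sc c)) (\<lambda>z. frame_cov D Y c z (component V (sc c) z))"
      by (rule smooth_on_linear_family[where F = "frame_cov D Y c", OF open_slit[OF c]
            linear_frame_cov[OF assms(1,3) c] smooth_frame_cov[OF assms(1,3) c] slit_field_smooth[OF assms(2) c]])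
    show "frame_cov D Y c z (component V (sc c) z) = pcomp (cov \<A> D V Y) c z" if z: "z \<in> crange (sc c)"
        for z
      using frame_cov_component[OF cinv_slit_in(1)[OF c z] c cinv_slit_in(2)[OF c z]
          slit_field_tangent[OF assms(2) cinv_slit_in(1)[OF c z]], of D Y]
        cmap_cinv[OF z] cinv_slit_in(1)[OF c z] by (simp add: cov_def)
  qed
qed (simp_all add: cov_def connection_tangent[OF assms(1,3)] slit_field_tangent[OF assms(2)])

lemma cov_add:
  assumes "linear_connection \<A> D" "V \<in> vector_fields SA" "Y \<in> pi_fields \<A>" "Z \<in> pi_fields \<A>"
  shows "cov \<A> D V (Y + Z) = cov \<A> D V Y + cov \<A> D V Z"
  using connection_add[OF assms(1,3,4)] slit_field_tangent[OF assms(2)]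
      by (auto simp: cov_def fun_eq_iff)

lemma cov_add_vec:
  assumes "linear_connection \<A> D" "V \<in> vector_fields SA" "W \<in> vector_fields SA" "Y \<in> pi_fields \<A>"
  shows "cov \<A> D (V + W) Y = cov \<A> D V Y + cov \<A> D W Y"
  using connection_add_vec[OF assms(1,4)] slit_field_tangent[OF assms(2)] slit_field_tangent[OF assms(3)]
  by (auto simp: cov_def fun_eq_iff)

section \<open>Horizontal lifts of regular connections\<close>

lemma regular_linear: "regular_connection \<A> D \<Longrightarrow> linear_connection \<A> D"
  by (simp add: regular_connection_def)

lemma regular_vertical_horizontal:
  assumes "regular_connection \<A> D" "u \<in> slit_bundle \<A>" "a \<in> tangent_space SA u"
    and "rho_at \<A> u a = 0" "D (eta \<A>) u a = 0"
  shows "a = 0"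
proof -
  have "a \<in> vertical_space \<A> u \<inter> horizontal_space \<A> D u"
    using assms(3-5) by (simp add: vertical_space_def horizontal_space_def conn_map_at_def)
  moreover have "vertical_space \<A> u \<inter> horizontal_space \<A> D u = {0}"
    using assms(1,2) unfolding regular_connection_def by blast
  ultimately show ?thesis by blast
qed

lemma regular_cov_gamma_eta:
  assumes "regular_connection \<A> D" "X \<in> pi_fields \<A>" "cov \<A> D (gamma \<A> X) (eta \<A>) = 0"
  shows "X = 0"
proof (rule pi_field_eqI[OF assms(2) pi_fields_zero])
  fix u c assume u: "u \<in> slit_bundle \<A>" and c: "c \<in> \<A>" "fst u \<in> cdom c"
  have "gamma \<A> X u = 0"
  proof (rule regular_vertical_horizontal[OF assms(1) u])
    show "gamma \<A> X u \<in> tangent_space SA u" by (rule slit_field_tangent[OF gamma_closed[OF assms(2)] u])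
    show "rho_at \<A> u (gamma \<A> X u) = 0"
      using fun_cong[OF rho_gamma[OF assms(2)], of u] u by (simp add: rho_def)
    show "D (eta \<A>) u (gamma \<A> X u) = 0"
      using fun_cong[OF assms(3), of u] u by (simp add: cov_def)
  qed
  then show "X u c = 0 u c" using gamma_component[OF u c, of X] by (simp add: zero_prod_def)
qed

lemma beta_at:
  assumes "regular_connection \<A> D" "X \<in> pi_fields \<A>" "u \<in> slit_bundle \<A>"
  shows "beta \<A> D X u \<in> horizontal_space \<A> D u" "rho_at \<A> u (beta \<A> D X u) = X u"
proof -
  obtain c where c: "c \<in> \<A>" "fst u \<in> cdom c" by (rule slit_chart_exists[OF assms(3)])
  \<comment> \<open>Any lift of \<open>X u\<close> would do; the fibre component 0 is an arbitrary
    choice. Its horizontal part is the preimage sought.\<close>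
  let ?a = "coord_vec SA (sc c) (X u c, 0) u"
  have a: "?a \<in> tangent_space SA u" by (rule slit_coord_vec_tangent[OF c(1) assms(3) c(2)])
  then obtain v h where vh: "v \<in> vertical_space \<A> u" "h \<in> horizontal_space \<A> D u" "?a = v + h"
    using assms(1,3) unfolding regular_connection_def by meson
  have v: "v \<in> tangent_space SA u" "rho_at \<A> u v = 0" using vh(1) by (simp_all add: vertical_space_def)
  have h: "h \<in> tangent_space SA u" using vh(2) by (simp add: horizontal_space_def)
  have "rho_at \<A> u h = X u"
  proof (rule base.tangent_space_eqI[OF rho_at_tangent[OF assms(3) h] pi_field_tangent[OF assms(2,3)] c])
    have "fst (v (sc c)) = 0" using rho_at_component[OF assms(3) v(1) c] v(2) by simp
    moreover have "v (sc c) + h (sc c) = (X u c, 0)"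
      using slit_coord_vec_component[OF c(1) assms(3) c(2), of "(X u c, 0)"] vh(3) by simp
    ultimately have "fst (h (sc c)) = X u c" by (metis add_0 fst_add fst_conv)
    then show "rho_at \<A> u h c = X u c" using rho_at_component[OF assms(3) h c] by simp
  qed
  then have "X u \<in> rho_at \<A> u ` horizontal_space \<A> D u" by (rule image_eqI[OF sym vh(2)])
  then show "beta \<A> D X u \<in> horizontal_space \<A> D u" "rho_at \<A> u (beta \<A> D X u) = X u"
    using assms(3) by (simp_all add: beta_def inv_into_into f_inv_into_f)
qed

lemma beta_tangent:
  assumes "regular_connection \<A> D" "X \<in> pi_fields \<A>" "u \<in> slit_bundle \<A>"
  shows "beta \<A> D X u \<in> tangent_space SA u" "D (eta \<A>) u (beta \<A> D X u) = 0"
  using beta_at(1)[OF assms] by (simp_all add: horizontal_space_def conn_map_at_def)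

text \<open>In a chart the lift has the form \<open>(X, h)\<close>, and horizontality is the linear
  system \<open>K (0, h) = - K (X, 0)\<close> for its vertical part. Regularity says that
  \<open>K\<close> is injective on vertical vectors, so \<open>h\<close> depends smoothly on the
  point.\<close>

lemma beta_closed:
  assumes "regular_connection \<A> D" "X \<in> pi_fields \<A>"
  shows "beta \<A> D X \<in> vector_fields SA"
proof (rule slit_fieldsI)
  fix c assume c: "c \<in> \<A>"
  let ?S = "crange (sc c)" and ?K = "frame_cov D (eta \<A>) c"
  let ?h = "\<lambda>z. snd (component (beta \<A> D X) (sc c) z)"
  note lin = regular_linear[OF assms(1)]
  note K = linear_frame_cov[OF lin eta_closed c] smooth_frame_cov[OF lin eta_closed c]
  have pair: "component (beta \<A> D X) (sc c) z = (pcomp X c z, ?h z)" if z: "z \<in> ?S" for z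
  proof -
    note u = cinv_slit_in[OF c z]
    show ?thesis
      using rho_at_component[OF u(1) beta_tangent(1)[OF assms u(1)] c u(2)] beta_at(2)[OF assms u(1)]
      by (simp add: prod_eq_iff)
  qed
  have "smooth_on ?S ?h"
  proof (rule smooth_on_linear_family_solution[where F = "\<lambda>z y. ?K z (0, y)", OF open_slit[OF c]])
    fix z assume z: "z \<in> ?S"
    note u = cinv_slit_in[OF c z]
    show l: "linear (\<lambda>y. ?K z (0, y))"
      using linear_compose[OF _ K(1)[OF z], of "Pair 0"] by (simp add: linear_iff o_def)
    show "inj (\<lambda>y. ?K z (0, y))"
      unfolding linear_injective_0[OF l]
    proof (intro allI impI)
      fix y assume y: "?K z (0, y) = 0"
      let ?a = "coord_vec SA (sc c) (0, y) (cinv (sc c) z)"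
      have a: "?a \<in> tangent_space SA (cinv (sc c) z)" by (rule slit_coord_vec_tangent[OF c u])
      have comp: "?a (sc c) = (0, y)" by (rule slit_coord_vec_component[OF c u])
      have "?a = 0"
      proof (rule regular_vertical_horizontal[OF assms(1) u(1) a])
        show "rho_at \<A> (cinv (sc c) z) ?a = 0"
          using rho_at_component[OF u(1) a c u(2)] comp
          by (intro base.tangent_space_eqI[OF rho_at_tangent[OF u(1) a] base.tangent_space_zero c u(2)]) simp
        show "D (eta \<A>) (cinv (sc c) z) ?a = 0"
          using y by (intro base.tangent_space_eqI[OF connection_tangent[OF lin eta_closed u(1) a] base.tangent_space_zero c u(2)])
             (simp add: frame_cov_def)
      qed
      then show "y = 0" using comp by (simp add: zero_prod_def)
    qed
    have "?K z (component (beta \<A> D X) (sc c) z) = 0"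
      using frame_cov_component[OF u(1) c u(2) beta_tangent(1)[OF assms u(1)], of D "eta \<A>"]
        beta_tangent(2)[OF assms u(1)] cmap_cinv[OF z] by simp
    then have "?K z ((pcomp X c z, 0) + (0, ?h z)) = 0" using pair[OF z] by simp
    then show "?K z (0, ?h z) = - ?K z (pcomp X c z, 0)"
      unfolding linear_add[OF K(1)[OF z]] by (simp add: eq_neg_iff_add_eq_0 add.commute)
  next
    show "smooth_on ?S (\<lambda>z. ?K z (0, w))" for w by (rule K(2))
    show "smooth_on ?S (\<lambda>z. - ?K z (pcomp X c z, 0))"
      by (rule smooth_on_uminus[OF open_slit[OF c] smooth_on_linear_family[where F = ?K, OF open_slit[OF c] K
            smooth_on_Pair[OF open_slit[OF c] pi_field_smooth[OF assms(2) c] smooth_on_const]]])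
  qed
  then show "smooth_on ?S (component (beta \<A> D X) (sc c))"
    by (rule smooth_on_cong[OF open_slit[OF c] smooth_on_Pair[OF open_slit[OF c] pi_field_smooth[OF assms(2) c]]])
       (rule pair[symmetric])
qed (use beta_tangent[OF assms] in \<open>auto simp: beta_def\<close>)

lemma rho_beta: "regular_connection \<A> D \<Longrightarrow> X \<in> pi_fields \<A> \<Longrightarrow> rho \<A> (beta \<A> D X) = X"
  using beta_at(2) by (auto simp: rho_def fun_eq_iff pi_field_outside)

lemma cov_beta_eta: "regular_connection \<A> D \<Longrightarrow> X \<in> pi_fields \<A> \<Longrightarrow> cov \<A> D (beta \<A> D X) (eta \<A>) = 0"
  using beta_tangent(2) by (auto simp: cov_def fun_eq_iff)

end

section \<open>The Finsler metric in charts\<close>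

lemma eventually_line:
  fixes z :: "'a::real_normed_vector"
  assumes "open S" "z \<in> S"
  shows "\<forall>\<^sub>F t in nhds 0. z + t *\<^sub>R h \<in> S"
proof -
  have "((\<lambda>t. z + t *\<^sub>R h) \<longlongrightarrow> z + 0 *\<^sub>R h) (nhds 0)"
    by (intro tendsto_add tendsto_const tendsto_scaleR filterlim_ident)
  then show ?thesis using topological_tendstoD assms by fastforce
qed

lemma deriv_line:
  fixes f :: "'a::real_normed_vector \<Rightarrow> real"
  assumes "f differentiable (at z)"
  shows "deriv (\<lambda>t. f (z + t *\<^sub>R h)) 0 = frechet_derivative f (at z) h"
proof -
  have f: "(f has_derivative frechet_derivative f (at z)) (at (z + 0 *\<^sub>R h))"
    using assms by (simp add: frechet_derivative_works[symmetric])
  have "((\<lambda>t. z + t *\<^sub>R h) has_derivative (\<lambda>r. r *\<^sub>R h)) (at 0)"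
    by (auto intro!: derivative_eq_intros)
  from has_derivative_compose[OF this f]
  have "((\<lambda>t. f (z + t *\<^sub>R h)) has_real_derivative frechet_derivative f (at z) h) (at 0)"
    unfolding has_field_derivative_def
    by (simp add: linear_cmul[OF linear_frechet_derivative[OF assms]] mult_commute_abs)
  then show ?thesis by (rule DERIV_imp_deriv)
qed

text \<open>The function \<open>r ^ Suc n * f z\<close> is differentiated directly and through the
  scaling of the fibre; the latter contributes one factor \<open>r\<close> in a vertical direction,
  which lowers the degree by one.\<close>

lemma frechet_derivative_homogeneous:
  fixes f :: "'a::real_normed_vector \<times> 'b::real_normed_vector \<Rightarrow> real"
  assumes "open S" "smooth_on S f" "r > 0" "\<And>x y. (x, y) \<in> S \<Longrightarrow> (x, r *\<^sub>R y) \<in> S"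
    and "\<And>x y. (x, y) \<in> S \<Longrightarrow> f (x, r *\<^sub>R y) = r ^ Suc n * f (x, y)" "(x, y) \<in> S"
  shows "frechet_derivative f (at (x, r *\<^sub>R y)) (0, w) = r ^ n * frechet_derivative f (at (x, y)) (0, w)"
proof -
  let ?T = "\<lambda>z. (fst z, r *\<^sub>R snd z)"
  have T: "(?T has_derivative ?T) (at (x, y))"
    by (auto intro!: derivative_eq_intros)
  have f: "(f has_derivative frechet_derivative f (at (x, r *\<^sub>R y))) (at (?T (x, y)))"
    using smooth_on_has_derivative[OF assms(2) assms(4)[OF assms(6)]] by simp
  have 1: "((\<lambda>z. r ^ Suc n * f z) has_derivative (\<lambda>h. frechet_derivative f (at (x, r *\<^sub>R y)) (?T h))) (at (x, y))"
    by (rule has_derivative_transform_within_open[OF has_derivative_compose[OF T f] assms(1,6)])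
       (auto simp: assms(5))
  have 2: "((\<lambda>z. r ^ Suc n * f z) has_derivative (\<lambda>h. r ^ Suc n * frechet_derivative f (at (x, y)) h)) (at (x, y))"
    by (intro has_derivative_mult_right smooth_on_has_derivative[OF assms(2,6)])
  have "frechet_derivative f (at (x, r *\<^sub>R y)) (?T (0, w)) = r ^ Suc n * frechet_derivative f (at (x, y)) (0, w)"
    by (rule fun_cong[OF has_derivative_unique[OF 1 2]])
  moreover have "?T (0, w) = r *\<^sub>R (0, w)" by simp
  ultimately have "r * frechet_derivative f (at (x, r *\<^sub>R y)) (0, w) = r * (r ^ n * frechet_derivative f (at (x, y)) (0, w))"
    using linear_cmul[OF smooth_on_frechet_linear[OF assms(2) assms(4)[OF assms(6)]], of r "(0, w)"]
        by auto
  then show ?thesis using assms(3) by simp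
qed

locale finsler_charts = slit_charts \<A> for \<A> :: "('m, 'e::euclidean_space) atlas" +
  fixes L :: "('m, 'e) tpoint \<Rightarrow> real"
  assumes L_smooth: "smooth_fun (slit_atlas \<A>) L"
    and L_homogeneous: "u \<in> slit_bundle \<A> \<Longrightarrow> r > 0 \<Longrightarrow> L (fst u, r *\<^sub>t snd u) = r * L u"
    and L_convex: "u \<in> slit_bundle \<A> \<Longrightarrow> v \<in> tangent_space \<A> (fst u) \<Longrightarrow> v \<noteq> 0 \<Longrightarrow>
      finsler_metric_at L u v v > 0"
begin

section \<open>The energy and its Hessian in slit charts\<close>

definition energy :: "('m, 'e) chart \<Rightarrow> 'e \<times> 'e \<Rightarrow> real" where
  "energy c z = (L (cinv (sc c) z))\<^sup>2 / 2"

text \<open>Second derivative in all chart coordinates, those of the base included, so that the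
  general results on symmetry and linearity apply as they stand; the metric is its restriction to
  vectors \<open>(0, v)\<close>.\<close>

definition hess :: "('m, 'e) chart \<Rightarrow> 'e \<times> 'e \<Rightarrow> 'e \<times> 'e \<Rightarrow> 'e \<times> 'e \<Rightarrow> real" where
  "hess c z h k = frechet_derivative (\<lambda>z. frechet_derivative (energy c) (at z) k) (at z) h"

lemma smooth_energy: 
  assumes "c \<in> \<A>"
  shows "smooth_on (crange (sc c)) (energy c)"
proof -
  have L: "smooth_on (crange (sc c)) (L \<circ> cinv (sc c))" using L_smooth assms
      by (simp add: smooth_fun_def)
  have "smooth_on (crange (sc c)) (\<lambda>z. ((L \<circ> cinv (sc c)) z * (L \<circ> cinv (sc c)) z) / 2)"
    by (rule smooth_on_linear[OF open_slit[OF assms] bounded_linear_divide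
        smooth_on_bilinear[OF open_slit[OF assms] bounded_bilinear_mult L L]])
  then show ?thesis by (simp add: energy_def[abs_def] power2_eq_square)
qed

lemma smooth_energy_deriv:
  "c \<in> \<A> \<Longrightarrow> smooth_on (crange (sc c)) (\<lambda>z. frechet_derivative (energy c) (at z) k)"
  by (rule smooth_on_frechet[OF smooth_energy])

lemma hess_sym: "c \<in> \<A> \<Longrightarrow> z \<in> crange (sc c) \<Longrightarrow> hess c z h k = hess c z k h"
  unfolding hess_def by (rule frechet_derivative_commute_real[OF open_slit smooth_energy])

lemma linear_hess: 
  assumes "c \<in> \<A>" "z \<in> crange (sc c)"
  shows "linear (\<lambda>h. hess c z h k)" "linear (hess c z h)"
proof -
  have 1: "linear (\<lambda>h. hess c z h k)" for k
    using smooth_on_frechet_linear[OF smooth_energy_deriv[OF assms(1)] assms(2)]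
        by (simp add: hess_def[abs_def])
  then show "linear (\<lambda>h. hess c z h k)" .
  have "hess c z h = (\<lambda>k. hess c z k h)" using hess_sym[OF assms] by blast
  then show "linear (hess c z h)" using 1[of h] by simp
qed

lemma smooth_hess: "c \<in> \<A> \<Longrightarrow> smooth_on (crange (sc c)) (\<lambda>z. hess c z h k)"
  unfolding hess_def by (rule smooth_on_frechet[OF smooth_energy_deriv])

lemma smooth_hess_fields:
  assumes "c \<in> \<A>" "smooth_on (crange (sc c)) Y" "smooth_on (crange (sc c)) Z"
  shows "smooth_on (crange (sc c)) (\<lambda>z. hess c z (Y z) (Z z))"
proof (rule smooth_on_linear_family[where F = "\<lambda>z. hess c z (Y z)", OF open_slit[OF assms(1)] _ _ assms(3)])
  show "smooth_on (crange (sc c)) (\<lambda>z. hess c z (Y z) w)" for w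
    unfolding hess_def
    by (rule smooth_on_frechet_field[OF open_slit[OF assms(1)] smooth_energy_deriv[OF assms(1)] assms(2)])
qed (rule linear_hess[OF assms(1)])

text \<open>Product rule in two stages: first the second argument moves, then the first with the
  second one frozen.\<close>

lemma frechet_hess_fields:
  assumes "c \<in> \<A>" "z \<in> crange (sc c)" "smooth_on (crange (sc c)) Y" "smooth_on (crange (sc c)) Z"
  shows "frechet_derivative (\<lambda>z. hess c z (Y z) (Z z)) (at z) h =
    frechet_derivative (\<lambda>y. hess c y (Y z) (Z z)) (at z) h
    + hess c z (frechet_derivative Y (at z) h) (Z z) + hess c z (Y z) (frechet_derivative Z (at z) h)"
proof -
  note o = open_slit[OF assms(1)]
  have "frechet_derivative (\<lambda>z. hess c z (Y z) (Z z)) (at z) h =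
      frechet_derivative (\<lambda>y. hess c y (Y y) (Z z)) (at z) h + hess c z (Y z) (frechet_derivative Z (at z) h)"
    by (rule frechet_derivative_linear_family[where F = "\<lambda>z. hess c z (Y z)", OF o assms(2)])
       (use assms linear_hess smooth_on_differentiable[OF smooth_hess_fields[OF assms(1,3) smooth_on_const] assms(2)]
          smooth_on_differentiable[OF assms(4,2)] in auto)
  also have "frechet_derivative (\<lambda>y. hess c y (Y y) (Z z)) (at z) h =
      frechet_derivative (\<lambda>y. hess c y (Y z) (Z z)) (at z) h
      + hess c z (frechet_derivative Y (at z) h) (Z z)"
    unfolding hess_def by (rule frechet_derivative_frechet_field[OF o smooth_energy_deriv[OF assms(1)] assms(3,2)])
  finally show ?thesis .
qed

lemma third_derivative_sym:
  assumes "c \<in> \<A>" "z \<in> crange (sc c)"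
  shows "frechet_derivative (\<lambda>y. hess c y h k) (at z) w = frechet_derivative (\<lambda>y. hess c y w k) (at z) h"
  unfolding hess_def
  by (rule frechet_derivative_commute_real[OF open_slit[OF assms(1)] smooth_energy_deriv[OF assms(1)] assms(2)])

lemma cinv_slit_shift:
  assumes "u \<in> slit_bundle \<A>" "c \<in> \<A>" "fst u \<in> cdom c" "v \<in> tangent_space \<A> (fst u)" "v c = w" "w \<noteq> 0"
  shows "cinv (sc c) (cmap c (fst u), w) = (fst u, v)"
proof -
  have "(fst u, v) \<in> slit_bundle \<A>" using assms by (intro slit_bundleI[of c]) auto
  then show ?thesis
    using slit_cinv_cmap[of "(fst u, v)" c] assms by (simp add: cmap_slit_chart)
qed

lemma energy_shift:
  assumes "u \<in> slit_bundle \<A>" "c \<in> \<A>" "fst u \<in> cdom c" "v \<in> tangent_space \<A> (fst u)" "w \<in> tangent_space \<A> (fst u)"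
    and "cmap (sc c) u + s *\<^sub>R (0, v c) + t *\<^sub>R (0, w c) \<in> crange (sc c)"
  shows "(L (fst u, snd u + s *\<^sub>t v + t *\<^sub>t w))\<^sup>2 / 2 = energy c (cmap (sc c) u + s *\<^sub>R (0, v c) + t *\<^sub>R (0, w c))"
proof -
  have T: "snd u + s *\<^sub>t v + t *\<^sub>t w \<in> tangent_space \<A> (fst u)"
    by (intro base.tangent_space_add base.tangent_space_scale assms slit_bundleD(2))
  have z: "cmap (sc c) u + s *\<^sub>R (0, v c) + t *\<^sub>R (0, w c) = (cmap c (fst u), snd u c + s *\<^sub>R v c + t *\<^sub>R w c)"
    by (simp add: cmap_slit_chart)
  show ?thesis
    using cinv_slit_shift[OF assms(1-3) T] assms(6) crange_slit_chart[OF assms(2)]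
    unfolding z by (simp add: energy_def tscale_def)
qed

text \<open>The nested derivatives run along lines that may meet the zero vector, where
  \<open>energy\<close> does not represent \<open>L\<close>. Only small parameters matter, and for
  these the shifted vector stays in the open chart image.\<close>

lemma finsler_metric_at_chart:
  assumes "u \<in> slit_bundle \<A>" "c \<in> \<A>" "fst u \<in> cdom c" "v \<in> tangent_space \<A> (fst u)" "w \<in> tangent_space \<A> (fst u)"
  shows "finsler_metric_at L u v w = hess c (cmap (sc c) u) (0, v c) (0, w c)"
proof -
  let ?z = "cmap (sc c) u" and ?S = "crange (sc c)"
  note o = open_slit[OF assms(2)]
  have z: "?z \<in> ?S" by (rule slit_cmap_in[OF assms(1,3)])
  have inner: "deriv (\<lambda>t. (L (fst u, snd u + s *\<^sub>t v + t *\<^sub>t w))\<^sup>2 / 2) 0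
      = frechet_derivative (energy c) (at (?z + s *\<^sub>R (0, v c))) (0, w c)"
    if s: "?z + s *\<^sub>R (0, v c) \<in> ?S" for s
  proof -
    have "\<forall>\<^sub>F t in nhds 0. (L (fst u, snd u + s *\<^sub>t v + t *\<^sub>t w))\<^sup>2 / 2 = energy c (?z + s *\<^sub>R (0, v c) + t *\<^sub>R (0, w c))"
      using eventually_line[OF o s, of "(0, w c)"] by eventually_elim (rule energy_shift[OF assms])
    then show ?thesis
      by (rule trans[OF deriv_cong_ev[OF _ refl] deriv_line[OF smooth_on_differentiable[OF smooth_energy[OF assms(2)] s]]])
  qed
  have "\<forall>\<^sub>F s in nhds 0. deriv (\<lambda>t. (L (fst u, snd u + s *\<^sub>t v + t *\<^sub>t w))\<^sup>2 / 2) 0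
      = frechet_derivative (energy c) (at (?z + s *\<^sub>R (0, v c))) (0, w c)"
    using eventually_line[OF o z, of "(0, v c)"] by eventually_elim (rule inner)
  then show ?thesis
    unfolding finsler_metric_at_def hess_def
    by (rule trans[OF deriv_cong_ev[OF _ refl] deriv_line[OF smooth_on_differentiable[OF smooth_energy_deriv[OF assms(2)] z]]])
qed

lemma finsler_metric_chart:
  assumes "X \<in> pi_fields \<A>" "Y \<in> pi_fields \<A>" "u \<in> slit_bundle \<A>" "c \<in> \<A>" "fst u \<in> cdom c"
  shows "finsler_metric \<A> L X Y u = hess c (cmap (sc c) u) (0, X u c) (0, Y u c)"
  using finsler_metric_at_chart[OF assms(3-5)] pi_field_tangent assms by (simp add: finsler_metric_def)

lemma finsler_metric_cinv:
  assumes "X \<in> pi_fields \<A>" "Y \<in> pi_fields \<A>" "c \<in> \<A>" "z \<in> crange (sc c)"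
  shows "finsler_metric \<A> L X Y (cinv (sc c) z) = hess c z (0, pcomp X c z) (0, pcomp Y c z)"
  using finsler_metric_chart[OF assms(1,2) cinv_slit_in(1)[OF assms(3,4)] assms(3) cinv_slit_in(2)[OF assms(3,4)]]
    cmap_cinv[OF assms(4)] by simp

lemma finsler_metric_outside: "u \<notin> slit_bundle \<A> \<Longrightarrow> finsler_metric \<A> L X Y u = 0"
  by (simp add: finsler_metric_def)

lemma vertical_smooth: "X \<in> pi_fields \<A> \<Longrightarrow> c \<in> \<A> \<Longrightarrow> smooth_on (crange (sc c)) (\<lambda>z. (0 :: 'e, pcomp X c z))"
  by (intro smooth_on_Pair open_slit smooth_on_const pi_field_smooth)

lemma finsler_metric_smooth:
  assumes "X \<in> pi_fields \<A>" "Y \<in> pi_fields \<A>"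
  shows "smooth_fun SA (finsler_metric \<A> L X Y)"
  unfolding smooth_fun_def
proof
  fix c' assume "c' \<in> SA"
  then obtain c where c: "c \<in> \<A>" "c' = sc c" by (auto simp: slit_atlas_def)
  show "smooth_on (crange c') (finsler_metric \<A> L X Y \<circ> cinv c')"
    unfolding c(2)
    by (rule smooth_on_cong[OF open_slit[OF c(1)] smooth_hess_fields[OF c(1) vertical_smooth[OF assms(1) c(1)]
          vertical_smooth[OF assms(2) c(1)]]])
       (simp add: finsler_metric_cinv assms c)
qed

lemma finsler_metric_add_left:
  assumes "X \<in> pi_fields \<A>" "Y \<in> pi_fields \<A>" "Z \<in> pi_fields \<A>"
  shows "finsler_metric \<A> L (X + Y) Z u = finsler_metric \<A> L X Z u + finsler_metric \<A> L Y Z u"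
proof (cases "u \<in> slit_bundle \<A>")
  case True
  then obtain c where c: "c \<in> \<A>" "fst u \<in> cdom c" by (rule slit_chart_exists)
  have "finsler_metric \<A> L (X + Y) Z u = hess c (cmap (sc c) u) ((0, X u c) + (0, Y u c)) (0, Z u c)"
    by (simp add: finsler_metric_chart[OF _ _ True c] assms pi_fields_add)
  then show ?thesis
    by (simp only: linear_add[OF linear_hess(1)[OF c(1) slit_cmap_in[OF True c(2)]]]
        finsler_metric_chart[OF _ _ True c] assms)
qed (simp add: finsler_metric_outside)

lemma finsler_metric_sym:
  assumes "X \<in> pi_fields \<A>" "Y \<in> pi_fields \<A>"
  shows "finsler_metric \<A> L X Y = finsler_metric \<A> L Y X"
proof
  fix u
  show "finsler_metric \<A> L X Y u = finsler_metric \<A> L Y X u"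
  proof (cases "u \<in> slit_bundle \<A>")
    case True
    then obtain c where c: "c \<in> \<A>" "fst u \<in> cdom c" by (rule slit_chart_exists)
    then show ?thesis
      using hess_sym[OF c(1) slit_cmap_in[OF True c(2)]]
      by (simp add: finsler_metric_chart[OF _ _ True c] assms)
  qed (simp add: finsler_metric_outside)
qed

lemma finsler_metric_definite:
  assumes "X \<in> pi_fields \<A>" "\<And>u. finsler_metric \<A> L X X u = 0"
  shows "X = 0"
proof
  fix u
  show "X u = 0 u"
  proof (cases "u \<in> slit_bundle \<A>")
    case True
    then show ?thesis
      using L_convex[OF True pi_field_tangent[OF assms(1) True]] assms(2)[of u]
      by (auto simp: finsler_metric_def)
  qed (simp add: pi_field_outside[OF assms(1)])
qed

text \<open>The connection supplies a global smooth lift of \<open>Y\<close>; its bracket with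
  \<open>gamma \<A> X\<close> projects to \<open>vderiv X Y\<close>, which replaces a verification
  in charts.\<close>

lemma vderiv_closed:
  assumes "regular_connection \<A> N" "X \<in> pi_fields \<A>" "Y \<in> pi_fields \<A>"
  shows "vderiv X Y \<in> pi_fields \<A>"
  using rho_lie_bracket_gamma[OF assms(2) beta_closed[OF assms(1,3)]] rho_beta[OF assms(1,3)]
    rho_closed[OF slit.lie_bracket_closed[OF gamma_closed[OF assms(2)] beta_closed[OF assms(1,3)]]]
        by simp

text \<open>The two flat derivatives remove exactly the variation of the arguments, leaving a third
  derivative of the energy with frozen vertical directions.\<close>

lemma vertical_derivative_metric:
  assumes "X \<in> pi_fields \<A>" "Y \<in> pi_fields \<A>" "Z \<in> pi_fields \<A>"
    and "vderiv X Y \<in> pi_fields \<A>" "vderiv X Z \<in> pi_fields \<A>"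
    and u: "u \<in> slit_bundle \<A>" and c: "c \<in> \<A>" "fst u \<in> cdom c"
  shows "field_act SA (gamma \<A> X) (finsler_metric \<A> L Y Z) u
      - finsler_metric \<A> L (vderiv X Y) Z u - finsler_metric \<A> L Y (vderiv X Z) u
    = frechet_derivative (\<lambda>z. hess c z (0, Y u c) (0, Z u c)) (at (cmap (sc c) u)) (0, X u c)"
proof -
  let ?z = "cmap (sc c) u" and ?S = "crange (sc c)"
  note o = open_slit[OF c(1)]
  have z: "?z \<in> ?S" by (rule slit_cmap_in[OF u c(2)])
  have pair: "frechet_derivative (\<lambda>z. (0 :: 'e, pcomp Y c z)) (at ?z) h = (0, frechet_derivative (pcomp Y c) (at ?z) h)"
    if "Y \<in> pi_fields \<A>" for Y h
    using frechet_derivative_at[OF has_derivative_Pair[OF has_derivative_const smooth_on_has_derivative[OF pi_field_smooth[OF that c(1)] z]]]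
    by metis
  have "field_act SA (gamma \<A> X) (finsler_metric \<A> L Y Z) u =
      frechet_derivative (finsler_metric \<A> L Y Z \<circ> cinv (sc c)) (at ?z) (gamma \<A> X u (sc c))"
    by (rule slit.field_act_chart) (simp_all add: gamma_closed finsler_metric_smooth assms c u cdom_slit_chart)
  also have "frechet_derivative (finsler_metric \<A> L Y Z \<circ> cinv (sc c)) (at ?z) =
      frechet_derivative (\<lambda>z. hess c z (0, pcomp Y c z) (0, pcomp Z c z)) (at ?z)"
    by (rule frechet_derivative_transform_within_open[OF smooth_on_differentiable[OF smooth_hess_fields[OF c(1)
        vertical_smooth[OF assms(2) c(1)] vertical_smooth[OF assms(3) c(1)]] z] o z, symmetric])
       (simp add: finsler_metric_cinv assms c)
  finally show ?thesis
    using frechet_hess_fields[OF c(1) z vertical_smooth[OF assms(2) c(1)] vertical_smooth[OF assms(3) c(1)], of "(0, X u c)"]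
      slit_cinv_cmap[OF u c]
    by (simp add: pair assms gamma_component u c finsler_metric_chart[OF _ _ u c] vderiv_component)
qed

text \<open>The energy is homogeneous of degree 2, and each of two vertical differentiations lowers
  the degree by one.\<close>

lemma hess_homogeneous:
  assumes "c \<in> \<A>" "(x, y) \<in> crange (sc c)" "r > 0"
  shows "hess c (x, r *\<^sub>R y) (0, v) (0, w) = hess c (x, y) (0, v) (0, w)"
proof -
  note o = open_slit[OF assms(1)]
  have S: "(x, r *\<^sub>R y) \<in> crange (sc c)" if "(x, y) \<in> crange (sc c)" for x y
    using that assms(3) by (simp add: crange_slit_chart[OF assms(1)])
  have L: "L (cinv (sc c) (x, r *\<^sub>R y)) = r * L (cinv (sc c) (x, y))" if z: "(x, y) \<in> crange (sc c)"
      for x y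
  proof -
    let ?u = "cinv (sc c) (x, y)"
    note u = cinv_slit_in[OF assms(1) z]
    have "(x, y) \<in> crange c \<times> (- {0})" using z unfolding crange_slit_chart[OF assms(1)] .
    then have "cmap c (fst ?u) = x" "snd ?u c = y" "y \<noteq> 0"
      using cmap_cinv[OF z] by (simp_all add: cmap_slit_chart)
    then have "cinv (sc c) (x, r *\<^sub>R y) = (fst ?u, r *\<^sub>t snd ?u)"
      using cinv_slit_shift[OF u(1) assms(1) u(2) base.tangent_space_scale[OF slit_bundleD(2)[OF u(1)], of r], of "r *\<^sub>R y"] assms(3)
      by (simp add: tscale_def)
    then show ?thesis using L_homogeneous[OF u(1) assms(3)] by simp
  qed
  have e: "energy c (x, r *\<^sub>R y) = r ^ Suc (Suc 0) * energy c (x, y)" if "(x, y) \<in> crange (sc c)" for x y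
    using L[OF that] by (simp add: energy_def power_mult_distrib power2_eq_square)
  have "frechet_derivative (energy c) (at (x, r *\<^sub>R y)) (0, w) = r ^ Suc 0 * frechet_derivative (energy c) (at (x, y)) (0, w)"
    if "(x, y) \<in> crange (sc c)" for x y
    by (rule frechet_derivative_homogeneous[OF o smooth_energy[OF assms(1)] assms(3) S e that])
  then show ?thesis
    using frechet_derivative_homogeneous[OF o smooth_energy_deriv[OF assms(1)] assms(3) S _ assms(2), of "(0, w)" 0 v]
    by (simp add: hess_def)
qed

lemma third_derivative_radial:
  assumes "u \<in> slit_bundle \<A>" "c \<in> \<A>" "fst u \<in> cdom c"
  shows "frechet_derivative (\<lambda>z. hess c z (0, v) (0, w)) (at (cmap (sc c) u)) (0, snd u c) = 0"
proof -
  let ?z = "cmap (sc c) u"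
  have z: "?z \<in> crange (sc c)" by (rule slit_cmap_in[OF assms(1,3)])
  \<comment> \<open>For \<open>t > -1\<close> the shift along the vector itself is scaling by
    \<open>1 + t > 0\<close>, under which the Hessian is constant.\<close>
  have "\<forall>\<^sub>F t :: real in nhds 0. t \<in> {-1<..}"
    by (rule eventually_nhds_in_open) auto
  then have "\<forall>\<^sub>F t in nhds 0. hess c (?z + t *\<^sub>R (0, snd u c)) (0, v) (0, w) = hess c ?z (0, v) (0, w)"
  proof eventually_elim
    case (elim t)
    have "?z + t *\<^sub>R (0, snd u c) = (cmap c (fst u), (1 + t) *\<^sub>R snd u c)"
      by (simp add: cmap_slit_chart scaleR_add_left)
    then show ?case
      using hess_homogeneous[OF assms(2), of "cmap c (fst u)" "snd u c" "1 + t"] z elim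
      by (simp add: cmap_slit_chart)
  qed
  from deriv_cong_ev[OF this refl]
  have "deriv (\<lambda>t. hess c (?z + t *\<^sub>R (0, snd u c)) (0, v) (0, w)) 0 = 0"
    unfolding deriv_const .
  then show ?thesis
    unfolding deriv_line[OF smooth_on_differentiable[OF smooth_hess[OF assms(2)] z]] .
qed

end

section \<open>From Finsler manifolds and their connections to the abstract calculus\<close>

lemma smooth_charts_smooth_atlas:
  assumes "smooth_atlas M \<A>"
  shows "smooth_charts \<A>"
proof
  have chart: "openin M (cdom c)" "open (crange c)"
    "homeomorphic_map (subtopology M (cdom c)) (top_of_set (crange c)) (cmap c)"
    and topspace: "topspace (subtopology M (cdom c)) = cdom c" if "c \<in> \<A>" for c
  proof -
    show 1: "openin M (cdom c)" "open (crange c)"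
      "homeomorphic_map (subtopology M (cdom c)) (top_of_set (crange c)) (cmap c)"
      using assms that unfolding smooth_atlas_def by blast+
    show "topspace (subtopology M (cdom c)) = cdom c"
      using openin_subset[OF 1(1)] by auto
  qed
  show "inj_on (cmap c) (cdom c)" if "c \<in> \<A>" for c
    using homeomorphic_imp_injective_map[OF chart(3)[OF that]] topspace[OF that] by simp
  show "open (cmap c ` (cdom c \<inter> cdom d))" if "c \<in> \<A>" "d \<in> \<A>" for c d
  proof -
    have "openin (subtopology M (cdom c)) (cdom c \<inter> cdom d)"
      by (rule openin_subtopology_Int2[OF chart(1)[OF that(2)]])
    then have "openin (top_of_set (crange c)) (cmap c ` (cdom c \<inter> cdom d))"
      using homeomorphic_imp_open_map[OF chart(3)[OF that(1)]] unfolding open_map_def by blast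
    then show ?thesis using openin_open_trans chart(2)[OF that(1)] by blast
  qed
  show "smooth_on (cmap c ` (cdom c \<inter> cdom d)) (cmap d \<circ> cinv c)" if "c \<in> \<A>" "d \<in> \<A>" for c d
    using assms that unfolding smooth_atlas_def by blast
qed

lemma finsler_charts_finsler_manifold:
  assumes "finsler_manifold M \<A> L"
  shows "finsler_charts \<A> L"
proof -
  have atlas: "smooth_atlas M \<A>" and smooth: "smooth_fun (slit_atlas \<A>) L"
    and homogeneous: "\<forall>(p, v)\<in>tangent_bundle \<A>. \<forall>r>0. L (p, r *\<^sub>t v) = r * L (p, v)"
    and convex: "\<forall>u\<in>slit_bundle \<A>. \<forall>v\<in>tangent_space \<A> (fst u). v \<noteq> 0 \<longrightarrow> finsler_metric_at L u v v > 0"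
    using assms unfolding finsler_manifold_def smooth_manifold_def by simp_all
  interpret smooth_charts \<A> by (rule smooth_charts_smooth_atlas[OF atlas])
  show ?thesis
  proof
    show "L (fst u, r *\<^sub>t snd u) = r * L u" if "u \<in> slit_bundle \<A>" "r > 0" for u r
    proof -
      have "u \<in> tangent_bundle \<A>" using that(1)
          by (simp add: slit_bundle_def tangent_bundle_def case_prod_unfold)
      then show ?thesis using bspec[OF homogeneous] that(2) by (simp add: case_prod_unfold)
    qed
  qed (use smooth convex in blast)+
qed

context finsler_charts
begin

text \<open>The regular connection enters through \<open>vderiv_closed\<close>, needed before flat
  derivatives can be inserted into the metric. The two metric axioms are the symmetry and the radial
  vanishing of the third derivative of the energy.\<close>

lemma pullback_calculus:
  assumes "regular_connection \<A> D"
  shows "pullback_calculus (vector_fields SA) (pi_fields \<A>) {f. smooth_fun SA f} (lie_bracket SA)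
    (rho \<A>) (gamma \<A>) (field_act SA) (finsler_metric \<A> L) (eta \<A>) vderiv"
proof (unfold_locales, unfold mem_Collect_eq)
  show "field_act SA (gamma \<A> X) (finsler_metric \<A> L Y Z) u - finsler_metric \<A> L (vderiv X Y) Z u
      - finsler_metric \<A> L Y (vderiv X Z) u =
    field_act SA (gamma \<A> Y) (finsler_metric \<A> L X Z) u - finsler_metric \<A> L (vderiv Y X) Z u
      - finsler_metric \<A> L X (vderiv Y Z) u"
    if X: "X \<in> pi_fields \<A>" and Y: "Y \<in> pi_fields \<A>" and Z: "Z \<in> pi_fields \<A>" for X Y Z u
  proof (cases "u \<in> slit_bundle \<A>")
    case True
    then obtain c where c: "c \<in> \<A>" "fst u \<in> cdom c" by (rule slit_chart_exists)
    show ?thesis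
      using third_derivative_sym[OF c(1) slit_cmap_in[OF True c(2)], of "(0, Y u c)" "(0, Z u c)" "(0, X u c)"]
        vertical_derivative_metric[OF X Y Z vderiv_closed[OF assms X Y] vderiv_closed[OF assms X Z] True c]
        vertical_derivative_metric[OF Y X Z vderiv_closed[OF assms Y X] vderiv_closed[OF assms Y Z] True c]
      by simp
  qed (simp add: finsler_metric_outside field_act_def points_slit_atlas)
  show "field_act SA (gamma \<A> (eta \<A>)) (finsler_metric \<A> L Y Z) u =
      finsler_metric \<A> L (vderiv (eta \<A>) Y) Z u + finsler_metric \<A> L Y (vderiv (eta \<A>) Z) u"
    if Y: "Y \<in> pi_fields \<A>" and Z: "Z \<in> pi_fields \<A>" for Y Z u
  proof (cases "u \<in> slit_bundle \<A>")
    case True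
    then obtain c where c: "c \<in> \<A>" "fst u \<in> cdom c" by (rule slit_chart_exists)
    show ?thesis
      using third_derivative_radial[OF True c, of "Y u c" "Z u c"] True
        vertical_derivative_metric[OF eta_closed Y Z vderiv_closed[OF assms eta_closed Y]
          vderiv_closed[OF assms eta_closed Z] True c]
      by (simp add: eta_def)
  qed (simp add: finsler_metric_outside field_act_def points_slit_atlas)
qed (simp_all add: slit.vector_fields_zero slit.vector_fields_add slit.vector_fields_minus pi_fields_zero
    pi_fields_add pi_fields_minus slit.smooth_fun_add eta_closed slit.lie_bracket_closed
    slit.lie_bracket_add_left slit.lie_bracket_jacobi rho_closed rho_add gamma_closed
    gamma_add rho_gamma vertical_eq_gamma rho_lie_bracket_gamma vderiv_eta slit.field_act_add
    slit.field_act_lie_bracket finsler_metric_smooth finsler_metric_add_left finsler_metric_definite,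
   rule slit.lie_bracket_antisym, rule finsler_metric_sym)

lemma regular_calculus:
  assumes "regular_connection \<A> D"
  shows "regular_calculus (vector_fields SA) (pi_fields \<A>) {f. smooth_fun SA f} (lie_bracket SA)
    (rho \<A>) (gamma \<A>) (field_act SA) (finsler_metric \<A> L) (eta \<A>) vderiv (cov \<A> D) (beta \<A> D)"
proof -
  interpret pullback_calculus "vector_fields SA" "pi_fields \<A>" "{f. smooth_fun SA f}" "lie_bracket SA"
    "rho \<A>" "gamma \<A>" "field_act SA" "finsler_metric \<A> L" "eta \<A>" vderiv
    by (rule pullback_calculus[OF assms])
  note lin = regular_linear[OF assms]
  show ?thesis
    by unfold_locales
       (simp_all add: cov_closed[OF lin] cov_add[OF lin] cov_add_vec[OF lin] beta_closed[OF assms]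
         rho_beta[OF assms] cov_beta_eta[OF assms] regular_cov_gamma_eta[OF assms])
qed

lemma cartan_calculus:
  assumes "cartan_connection \<A> L N"
  shows "cartan_calculus (vector_fields SA) (pi_fields \<A>) {f. smooth_fun SA f} (lie_bracket SA)
    (rho \<A>) (gamma \<A>) (field_act SA) (finsler_metric \<A> L) (eta \<A>) vderiv (cov \<A> N) (beta \<A> N)"
proof -
  interpret regular_calculus "vector_fields SA" "pi_fields \<A>" "{f. smooth_fun SA f}" "lie_bracket SA"
    "rho \<A>" "gamma \<A>" "field_act SA" "finsler_metric \<A> L" "eta \<A>" vderiv "cov \<A> N" "beta \<A> N"
    using assms by (intro regular_calculus) (simp add: cartan_connection_def)
  have tor: "tor V W = torsion \<A> N V W" for V W
    by (simp add: tor_def torsion_def)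
  show ?thesis
  proof
    fix V Y Z u assume "V \<in> vector_fields SA" "Y \<in> pi_fields \<A>" "Z \<in> pi_fields \<A>"
    then have "cov_form2 \<A> N V (finsler_metric \<A> L) Y Z u = 0"
      using assms by (simp add: cartan_connection_def)
    then show "field_act SA V (finsler_metric \<A> L Y Z) u =
        finsler_metric \<A> L (cov \<A> N V Y) Z u + finsler_metric \<A> L Y (cov \<A> N V Z) u"
      by (simp add: cov_form2_def)
  next
    fix X Y assume "X \<in> pi_fields \<A>" "Y \<in> pi_fields \<A>"
    then show "tor (beta \<A> N X) (beta \<A> N Y) = 0"
      using assms by (simp add: cartan_connection_def h_torsion_def tor)
  next
    fix X Y Z u assume "X \<in> pi_fields \<A>" "Y \<in> pi_fields \<A>" "Z \<in> pi_fields \<A>"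
    then show "finsler_metric \<A> L (T X Y) Z u = finsler_metric \<A> L (T X Z) Y u"
      using assms by (simp add: cartan_connection_def hv_torsion_def T_def tor)
  qed
qed

lemma chern_calculus:
  assumes "cartan_connection \<A> L N" "chern_connection \<A> L N D"
  shows "chern_calculus (vector_fields SA) (pi_fields \<A>) {f. smooth_fun SA f} (lie_bracket SA)
    (rho \<A>) (gamma \<A>) (field_act SA) (finsler_metric \<A> L) (eta \<A>) vderiv (cov \<A> N) (beta \<A> N)
    (cov \<A> D) (beta \<A> D)"
proof -
  interpret N: cartan_calculus "vector_fields SA" "pi_fields \<A>" "{f. smooth_fun SA f}" "lie_bracket SA"
    "rho \<A>" "gamma \<A>" "field_act SA" "finsler_metric \<A> L" "eta \<A>" vderiv "cov \<A> N" "beta \<A> N"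
    by (rule cartan_calculus[OF assms(1)])
  interpret D: regular_calculus "vector_fields SA" "pi_fields \<A>" "{f. smooth_fun SA f}" "lie_bracket SA"
    "rho \<A>" "gamma \<A>" "field_act SA" "finsler_metric \<A> L" "eta \<A>" vderiv "cov \<A> D" "beta \<A> D"
    using assms(2) by (intro regular_calculus) (simp add: chern_connection_def)
  show ?thesis
  proof
    fix V W assume "V \<in> vector_fields SA" "W \<in> vector_fields SA"
    then have "torsion \<A> D V W = 0" using assms(2) by (simp add: chern_connection_def)
    then show "D.tor V W = 0" by (simp add: D.tor_def torsion_def)
  next
    fix V Y Z u assume V: "V \<in> vector_fields SA" "Y \<in> pi_fields \<A>" "Z \<in> pi_fields \<A>"
    have T: "N.T X Y = hv_torsion \<A> N X Y" for X Y
      by (simp add: N.T_def N.tor_def hv_torsion_def torsion_def)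
    show "field_act SA V (finsler_metric \<A> L Y Z) u =
      finsler_metric \<A> L (cov \<A> D V Y) Z u + finsler_metric \<A> L Y (cov \<A> D V Z) u
      + 2 * finsler_metric \<A> L (N.T (cov \<A> D V (eta \<A>)) Y) Z u"
    \<comment> \<open>The Chern condition is imposed on the slit bundle; elsewhere both sides are 0
      by the default values.\<close>
    proof (cases "u \<in> slit_bundle \<A>")
      case True
      then have "cov_form2 \<A> D V (finsler_metric \<A> L) Y Z u
          = 2 * hv_torsion_form \<A> L N (conn_map \<A> D V) Y Z u"
        using assms(2) V by (simp add: chern_connection_def)
      then show ?thesis by (simp add: cov_form2_def hv_torsion_form_def conn_map_def T)
    qed (simp add: finsler_metric_outside field_act_def points_slit_atlas)
  qed
qed

end

theorem theorem5p5:
  fixes M :: "'m topology"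
    and \<A> :: "('m, 'e::euclidean_space) atlas"
    and L :: "('m, 'e) tpoint \<Rightarrow> real"
    and N D :: "('m, 'e) connection"
    and X Y Z W :: "('m, 'e) pi_field"
    and u :: "('m, 'e) tpoint"
  assumes "finsler_manifold M \<A> L"
    and "cartan_connection \<A> L N"
    and "chern_connection \<A> L N D"
    and "X \<in> pi_fields \<A>" and "Y \<in> pi_fields \<A>" and "Z \<in> pi_fields \<A>" and "W \<in> pi_fields \<A>"
    and "u \<in> slit_bundle \<A>"
  shows
    "\<comment> \<open>(a)\<close>
     hv_curvature_form \<A> L D X Y Z W u + hv_curvature_form \<A> L D X Y W Z u
       = 2 * cov_form3 \<A> D (beta \<A> N X) (hv_torsion_form \<A> L N) Y Z W u
         - 2 * hv_torsion_form \<A> L N (hv_curvature_hat \<A> D X Y) Z W u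
    \<and> \<comment> \<open>(b)\<close>
     hv_curvature \<A> D X Y Z u = hv_curvature \<A> D Z Y X u
    \<and> \<comment> \<open>(c)\<close>
     hv_curvature_form \<A> L D X Y Z W u
       = cov_form3 \<A> D (beta \<A> N X) (hv_torsion_form \<A> L N) Y Z W u
         + cov_form3 \<A> D (beta \<A> N Z) (hv_torsion_form \<A> L N) Y W X u
         - cov_form3 \<A> D (beta \<A> N W) (hv_torsion_form \<A> L N) Y X Z u
         + hv_torsion_form \<A> L N (hv_curvature_hat \<A> D W Y) X Z u
         - hv_torsion_form \<A> L N (hv_curvature_hat \<A> D X Y) Z W u
         - hv_torsion_form \<A> L N (hv_curvature_hat \<A> D Z Y) W X u
    \<and> \<comment> \<open>(d)\<close>
     hv_curvature_hat \<A> D (eta \<A>) X u = 0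
    \<and> \<comment> \<open>(e)\<close>
     hv_curvature_hat \<A> D X Y u = hv_curvature_hat \<A> N X Y u
    \<and> hv_curvature_hat \<A> N X Y u
       = cov_map2 \<A> D (beta \<A> N (eta \<A>)) (hv_torsion \<A> N) X Y u
    \<and> \<comment> \<open>(f)\<close>
     hv_curvature_hat \<A> D X Y u = hv_curvature_hat \<A> D Y X u
    \<and> \<comment> \<open>(g)\<close>
     hv_curvature \<A> D X (eta \<A>) Y u = 0
    \<and> hv_curvature \<A> D (eta \<A>) X Y u
       = cov_map2 \<A> D (beta \<A> N (eta \<A>)) (hv_torsion \<A> N) X Y u
    \<and> \<comment> \<open>(h)\<close>
     cov_map3 \<A> D (gamma \<A> X) (hv_curvature \<A> D) Z Y W u
       = cov_map3 \<A> D (gamma \<A> Y) (hv_curvature \<A> D) Z X W u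
    \<and> \<comment> \<open>(i)\<close>
     cov_map3 \<A> D (gamma \<A> (eta \<A>)) (hv_curvature \<A> D) X Y Z u = - hv_curvature \<A> D X Y Z u"
proof -
  interpret finsler_charts \<A> L by (rule finsler_charts_finsler_manifold[OF assms(1)])
  interpret chern_calculus "vector_fields (slit_atlas \<A>)" "pi_fields \<A>" "{f. smooth_fun (slit_atlas \<A>) f}"
    "lie_bracket (slit_atlas \<A>)" "rho \<A>" "gamma \<A>" "field_act (slit_atlas \<A>)" "finsler_metric \<A> L"
    "eta \<A>" vderiv "cov \<A> N" "beta \<A> N" "cov \<A> D" "beta \<A> D"
    by (rule chern_calculus[OF assms(2,3)])
  have PN: "hv_curvature \<A> N = N.P"
    by (intro ext) (simp add: hv_curvature_def curvature_def N.P_def N.curv_def)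
  have PD: "hv_curvature \<A> D = D.P"
    by (intro ext) (simp add: hv_curvature_def curvature_def D.P_def D.curv_def)
  have T: "hv_torsion \<A> N = N.T"
    by (intro ext) (simp add: hv_torsion_def torsion_def N.T_def N.tor_def)
  have form: "cov_form3 \<A> D V (hv_torsion_form \<A> L N) X Y Z u = DT V X Y Z u" for V X Y Z
    by (simp add: cov_form3_def hv_torsion_form_def DT_def T)
  have map2: "cov_map2 \<A> D V (hv_torsion \<A> N) X Y = DTv V X Y" for V X Y
    by (simp add: cov_map2_def DTv_def T)
  note [simp] = assms(4-7)
  have "cov_map3 \<A> D (gamma \<A> X) (hv_curvature \<A> D) Z Y W = cov_map3 \<A> D (gamma \<A> Y) (hv_curvature \<A> D) Z X W"
    unfolding cov_map3_def PD by (rule D.cov_gam_P_sym) simp_all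
  moreover have "cov_map3 \<A> D (gamma \<A> (eta \<A>)) (hv_curvature \<A> D) X Y Z = - hv_curvature \<A> D X Y Z"
    unfolding cov_map3_def PD by (rule cov_gam_eta_P) simp_all
  ultimately show ?thesis
    unfolding hv_curvature_form_def hv_curvature_hat_def form map2
    \<comment> \<open>Only unfolded now, since \<open>form\<close> and \<open>map2\<close> match
      terms that still contain \<open>hv_torsion_form\<close> and \<open>hv_torsion\<close>.\<close>
    unfolding hv_torsion_form_def PN PD T
    using P_metric[of X Y Z W u] P_formula[of X Y Z W u] D.P_sym[of X Y Z] Phat_N[of X Y]
      Phat_eq_DTv[of X Y] Phat_sym[of X Y] P_eta_left[of X Y]
    by simp
qed

end
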